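(* We have, in the sense of distributions, $$\frac{\partial\omega_\star}{\partial\bar z}=2\,\frac{\partial\zeta_\star}{\partial z}\quad\text{in }\mathcal D'(\Omega).$$
   Context: $\Omega\subset\mathbb R^2\simeq\mathbb C$ is a smooth bounded domain, $z=x_1+ix_2$, $\partial_z=\frac12(\partial_{x_1}-i\partial_{x_2})$, $\partial_{\bar z}=\frac12(\partial_{x_1}+i\partial_{x_2})$. $V:\mathbb R^k\to\mathbb R$ ($k\ge1$) is smooth with $\inf V=0$ and satisfies: (1) the zero set $\Sigma=\{V=0\}$ is finite with at least two elements; (2) $\nabla^2V(\sigma)$ is positive definite at each $\sigma\in\Sigma$; (3) there are $\alpha_\infty,R_\infty>0$ with $y\cdot\nabla V(y)\ge\alpha_\infty|y|^2$ if $|y|>R_\infty$, and $V(y)\to+\infty$ as $|y|\to+\infty$. Set $E_\varepsilon(u)=\int_\Omega\big(\varepsilon\frac{|\nabla u|^2}{2}+\frac1\varepsilon V(u)\big)dx$. Let $M_0>0$, $\varepsilon_n\in(0,1]$, $\varepsilon_n\to0$, and let $u_{\varepsilon_n}\in H^1(\Omega,\mathbb R^k)$ be solutions of $-\Delta u_{\varepsilon_n}=-\varepsilon_n^{-2}\nabla_uV(u_{\varepsilon_n})$ in $\Omega$ with $E_{\varepsilon_n}(u_{\varepsilon_n})\le M_0$. Passing to a subsequence, weakly as measures on $\Omega$: $\frac{V(u_{\varepsilon_n})}{\varepsilon_n}dx\rightharpoonup\zeta_\star$ and $\varepsilon_n\,\partial_{x_i}u_{\varepsilon_n}\cdot\partial_{x_j}u_{\varepsilon_n}\,dx\rightharpoonup\mu_{\star,i,j}$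 for $i,j=1,2$. The limiting Hopf differential is the complex-valued measure $\omega_\star=(\mu_{\star,1,1}-\mu_{\star,2,2})-2i\,\mu_{\star,1,2}$. *)

theory Defs
  imports "HOL-Analysis.Analysis"
begin

section \<open>Smooth functions, test functions, smooth domains\<close>

text \<open>These notions are used on open sets only, so that derivatives are taken at full
  neighbourhoods and iterated partial derivatives suffice.\<close>

primrec Ck_on :: "nat \<Rightarrow> 'a::euclidean_space set \<Rightarrow> ('a \<Rightarrow> 'b::real_normed_vector) \<Rightarrow> bool" where
  "Ck_on 0 S f \<longleftrightarrow> continuous_on S f"
| "Ck_on (Suc n) S f \<longleftrightarrow> (\<forall>x\<in>S. f differentiable (at x)) \<and>
     (\<forall>b\<in>Basis. Ck_on n S (\<lambda>x. frechet_derivative f (at x) b))"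

definition smooth_on :: "'a::euclidean_space set \<Rightarrow> ('a \<Rightarrow> 'b::real_normed_vector) \<Rightarrow> bool" where
  "smooth_on S f \<longleftrightarrow> (\<forall>n. Ck_on n S f)"

definition compactly_supported_in ::
    "'a::euclidean_space set \<Rightarrow> ('a \<Rightarrow> 'b::real_normed_vector) \<Rightarrow> bool" where
  "compactly_supported_in \<Omega> f \<longleftrightarrow>
     compact (closure {x. f x \<noteq> 0}) \<and> closure {x. f x \<noteq> 0} \<subseteq> \<Omega>"

definition Cc :: "'a::euclidean_space set \<Rightarrow> ('a \<Rightarrow> 'b::real_normed_vector) set" where
  "Cc \<Omega> = {\<phi>. continuous_on UNIV \<phi> \<and> compactly_supported_in \<Omega> \<phi>}"

definition test_functions :: "'a::euclidean_space set \<Rightarrow> ('a \<Rightarrow> 'b::real_normed_vector) set" where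
  "test_functions \<Omega> = {\<phi>. smooth_on UNIV \<phi> \<and> compactly_supported_in \<Omega> \<phi>}"

text \<open>Near each boundary point the domain is the negativity set of a smooth function
  without critical points.\<close>

definition smooth_bounded_domain :: "'a::euclidean_space set \<Rightarrow> bool" where
  "smooth_bounded_domain \<Omega> \<longleftrightarrow> open \<Omega> \<and> connected \<Omega> \<and> \<Omega> \<noteq> {} \<and> bounded \<Omega> \<and>
     (\<forall>p\<in>frontier \<Omega>. \<exists>U. \<exists>\<rho>::'a \<Rightarrow> real. open U \<and> p \<in> U \<and> smooth_on U \<rho> \<and>
        (\<forall>x\<in>U. frechet_derivative \<rho> (at x) \<noteq> (\<lambda>_. 0)) \<and> \<Omega> \<inter> U = {x\<in>U. \<rho> x < 0})"

section \<open>The potential\<close>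

definition gradient :: "('a::euclidean_space \<Rightarrow> real) \<Rightarrow> 'a \<Rightarrow> 'a" where
  "gradient f y = (\<Sum>b\<in>Basis. frechet_derivative f (at y) b *\<^sub>R b)"

definition hessian :: "('a::euclidean_space \<Rightarrow> real) \<Rightarrow> 'a \<Rightarrow> 'a \<Rightarrow> 'a \<Rightarrow> real" where
  "hessian f y v w = frechet_derivative (\<lambda>x. frechet_derivative f (at x) w) (at y) v"

definition multi_well_potential :: "('a::euclidean_space \<Rightarrow> real) \<Rightarrow> bool" where
  "multi_well_potential V \<longleftrightarrow>
     smooth_on UNIV V \<and> bdd_below (range V) \<and> (INF y. V y) = 0 \<and>
     finite {y. V y = 0} \<and> card {y. V y = 0} \<ge> 2 \<and>
     (\<forall>\<sigma>. V \<sigma> = 0 \<longrightarrow> (\<forall>v. v \<noteq> 0 \<longrightarrow> hessian V \<sigma> v v > 0)) \<and>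
     (\<exists>\<alpha>>0. \<exists>R>0. \<forall>y. norm y > R \<longrightarrow> y \<bullet> gradient V y \<ge> \<alpha> * (norm y)\<^sup>2) \<and>
     filterlim V at_top at_infinity"

section \<open>Sobolev functions\<close>

definition L1_loc :: "'a::euclidean_space set \<Rightarrow> ('a \<Rightarrow> 'b::euclidean_space) \<Rightarrow> bool" where
  "L1_loc \<Omega> f \<longleftrightarrow> (\<forall>K. compact K \<and> K \<subseteq> \<Omega> \<longrightarrow> f absolutely_integrable_on K)"

definition L2_on :: "'a::euclidean_space set \<Rightarrow> ('a \<Rightarrow> 'b::euclidean_space) \<Rightarrow> bool" where
  "L2_on \<Omega> f \<longleftrightarrow> f \<in> borel_measurable (lebesgue_on \<Omega>) \<and>
     integrable (lebesgue_on \<Omega>) (\<lambda>x. (norm (f x))\<^sup>2)"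

definition has_weak_partial ::
    "'a::euclidean_space set \<Rightarrow> 'a \<Rightarrow> ('a \<Rightarrow> 'b::euclidean_space) \<Rightarrow> ('a \<Rightarrow> 'b) \<Rightarrow> bool" where
  "has_weak_partial \<Omega> e u g \<longleftrightarrow> L1_loc \<Omega> u \<and> L1_loc \<Omega> g \<and>
     (\<forall>\<phi>::'a \<Rightarrow> real. \<phi> \<in> test_functions \<Omega> \<longrightarrow>
        (LINT x|lebesgue_on \<Omega>. frechet_derivative \<phi> (at x) e *\<^sub>R u x) =
        - (LINT x|lebesgue_on \<Omega>. \<phi> x *\<^sub>R g x))"

text \<open>A representative of the weak partial derivative in direction \<open>e\<close>; it is determined only
  up to a null set, and is used only under integrals.\<close>

definition weak_partial ::
    "'a::euclidean_space set \<Rightarrow> 'a \<Rightarrow> ('a \<Rightarrow> 'b::euclidean_space) \<Rightarrow> 'a \<Rightarrow> 'b" where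
  "weak_partial \<Omega> e u = (SOME g. has_weak_partial \<Omega> e u g)"

definition H1_on :: "'a::euclidean_space set \<Rightarrow> ('a \<Rightarrow> 'b::euclidean_space) \<Rightarrow> bool" where
  "H1_on \<Omega> u \<longleftrightarrow> L2_on \<Omega> u \<and> (\<forall>e\<in>Basis. \<exists>g. has_weak_partial \<Omega> e u g \<and> L2_on \<Omega> g)"

section \<open>Energy and weak solutions\<close>

text \<open>The energy of a nonnegative potential takes values in \<open>[0, \<infinity>]\<close>.\<close>

definition energy ::
    "'a::euclidean_space set \<Rightarrow> ('b::euclidean_space \<Rightarrow> real) \<Rightarrow> real \<Rightarrow> ('a \<Rightarrow> 'b) \<Rightarrow> ennreal" where
  "energy \<Omega> V \<epsilon> u = (\<integral>\<^sup>+x. ennreal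
     (\<epsilon> * ((\<Sum>e\<in>Basis. (norm (weak_partial \<Omega> e u x))\<^sup>2) / 2) + 1 / \<epsilon> * V (u x)) \<partial>lebesgue_on \<Omega>)"

text \<open>An \<open>H\<^sup>1\<close> solution, in the sense of distributions on \<open>\<Omega>\<close>, of
  \<open>- \<Delta> u = - \<epsilon>\<^sup>-\<^sup>2 \<nabla>V(u)\<close>. Local integrability of the right-hand side is what makes it a
  distribution.\<close>

definition H1_solution ::
    "'a::euclidean_space set \<Rightarrow> ('b::euclidean_space \<Rightarrow> real) \<Rightarrow> real \<Rightarrow> ('a \<Rightarrow> 'b) \<Rightarrow> bool" where
  "H1_solution \<Omega> V \<epsilon> u \<longleftrightarrow> H1_on \<Omega> u \<and> L1_loc \<Omega> (\<lambda>x. gradient V (u x)) \<and>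
     (\<forall>\<phi>::'a \<Rightarrow> real. \<phi> \<in> test_functions \<Omega> \<longrightarrow>
        (LINT x|lebesgue_on \<Omega>.
           (\<Sum>e\<in>Basis. frechet_derivative \<phi> (at x) e *\<^sub>R weak_partial \<Omega> e u x)) =
        - (1 / \<epsilon>\<^sup>2) *\<^sub>R (LINT x|lebesgue_on \<Omega>. \<phi> x *\<^sub>R gradient V (u x)))"

section \<open>Signed and complex measures\<close>

text \<open>Finite signed measures (\<open>'c = real\<close>) and complex measures (\<open>'c = complex\<close>) are
  \<open>\<sigma>\<close>-additive set functions on \<open>sets M\<close>; their values on other sets are irrelevant.\<close>

definition vector_measure :: "'a measure \<Rightarrow> ('a set \<Rightarrow> 'c::real_normed_vector) \<Rightarrow> bool" where
  "vector_measure M \<nu> \<longleftrightarrow> (\<forall>A::nat \<Rightarrow> 'a set. range A \<subseteq> sets M \<longrightarrow> disjoint_family A \<longrightarrow>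
     (\<lambda>n. \<nu> (A n)) sums \<nu> (\<Union>n. A n))"

text \<open>Jordan decomposition: the negative variation of \<open>\<nu>\<close> is the positive variation of \<open>- \<nu>\<close>.\<close>

definition positive_variation :: "'a measure \<Rightarrow> ('a set \<Rightarrow> real) \<Rightarrow> 'a measure" where
  "positive_variation M \<nu> =
     measure_of (space M) (sets M) (\<lambda>A. SUP B\<in>{B\<in>sets M. B \<subseteq> A}. ennreal (\<nu> B))"

definition signed_integral ::
    "'a measure \<Rightarrow> ('a set \<Rightarrow> real) \<Rightarrow> ('a \<Rightarrow> 'b::{banach, second_countable_topology}) \<Rightarrow> 'b" where
  "signed_integral M \<nu> f = (LINT x|positive_variation M \<nu>. f x)
     - (LINT x|positive_variation M (\<lambda>A. - \<nu> A). f x)"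

definition complex_measure_integral ::
    "'a measure \<Rightarrow> ('a set \<Rightarrow> complex) \<Rightarrow> ('a \<Rightarrow> complex) \<Rightarrow> complex" where
  "complex_measure_integral M \<kappa> f =
     signed_integral M (\<lambda>A. Re (\<kappa> A)) f + \<i> * signed_integral M (\<lambda>A. Im (\<kappa> A)) f"

abbreviation borel_on :: "'a::topological_space set \<Rightarrow> 'a measure" where
  "borel_on \<Omega> \<equiv> restrict_space borel \<Omega>"

definition weakly_as_measures ::
    "'a::euclidean_space set \<Rightarrow> (nat \<Rightarrow> 'a \<Rightarrow> real) \<Rightarrow> ('a set \<Rightarrow> real) \<Rightarrow> bool" where
  "weakly_as_measures \<Omega> f \<nu> \<longleftrightarrow> vector_measure (borel_on \<Omega>) \<nu> \<and>
     (\<forall>\<phi>::'a \<Rightarrow> real. \<phi> \<in> Cc \<Omega> \<longrightarrow>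
        (\<lambda>n. LINT x|lebesgue_on \<Omega>. \<phi> x * f n x) \<longlonglongrightarrow> signed_integral (borel_on \<Omega>) \<nu> \<phi>)"

section \<open>Distributions on planar domains\<close>

text \<open>The plane is \<open>complex\<close>, with coordinate vectors \<open>1\<close> and \<open>\<i>\<close>.\<close>

definition coord :: "nat \<Rightarrow> complex" where
  "coord i = (if i = 1 then 1 else \<i>)"

type_synonym distr = "(complex \<Rightarrow> complex) \<Rightarrow> complex"

definition distr_of_measure :: "complex set \<Rightarrow> (complex set \<Rightarrow> complex) \<Rightarrow> distr" where
  "distr_of_measure \<Omega> \<kappa> = (\<lambda>\<phi>. complex_measure_integral (borel_on \<Omega>) \<kappa> \<phi>)"

definition distr_partial :: "nat \<Rightarrow> distr \<Rightarrow> distr" where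
  "distr_partial i T = (\<lambda>\<phi>. - T (\<lambda>x. frechet_derivative \<phi> (at x) (coord i)))"

definition distr_dz :: "distr \<Rightarrow> distr" where
  "distr_dz T = (\<lambda>\<phi>. 1/2 * (distr_partial 1 T \<phi> - \<i> * distr_partial 2 T \<phi>))"

definition distr_dzbar :: "distr \<Rightarrow> distr" where
  "distr_dzbar T = (\<lambda>\<phi>. 1/2 * (distr_partial 1 T \<phi> + \<i> * distr_partial 2 T \<phi>))"

definition distr_eq_on :: "complex set \<Rightarrow> distr \<Rightarrow> distr \<Rightarrow> bool" where
  "distr_eq_on \<Omega> S T \<longleftrightarrow> (\<forall>\<phi>\<in>test_functions \<Omega>. S \<phi> = T \<phi>)"

definition limiting_hopf :: "(nat \<Rightarrow> nat \<Rightarrow> complex set \<Rightarrow> real) \<Rightarrow> complex set \<Rightarrow> complex" where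
  "limiting_hopf \<mu> = (\<lambda>A. complex_of_real (\<mu> 1 1 A - \<mu> 2 2 A) - 2 * \<i> * complex_of_real (\<mu> 1 2 A))"

end

theory Submission
  imports Defs
begin

text \<open>For a smooth solution the identity is the conservation law of the stress-energy tensor,
  \<open>\<partial>\<^sub>i (\<partial>\<^sub>i u \<bullet> \<partial>\<^sub>j u - \<delta>\<^sub>i\<^sub>j \<bar>\<nabla>u\<bar>\<^sup>2 / 2) = \<epsilon>\<^sup>-\<^sup>2 \<partial>\<^sub>j V(u)\<close>, tested and multiplied by \<open>\<epsilon>\<close>; it then passes
  to the limit because it is linear in the measures. An \<open>H\<^sup>1\<close> solution is mollified: the gradient
  terms converge because \<open>\<nabla>u\<close> is square integrable, and the potential terms because \<open>u\<close> is locally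
  bounded. For local boundedness, the coercivity of \<open>V\<close> makes \<open>\<Delta> sqrt (1 + \<bar>u\<bar>\<^sup>2)\<close> bounded
  below in the sense of distributions, and the mean value inequality for subharmonic functions
  applies. No higher regularity of \<open>u\<close> is needed.\<close>

section \<open>Finite signed measures\<close>

lemma vector_measure_sums:
  assumes "vector_measure M \<nu>" "range A \<subseteq> sets M" "disjoint_family A"
  shows "(\<lambda>n. \<nu> (A n)) sums \<nu> (\<Union>n. A n)"
  using assms by (auto simp: vector_measure_def)

lemma vector_measure_empty:
  assumes "vector_measure M \<nu>"
  shows "\<nu> {} = 0"
proof -
  have "(\<lambda>n::nat. \<nu> {}) sums \<nu> (\<Union>n::nat. {})"
    by (rule vector_measure_sums[OF assms]) (auto simp: disjoint_family_on_def)
  then have "summable (\<lambda>n::nat. \<nu> {})"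
    by (rule sums_summable)
  then show ?thesis
    by (simp add: summable_const_iff)
qed

lemma vector_measure_Un:
  assumes "vector_measure M \<nu>" "A \<in> sets M" "B \<in> sets M" "A \<inter> B = {}"
  shows "\<nu> (A \<union> B) = \<nu> A + \<nu> B"
proof -
  have "(\<lambda>n. \<nu> (binaryset A B n)) sums \<nu> (\<Union>n. binaryset A B n)"
    using assms by (intro vector_measure_sums[OF assms(1)])
      (auto simp: range_binaryset_eq disjoint_family_on_def binaryset_def)
  moreover have "(\<lambda>n. \<nu> (binaryset A B n)) sums (\<nu> A + \<nu> B)"
    by (rule binaryset_sums) (rule vector_measure_empty[OF assms(1)])
  ultimately show ?thesis
    using sums_unique2 UN_binaryset_eq by metis
qed

lemma vector_measure_Diff:
  assumes "vector_measure M \<nu>" "A \<in> sets M" "B \<in> sets M" "B \<subseteq> A"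
  shows "\<nu> (A - B) = \<nu> A - \<nu> B"
proof -
  have "\<nu> ((A - B) \<union> B) = \<nu> (A - B) + \<nu> B"
    using assms by (intro vector_measure_Un[OF assms(1)]) auto
  moreover have "(A - B) \<union> B = A"
    using assms by auto
  ultimately show ?thesis by simp
qed

lemma vector_measure_lincomb:
  fixes \<nu> \<nu>' :: "'a set \<Rightarrow> real"
  assumes "vector_measure M \<nu>" "vector_measure M \<nu>'"
  shows "vector_measure M (\<lambda>A. a * \<nu> A + b * \<nu>' A)"
  using assms unfolding vector_measure_def by (auto intro!: sums_add sums_mult)

lemma vector_measure_uminus:
  fixes \<nu> :: "'a set \<Rightarrow> real"
  assumes "vector_measure M \<nu>"
  shows "vector_measure M (\<lambda>A. - \<nu> A)"
  using assms unfolding vector_measure_def by (auto intro!: sums_minus)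

definition sup_measure_fun :: "'a measure \<Rightarrow> ('a set \<Rightarrow> real) \<Rightarrow> 'a set \<Rightarrow> ennreal" where
  "sup_measure_fun M \<nu> A = (SUP B\<in>{B\<in>sets M. B \<subseteq> A}. ennreal (\<nu> B))"

lemma sup_measure_fun_upper:
  "B \<in> sets M \<Longrightarrow> B \<subseteq> A \<Longrightarrow> ennreal (\<nu> B) \<le> sup_measure_fun M \<nu> A"
  unfolding sup_measure_fun_def by (rule SUP_upper) auto

lemma sup_measure_fun_mono: "A \<subseteq> B \<Longrightarrow> sup_measure_fun M \<nu> A \<le> sup_measure_fun M \<nu> B"
  unfolding sup_measure_fun_def by (rule SUP_subset_mono) auto

lemma sup_measure_fun_empty:
  assumes "vector_measure M \<nu>"
  shows "sup_measure_fun M \<nu> {} = 0"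
proof -
  have "{B \<in> sets M. B \<subseteq> {}} = {{}}" by auto
  then show ?thesis
    by (simp add: sup_measure_fun_def vector_measure_empty[OF assms])
qed

lemma sup_measure_fun_superadditive:
  assumes \<nu>: "vector_measure M \<nu>" and "A \<inter> B = {}"
  shows "sup_measure_fun M \<nu> A + sup_measure_fun M \<nu> B \<le> sup_measure_fun M \<nu> (A \<union> B)"
proof -
  have key: "ennreal (\<nu> C) + ennreal (\<nu> D) \<le> sup_measure_fun M \<nu> (A \<union> B)"
    if C: "C \<in> sets M" "C \<subseteq> A" and D: "D \<in> sets M" "D \<subseteq> B" for C D
  proof -
    define C' where "C' = (if \<nu> C \<ge> 0 then C else {})"
    define D' where "D' = (if \<nu> D \<ge> 0 then D else {})"
    have C': "C' \<in> sets M" "C' \<subseteq> A" "\<nu> C' \<ge> 0" "ennreal (\<nu> C) = ennreal (\<nu> C')"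
      using C vector_measure_empty[OF \<nu>] by (auto simp: C'_def ennreal_neg)
    have D': "D' \<in> sets M" "D' \<subseteq> B" "\<nu> D' \<ge> 0" "ennreal (\<nu> D) = ennreal (\<nu> D')"
      using D vector_measure_empty[OF \<nu>] by (auto simp: D'_def ennreal_neg)
    have "ennreal (\<nu> C) + ennreal (\<nu> D) = ennreal (\<nu> C' + \<nu> D')"
      using C' D' by (simp add: ennreal_plus)
    also have "\<nu> C' + \<nu> D' = \<nu> (C' \<union> D')"
      using C' D' assms(2) by (intro vector_measure_Un[OF \<nu>, symmetric]) auto
    also have "ennreal \<dots> \<le> sup_measure_fun M \<nu> (A \<union> B)"
      using C' D' by (intro sup_measure_fun_upper) auto
    finally show ?thesis .
  qed
  have ne: "{C \<in> sets M. C \<subseteq> X} \<noteq> {}" for X by auto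
  have "sup_measure_fun M \<nu> A + sup_measure_fun M \<nu> B
      = (SUP C\<in>{C\<in>sets M. C \<subseteq> A}. ennreal (\<nu> C) + sup_measure_fun M \<nu> B)"
    using ne[of A] by (simp add: sup_measure_fun_def[of M \<nu> A] ennreal_SUP_add_left)
  also have "\<dots> = (SUP C\<in>{C\<in>sets M. C \<subseteq> A}. SUP D\<in>{D\<in>sets M. D \<subseteq> B}. ennreal (\<nu> C) + ennreal (\<nu> D))"
    using ne[of B] by (simp add: sup_measure_fun_def[of M \<nu> B] ennreal_SUP_add_right)
  also have "\<dots> \<le> sup_measure_fun M \<nu> (A \<union> B)"
    by (intro SUP_least) (use key in auto)
  finally show ?thesis .
qed

lemma ennreal_sums_le_suminf:
  fixes c :: "nat \<Rightarrow> real"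
  assumes "c sums s"
  shows "ennreal s \<le> (\<Sum>i. ennreal (c i))"
proof (rule LIMSEQ_le_const2)
  show "(\<lambda>n. ennreal (\<Sum>i<n. c i)) \<longlonglongrightarrow> ennreal s"
    using assms unfolding sums_def by (rule tendsto_ennrealI)
  have "ennreal (\<Sum>i<n. c i) \<le> (\<Sum>i. ennreal (c i))" for n
  proof -
    have "ennreal (\<Sum>i<n. c i) \<le> ennreal (\<Sum>i<n. max 0 (c i))"
      by (intro ennreal_leI sum_mono) auto
    also have "\<dots> = (\<Sum>i<n. ennreal (max 0 (c i)))"
      by (simp add: sum_ennreal)
    also have "\<dots> = (\<Sum>i<n. ennreal (c i))"
      by (intro sum.cong) (auto simp: max_def ennreal_neg)
    also have "\<dots> \<le> (\<Sum>i. ennreal (c i))"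
      by (rule sum_le_suminf) auto
    finally show ?thesis .
  qed
  then show "\<exists>N. \<forall>n\<ge>N. ennreal (\<Sum>i<n. c i) \<le> (\<Sum>i. ennreal (c i))" by auto
qed

lemma emeasure_positive_variation:
  assumes \<nu>: "vector_measure M \<nu>" and "A \<in> sets M"
  shows "emeasure (positive_variation M \<nu>) A = sup_measure_fun M \<nu> A"
  unfolding positive_variation_def sup_measure_fun_def[symmetric]
proof (rule emeasure_measure_of_sigma[OF _ _ _ assms(2)])
  show "sigma_algebra (space M) (sets M)" by (rule sets.sigma_algebra_axioms)
  show "positive (sets M) (sup_measure_fun M \<nu>)"
    using sup_measure_fun_empty[OF \<nu>] by (simp add: positive_def)
  show "countably_additive (sets M) (sup_measure_fun M \<nu>)"
  proof (rule countably_additiveI)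
    fix A :: "nat \<Rightarrow> _" assume A: "range A \<subseteq> sets M" "disjoint_family A"
    show "(\<Sum>i. sup_measure_fun M \<nu> (A i)) = sup_measure_fun M \<nu> (\<Union>i. A i)"
    proof (rule antisym)
      have fin: "(\<Sum>i<n. sup_measure_fun M \<nu> (A i)) \<le> sup_measure_fun M \<nu> (\<Union>i<n. A i)" for n
      proof (induction n)
        case 0 then show ?case by simp
      next
        case (Suc n)
        have "(\<Sum>i<Suc n. sup_measure_fun M \<nu> (A i))
            \<le> sup_measure_fun M \<nu> (\<Union>i<n. A i) + sup_measure_fun M \<nu> (A n)"
          using Suc by (simp add: add_right_mono)
        also have "\<dots> \<le> sup_measure_fun M \<nu> ((\<Union>i<n. A i) \<union> A n)"
        proof (rule sup_measure_fun_superadditive[OF \<nu>])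
          have "A i \<inter> A n = {}" if "i < n" for i
            using A(2) that by (intro disjoint_family_onD) auto
          then show "(\<Union>i<n. A i) \<inter> A n = {}" by auto
        qed
        also have "(\<Union>i<n. A i) \<union> A n = (\<Union>i<Suc n. A i)" by (auto simp: lessThan_Suc)
        finally show ?case .
      qed
      have "(\<Sum>i<n. sup_measure_fun M \<nu> (A i)) \<le> sup_measure_fun M \<nu> (\<Union>i. A i)" for n
        by (rule order_trans[OF fin]) (rule sup_measure_fun_mono, auto)
      then show "(\<Sum>i. sup_measure_fun M \<nu> (A i)) \<le> sup_measure_fun M \<nu> (\<Union>i. A i)"
        by (simp add: suminf_eq_SUP SUP_least)
    next
      show "sup_measure_fun M \<nu> (\<Union>i. A i) \<le> (\<Sum>i. sup_measure_fun M \<nu> (A i))"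
        unfolding sup_measure_fun_def[of M \<nu> "\<Union>i. A i"]
      proof (rule SUP_least)
        fix B assume "B \<in> {B \<in> sets M. B \<subseteq> (\<Union>i. A i)}"
        then have B: "B \<in> sets M" "B \<subseteq> (\<Union>i. A i)" by auto
        have "(\<lambda>i. \<nu> (B \<inter> A i)) sums \<nu> (\<Union>i. B \<inter> A i)"
          using A B by (intro vector_measure_sums[OF \<nu>]) (auto simp: disjoint_family_on_def)
        moreover have "(\<Union>i. B \<inter> A i) = B" using B by auto
        ultimately have "ennreal (\<nu> B) \<le> (\<Sum>i. ennreal (\<nu> (B \<inter> A i)))"
          using ennreal_sums_le_suminf by metis
        also have "\<dots> \<le> (\<Sum>i. sup_measure_fun M \<nu> (A i))"
          using A B by (intro suminf_le sup_measure_fun_upper) auto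
        finally show "ennreal (\<nu> B) \<le> (\<Sum>i. sup_measure_fun M \<nu> (A i))" .
      qed
    qed
  qed
qed

lemma sets_positive_variation [simp, measurable_cong]: "sets (positive_variation M \<nu>) = sets M"
  by (simp add: positive_variation_def)

lemma space_positive_variation [simp]: "space (positive_variation M \<nu>) = space M"
  by (simp add: positive_variation_def)

text \<open>If the variation were infinite, one could split off successively disjoint sets
  of measure larger than \<open>1\<close> in modulus, leaving a set of infinite variation each time.\<close>

lemma finite_measure_positive_variation:
  assumes \<nu>: "vector_measure M \<nu>"
  shows "finite_measure (positive_variation M \<nu>)"
proof (rule finite_measureI, rule notI)
  define pv where "pv = positive_variation M \<nu>"
  define nv where "nv = positive_variation M (\<lambda>A. - \<nu> A)"
  have sets_pv [simp]: "sets pv = sets M" "sets nv = sets M" by (auto simp: pv_def nv_def)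
  have pv: "emeasure pv A = sup_measure_fun M \<nu> A" if "A \<in> sets M" for A
    using emeasure_positive_variation[OF \<nu> that] by (simp add: pv_def)
  have nv: "emeasure nv A = sup_measure_fun M (\<lambda>A. - \<nu> A) A" if "A \<in> sets M" for A
    using emeasure_positive_variation[OF vector_measure_uminus[OF \<nu>] that] by (simp add: nv_def)
  define inf where "inf A \<longleftrightarrow> A \<in> sets M \<and> (emeasure pv A = \<infinity> \<or> emeasure nv A = \<infinity>)" for A
  have split: "\<exists>F\<subseteq>E. inf F \<and> \<bar>\<nu> (E - F)\<bar> > 1" if E: "inf E" for E
  proof -
    have Em: "E \<in> sets M" using E by (simp add: inf_def)
    have "\<exists>B\<in>sets M. B \<subseteq> E \<and> \<bar>\<nu> B\<bar> > 1 + \<bar>\<nu> E\<bar>"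
    proof -
      from E consider "emeasure pv E = \<infinity>" | "emeasure nv E = \<infinity>" by (auto simp: inf_def)
      then show ?thesis
      proof cases
        case 1
        then have "ennreal (1 + \<bar>\<nu> E\<bar>) < sup_measure_fun M \<nu> E"
          using pv[OF Em] by simp
        then obtain B where "B \<in> sets M" "B \<subseteq> E" "ennreal (1 + \<bar>\<nu> E\<bar>) < ennreal (\<nu> B)"
          unfolding sup_measure_fun_def by (auto simp: less_SUP_iff)
        moreover from this(3) have "1 + \<bar>\<nu> E\<bar> < \<nu> B" by (subst (asm) ennreal_less_iff) auto
        ultimately show ?thesis
          by (intro bexI[of _ B]) auto
      next
        case 2
        then have "ennreal (1 + \<bar>\<nu> E\<bar>) < sup_measure_fun M (\<lambda>A. - \<nu> A) E"
          using nv[OF Em] by simp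
        then obtain B where "B \<in> sets M" "B \<subseteq> E" "ennreal (1 + \<bar>\<nu> E\<bar>) < ennreal (- \<nu> B)"
          unfolding sup_measure_fun_def by (auto simp: less_SUP_iff)
        moreover from this(3) have "1 + \<bar>\<nu> E\<bar> < - \<nu> B" by (subst (asm) ennreal_less_iff) auto
        ultimately show ?thesis
          by (intro bexI[of _ B]) auto
      qed
    qed
    then obtain B where B: "B \<in> sets M" "B \<subseteq> E" "\<bar>\<nu> B\<bar> > 1 + \<bar>\<nu> E\<bar>" by auto
    have C: "\<bar>\<nu> (E - B)\<bar> > 1"
      using B vector_measure_Diff[OF \<nu> Em B(1,2)] by linarith
    have add: "emeasure pv E = emeasure pv B + emeasure pv (E - B)"
              "emeasure nv E = emeasure nv B + emeasure nv (E - B)"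
      using B Em plus_emeasure[of B pv "E - B"] plus_emeasure[of B nv "E - B"]
      by (simp_all add: Un_absorb1)
    then have "inf B \<or> inf (E - B)"
      using E B Em by (auto simp: inf_def)
    then show ?thesis
    proof
      assume "inf B"
      then show ?thesis using B C by auto
    next
      assume "inf (E - B)"
      moreover have "E - (E - B) = B" using B by auto
      ultimately show ?thesis using B by (intro exI[of _ "E - B"]) auto
    qed
  qed
  assume "emeasure (positive_variation M \<nu>) (space (positive_variation M \<nu>)) = \<infinity>"
  then have "inf (space M)" by (simp add: inf_def pv_def)
  then have "\<exists>f. \<forall>n::nat. inf (f n) \<and> (f (Suc n) \<subseteq> f n \<and> \<bar>\<nu> (f n - f (Suc n))\<bar> > 1)"
    by (intro dependent_nat_choice) (use split in blast)+
  then obtain f where f: "\<And>n::nat. inf (f n)" "\<And>n. f (Suc n) \<subseteq> f n"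
      "\<And>n. \<bar>\<nu> (f n - f (Suc n))\<bar> > 1" by blast
  have dec: "f m \<subseteq> f n" if "n \<le> m" for n m
    using f(2) that by (rule lift_Suc_antimono_le)
  have "disjoint_family (\<lambda>n. f n - f (Suc n))"
  unfolding disjoint_family_on_def
  proof (intro ballI impI)
    have *: "(f m - f (Suc m)) \<inter> (f n - f (Suc n)) = {}" if "m < n" for m n
      using dec[of "Suc m" n] that by auto
    fix m n :: nat assume "m \<noteq> n"
    then show "(f m - f (Suc m)) \<inter> (f n - f (Suc n)) = {}"
      using *[of m n] *[of n m] by (cases "m < n") auto
  qed
  moreover have "range (\<lambda>n. f n - f (Suc n)) \<subseteq> sets M"
    using f(1) by (auto simp: inf_def)
  ultimately have "summable (\<lambda>n. \<nu> (f n - f (Suc n)))"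
    using vector_measure_sums[OF \<nu>] sums_summable by blast
  then have "(\<lambda>n. \<nu> (f n - f (Suc n))) \<longlonglongrightarrow> 0"
    by (rule summable_LIMSEQ_zero)
  then obtain n where "\<bar>\<nu> (f n - f (Suc n))\<bar> < 1"
    using LIMSEQ_D[of _ 0 1] by fastforce
  then show False using f(3)[of n] by simp
qed

lemma Jordan_decomposition:
  assumes \<nu>: "vector_measure M \<nu>" and A: "A \<in> sets M"
  shows "\<nu> A = measure (positive_variation M \<nu>) A
             - measure (positive_variation M (\<lambda>A. - \<nu> A)) A"
proof -
  have le: "measure (positive_variation M \<nu>) A
      \<le> \<nu> A + measure (positive_variation M (\<lambda>A. - \<nu> A)) A"
    if \<nu>: "vector_measure M \<nu>" for \<nu>
  proof -
    define n where "n = measure (positive_variation M (\<lambda>A. - \<nu> A)) A"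
    interpret p: finite_measure "positive_variation M \<nu>"
      by (rule finite_measure_positive_variation[OF \<nu>])
    interpret q: finite_measure "positive_variation M (\<lambda>A. - \<nu> A)"
      by (rule finite_measure_positive_variation[OF vector_measure_uminus[OF \<nu>]])
    have n0: "n \<ge> 0" by (simp add: n_def)
    have *: "\<nu> B \<le> \<nu> A + n" if B: "B \<in> sets M" "B \<subseteq> A" for B
    proof -
      have "ennreal (- \<nu> (A - B)) \<le> sup_measure_fun M (\<lambda>A. - \<nu> A) A"
        using A B by (intro sup_measure_fun_upper) auto
      also have "\<dots> = ennreal n"
        using emeasure_positive_variation[OF vector_measure_uminus[OF \<nu>] A]
        by (simp add: n_def q.emeasure_eq_measure)
      finally have "- \<nu> (A - B) \<le> n"
        using n0 by simp
      then show ?thesis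
        using vector_measure_Diff[OF \<nu> A B] by simp
    qed
    have nn: "0 \<le> \<nu> A + n"
      using *[of "{}"] vector_measure_empty[OF \<nu>] by simp
    have "ennreal (measure (positive_variation M \<nu>) A) = sup_measure_fun M \<nu> A"
      using emeasure_positive_variation[OF \<nu> A] by (simp add: p.emeasure_eq_measure)
    also have "\<dots> \<le> ennreal (\<nu> A + n)"
      unfolding sup_measure_fun_def by (rule SUP_least) (auto intro!: ennreal_leI *)
    finally show ?thesis
      using nn by (simp add: n_def)
  qed
  from le[OF \<nu>] le[OF vector_measure_uminus[OF \<nu>]] show ?thesis by simp
qed

lemma sum_integral_eq_0_of_sum_measure_eq_0:
  fixes f :: "'a \<Rightarrow> real"
  assumes N: "\<And>i. i \<in> I \<Longrightarrow> finite_measure (N i)"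
    and sets: "\<And>i. i \<in> I \<Longrightarrow> sets (N i) = sets M"
    and zero: "\<And>A. A \<in> sets M \<Longrightarrow> (\<Sum>i\<in>I. c i * measure (N i) A) = 0"
    and f: "f \<in> borel_measurable M" "\<And>x. x \<in> space M \<Longrightarrow> norm (f x) \<le> B"
  shows "(\<Sum>i\<in>I. c i * integral\<^sup>L (N i) f) = 0"
proof -
  have space: "space (N i) = space M" if "i \<in> I" for i
    using sets[OF that] by (rule sets_eq_imp_space_eq)
  have bm: "h \<in> borel_measurable (N i)" if "h \<in> borel_measurable M" "i \<in> I" for h :: "'a \<Rightarrow> real" and i
    using that sets measurable_cong_sets by blast
  have int: "integrable (N i) h"
    if "h \<in> borel_measurable M" "\<And>x. x \<in> space M \<Longrightarrow> norm (h x) \<le> b" "i \<in> I"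
    for h :: "'a \<Rightarrow> real" and b i
    using that N[OF that(3)] space[OF that(3)]
    by (intro finite_measure.integrable_const_bound[of _ _ b]) (auto intro: bm)
  have nonneg: "(\<exists>b. \<forall>x\<in>space M. h x \<le> b) \<longrightarrow> (\<Sum>i\<in>I. c i * integral\<^sup>L (N i) h) = 0"
    if "h \<in> borel_measurable M" "\<And>x. 0 \<le> h x" for h
    using that
  proof (induction rule: borel_measurable_induct_real)
    case (set A)
    have "A \<inter> space (N i) = A" if "i \<in> I" for i
      using set sets.sets_into_space space[OF that] by auto
    then show ?case
      using zero[OF set] by (simp cong: sum.cong)
  next
    case (mult u a)
    show ?case
    proof (cases "a = 0")
      case False
      show ?thesis
      proof
        assume "\<exists>b. \<forall>x\<in>space M. a * u x \<le> b"
        then obtain b where "\<And>x. x \<in> space M \<Longrightarrow> a * u x \<le> b" by auto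
        then have "\<And>x. x \<in> space M \<Longrightarrow> u x \<le> b / a" using mult(1) False by (simp add: field_simps)
        then have "(\<Sum>i\<in>I. c i * integral\<^sup>L (N i) u) = 0" using mult by blast
        then show "(\<Sum>i\<in>I. c i * integral\<^sup>L (N i) (\<lambda>x. a * u x)) = 0"
          by (simp add: mult.left_commute[of _ a] flip: sum_distrib_left)
      qed
    qed simp
  next
    case (add u v)
    show ?case
    proof
      assume "\<exists>b. \<forall>x\<in>space M. v x + u x \<le> b"
      then obtain b where b: "\<And>x. x \<in> space M \<Longrightarrow> v x + u x \<le> b" by auto
      have ub: "u x \<le> b" "v x \<le> b" if "x \<in> space M" for x
        proof -
        have "0 \<le> u x" "0 \<le> v x" using add by auto
        then show "u x \<le> b" "v x \<le> b" using b[OF that] by linarith+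
      qed
      then have 0: "(\<Sum>i\<in>I. c i * integral\<^sup>L (N i) u) = 0" "(\<Sum>i\<in>I. c i * integral\<^sup>L (N i) v) = 0"
        using add by blast+
      have "integral\<^sup>L (N i) (\<lambda>x. v x + u x) = integral\<^sup>L (N i) v + integral\<^sup>L (N i) u" if "i \<in> I" for i
        using add ub that by (intro Bochner_Integration.integral_add int[where b=b]) auto
      then show "(\<Sum>i\<in>I. c i * integral\<^sup>L (N i) (\<lambda>x. v x + u x)) = 0"
        using 0 by (simp add: distrib_left sum.distrib cong: sum.cong)
    qed
  next
    case (seq U)
    show ?case
    proof
      assume "\<exists>b. \<forall>x\<in>space M. h x \<le> b"
      then obtain b where b: "\<And>x. x \<in> space M \<Longrightarrow> h x \<le> b" by auto
      have Ule: "U i x \<le> h x" if "x \<in> space M" for i x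
      proof (rule incseq_le)
        show "incseq (\<lambda>i. U i x)" using \<open>incseq U\<close> by (auto simp: incseq_def le_fun_def)
        show "(\<lambda>i. U i x) \<longlonglongrightarrow> h x" using seq(4)[OF that] .
      qed
      have lim: "(\<lambda>n. integral\<^sup>L (N i) (U n)) \<longlonglongrightarrow> integral\<^sup>L (N i) h" if i: "i \<in> I" for i
      proof (rule integral_dominated_convergence[where w="\<lambda>_. b"])
        interpret finite_measure "N i" by (rule N[OF i])
        show "integrable (N i) (\<lambda>_. b)" by simp
        show "U n \<in> borel_measurable (N i)" for n using seq i by (auto intro: bm)
        have "h \<in> borel_measurable M"
          using seq(4) by (rule borel_measurable_LIMSEQ_real) (use seq in auto)
        then show "h \<in> borel_measurable (N i)" by (rule bm[OF _ i])
        show "AE x in N i. (\<lambda>n. U n x) \<longlonglongrightarrow> h x"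
          using seq(4) space[OF i] by (intro AE_I2) auto
        show "AE x in N i. norm (U n x) \<le> b" for n
        proof (rule AE_I2)
          fix x assume "x \<in> space (N i)"
          then have x: "x \<in> space M" using space[OF i] by auto
          show "norm (U n x) \<le> b"
            using b[OF x] seq(2)[of n x] Ule[OF x, of n] by auto
        qed
      qed
      have "(\<Sum>i\<in>I. c i * integral\<^sup>L (N i) (U n)) = 0" for n
        using seq(5)[of n] Ule[of _ n] b order_trans by blast
      moreover have "(\<lambda>n. \<Sum>i\<in>I. c i * integral\<^sup>L (N i) (U n)) \<longlonglongrightarrow> (\<Sum>i\<in>I. c i * integral\<^sup>L (N i) h)"
        by (intro tendsto_intros lim)
      ultimately show "(\<Sum>i\<in>I. c i * integral\<^sup>L (N i) h) = 0"
        by (simp add: LIMSEQ_const_iff)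
    qed
  qed
  have pn: "(\<Sum>i\<in>I. c i * integral\<^sup>L (N i) (\<lambda>x. max 0 (g x))) = 0"
    if "g \<in> borel_measurable M" "\<And>x. x \<in> space M \<Longrightarrow> norm (g x) \<le> B" for g
  proof (rule nonneg[THEN mp])
    show "\<exists>b. \<forall>x\<in>space M. max 0 (g x) \<le> b"
      using that(2) by (intro exI[of _ "\<bar>B\<bar>"]) force
  qed (use that in auto)
  have "integral\<^sup>L (N i) f = integral\<^sup>L (N i) (\<lambda>x. max 0 (f x)) - integral\<^sup>L (N i) (\<lambda>x. max 0 (- f x))"
    if i: "i \<in> I" for i
  proof -
    have "integral\<^sup>L (N i) f = integral\<^sup>L (N i) (\<lambda>x. max 0 (f x) - max 0 (- f x))"
      by (intro Bochner_Integration.integral_cong) auto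
    also have "\<dots> = integral\<^sup>L (N i) (\<lambda>x. max 0 (f x)) - integral\<^sup>L (N i) (\<lambda>x. max 0 (- f x))"
    proof -
      have "norm (max 0 (f x)) \<le> B" "norm (max 0 (- f x)) \<le> B" if "x \<in> space M" for x
        using f(2)[OF that] by auto
      then show ?thesis
        using f(1) i by (intro Bochner_Integration.integral_diff int[where b=B]) auto
    qed
    finally show ?thesis .
  qed
  then show ?thesis
    using pn[OF f] pn[of "\<lambda>x. - f x"] f
    by (simp add: right_diff_distrib sum_subtractf cong: sum.cong)
qed

lemma signed_integral_lincomb:
  fixes \<nu> \<nu>\<^sub>1 \<nu>\<^sub>2 :: "'a set \<Rightarrow> real" and f :: "'a \<Rightarrow> real"
  assumes \<nu>: "vector_measure M \<nu>\<^sub>1" "vector_measure M \<nu>\<^sub>2"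
    and f: "f \<in> borel_measurable M" "\<And>x. x \<in> space M \<Longrightarrow> norm (f x) \<le> B"
  shows "signed_integral M (\<lambda>A. a * \<nu>\<^sub>1 A + b * \<nu>\<^sub>2 A) f =
    a * signed_integral M \<nu>\<^sub>1 f + b * signed_integral M \<nu>\<^sub>2 f"
proof -
  define \<nu> where "\<nu> = (\<lambda>A. a * \<nu>\<^sub>1 A + b * \<nu>\<^sub>2 A)"
  have vm: "vector_measure M \<nu>"
    unfolding \<nu>_def by (intro vector_measure_lincomb \<nu>)
  define N where "N = (!) [positive_variation M \<nu>, positive_variation M (\<lambda>A. - \<nu> A),
    positive_variation M \<nu>\<^sub>1, positive_variation M (\<lambda>A. - \<nu>\<^sub>1 A),
    positive_variation M \<nu>\<^sub>2, positive_variation M (\<lambda>A. - \<nu>\<^sub>2 A)]"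
  define c where "c = (!) [1, -1, -a, a, -b, b]"
  have I: "{..<6} = {0, 1, 2, 3, 4, 5::nat}" by auto
  have "(\<Sum>i<6. c i * integral\<^sup>L (N i) f) = 0"
  proof (rule sum_integral_eq_0_of_sum_measure_eq_0[OF _ _ _ f])
    show "finite_measure (N i)" if "i \<in> {..<6}" for i
      using that vm \<nu> unfolding I
      by (auto simp: N_def intro!: finite_measure_positive_variation vector_measure_uminus)
    show "sets (N i) = sets M" if "i \<in> {..<6}" for i
      using that unfolding I by (auto simp: N_def)
    fix A assume A: "A \<in> sets M"
    have "\<nu> A = a * \<nu>\<^sub>1 A + b * \<nu>\<^sub>2 A" by (simp add: \<nu>_def)
    then show "(\<Sum>i<6. c i * measure (N i) A) = 0"
      unfolding Jordan_decomposition[OF vm A] Jordan_decomposition[OF \<nu>(1) A]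
        Jordan_decomposition[OF \<nu>(2) A] I
      by (simp add: N_def c_def algebra_simps)
  qed
  then show ?thesis
    unfolding I by (simp add: N_def c_def signed_integral_def algebra_simps flip: \<nu>_def)
qed

lemma signed_integral_complex:
  fixes f :: "'a \<Rightarrow> complex"
  assumes \<nu>: "vector_measure M \<nu>"
    and f: "f \<in> borel_measurable M" "\<And>x. x \<in> space M \<Longrightarrow> norm (f x) \<le> B"
  shows "signed_integral M \<nu> f = Complex (signed_integral M \<nu> (\<lambda>x. Re (f x))) (signed_integral M \<nu> (\<lambda>x. Im (f x)))"
proof -
  have "integrable (positive_variation M \<nu>') f" if "vector_measure M \<nu>'" for \<nu>'
    using f by (intro finite_measure.integrable_const_bound[where B=B] finite_measure_positive_variation[OF that])
      (auto simp: measurable_cong_sets[OF sets_positive_variation refl])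
  from this[OF \<nu>] this[OF vector_measure_uminus[OF \<nu>]] show ?thesis
    by (simp add: signed_integral_def complex_eq_iff integral_Re integral_Im)
qed

section \<open>Test functions\<close>

abbreviation pd :: "'a::euclidean_space \<Rightarrow> ('a \<Rightarrow> 'b::real_normed_vector) \<Rightarrow> 'a \<Rightarrow> 'b" where
  "pd b f \<equiv> \<lambda>x. frechet_derivative f (at x) b"

lemma pdI: "(f has_derivative f') (at x) \<Longrightarrow> frechet_derivative f (at x) b = f' b"
  by (metis frechet_derivative_at)

lemma Ck_on_Suc_imp: "Ck_on (Suc n) S f \<Longrightarrow> Ck_on n S f"
proof (induction n arbitrary: f)
  case 0
  then show ?case
    by (auto intro!: continuous_at_imp_continuous_on differentiable_imp_continuous_within)
next
  case (Suc n)
  then show ?case by (metis Ck_on.simps(2))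
qed

lemma Ck_on_bounded_linear:
  assumes "bounded_linear L" "Ck_on n UNIV f"
  shows "Ck_on n UNIV (\<lambda>x. L (f x))"
  using assms(2)
proof (induction n arbitrary: f)
  case 0
  then show ?case
    using linear_continuous_on[OF assms(1)] by (auto intro: continuous_on_compose2)
next
  case (Suc n)
  have d: "((\<lambda>x. L (f x)) has_derivative (\<lambda>h. L (frechet_derivative f (at x) h))) (at x)" for x
    using Suc.prems by (intro bounded_linear.has_derivative[OF assms(1)])
      (auto simp: frechet_derivative_works)
  then have "pd b (\<lambda>x. L (f x)) = (\<lambda>x. L (pd b f x))" for b
    by (intro ext pdI)
  then show ?case
    using Suc differentiableI[OF d] by auto
qed

lemma Ck_on_add:
  assumes "Ck_on n UNIV f" "Ck_on n UNIV g"
  shows "Ck_on n UNIV (\<lambda>x. f x + g x)"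
  using assms
proof (induction n arbitrary: f g)
  case 0
  then show ?case by (auto intro: continuous_intros)
next
  case (Suc n)
  have d: "((\<lambda>x. f x + g x) has_derivative
      (\<lambda>h. frechet_derivative f (at x) h + frechet_derivative g (at x) h)) (at x)" for x
    using Suc.prems by (intro has_derivative_add) (auto simp: frechet_derivative_works)
  then have "pd b (\<lambda>x. f x + g x) = (\<lambda>x. pd b f x + pd b g x)" for b
    by (intro ext pdI)
  then show ?case
    using Suc differentiableI[OF d] by auto
qed

lemma Ck_on_mult:
  fixes f g :: "'a::euclidean_space \<Rightarrow> real"
  assumes "Ck_on n UNIV f" "Ck_on n UNIV g"
  shows "Ck_on n UNIV (\<lambda>x. f x * g x)"
  using assms
proof (induction n arbitrary: f g)
  case 0
  then show ?case by (auto intro: continuous_intros)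
next
  case (Suc n)
  have d: "((\<lambda>x. f x * g x) has_derivative
      (\<lambda>h. f x * frechet_derivative g (at x) h + frechet_derivative f (at x) h * g x)) (at x)" for x
    using Suc.prems by (intro has_derivative_mult) (auto simp: frechet_derivative_works)
  then have "pd b (\<lambda>x. f x * g x) = (\<lambda>x. f x * pd b g x + pd b f x * g x)" for b
    by (intro ext pdI)
  moreover have "Ck_on n UNIV (\<lambda>x. f x * pd b g x + pd b f x * g x)" if "b \<in> Basis" for b
    using Suc.prems that Ck_on_Suc_imp[OF Suc.prems(1)] Ck_on_Suc_imp[OF Suc.prems(2)]
    by (intro Ck_on_add Suc.IH) auto
  ultimately show ?case
    using differentiableI[OF d] by auto
qed

lemma Ck_on_affine:
  assumes "Ck_on n UNIV f"
  shows "Ck_on n UNIV (\<lambda>x. f (a + c *\<^sub>R x))"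
  using assms
proof (induction n arbitrary: f)
  case 0
  then show ?case by (auto intro!: continuous_on_compose2[of UNIV f] continuous_intros)
next
  case (Suc n)
  have d: "((\<lambda>x. f (a + c *\<^sub>R x)) has_derivative
      (\<lambda>h. c *\<^sub>R frechet_derivative f (at (a + c *\<^sub>R x)) h)) (at x)" for x
  proof -
    have f: "(f has_derivative frechet_derivative f (at (a + c *\<^sub>R x))) (at (a + c *\<^sub>R x))"
      using Suc.prems by (auto simp: frechet_derivative_works)
    then interpret bounded_linear "frechet_derivative f (at (a + c *\<^sub>R x))"
      by (rule has_derivative_bounded_linear)
    have "((\<lambda>x. f (a + c *\<^sub>R x)) has_derivative
      (\<lambda>h. frechet_derivative f (at (a + c *\<^sub>R x)) (c *\<^sub>R h))) (at x)"
    proof (rule has_derivative_compose[of "\<lambda>x. a + c *\<^sub>R x" "\<lambda>h. c *\<^sub>R h"])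
      show "((\<lambda>x. a + c *\<^sub>R x) has_derivative (\<lambda>h. c *\<^sub>R h)) (at x)"
        by (auto intro!: derivative_eq_intros)
    qed (rule f)
    then show ?thesis by (simp add: scaleR)
  qed
  then have "pd b (\<lambda>x. f (a + c *\<^sub>R x)) = (\<lambda>x. c *\<^sub>R pd b f (a + c *\<^sub>R x))" for b
    by (intro ext pdI)
  moreover have "Ck_on n UNIV (\<lambda>x. c *\<^sub>R pd b f (a + c *\<^sub>R x))" if "b \<in> Basis" for b
    using Suc that by (intro Ck_on_bounded_linear[OF bounded_linear_scaleR_right] Suc.IH) auto
  ultimately show ?case
    using differentiableI[OF d] by auto
qed

lemma test_functions_has_derivative:
  assumes "\<phi> \<in> test_functions \<Omega>"
  shows "(\<phi> has_derivative frechet_derivative \<phi> (at x)) (at x)"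
proof -
  have "Ck_on (Suc 0) UNIV \<phi>" using assms unfolding test_functions_def smooth_on_def by blast
  then show ?thesis by (auto simp: frechet_derivative_works)
qed

lemma test_functions_continuous:
  assumes "\<phi> \<in> test_functions \<Omega>"
  shows "continuous_on UNIV \<phi>"
proof -
  have "Ck_on 0 UNIV \<phi>" using assms unfolding test_functions_def smooth_on_def by blast
  then show ?thesis by simp
qed

lemma test_functions_measurable [measurable_dest]:
  "\<phi> \<in> test_functions \<Omega> \<Longrightarrow> \<phi> \<in> borel_measurable borel"
  by (intro borel_measurable_continuous_onI test_functions_continuous)

lemma test_functionsI:
  assumes "\<And>n. Ck_on n UNIV \<phi>" "compact K" "K \<subseteq> \<Omega>" "\<And>x. \<phi> x \<noteq> 0 \<Longrightarrow> x \<in> K"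
  shows "\<phi> \<in> test_functions \<Omega>"
proof -
  have "closure {x. \<phi> x \<noteq> 0} \<subseteq> K"
    using assms by (intro closure_minimal) (auto intro: compact_imp_closed)
  then show ?thesis
    using assms compact_Int_closed[OF assms(2), of "closure {x. \<phi> x \<noteq> 0}"]
    unfolding test_functions_def smooth_on_def compactly_supported_in_def
    by (auto simp: Int_absorb1)
qed

lemma test_functionsD:
  assumes "\<phi> \<in> test_functions \<Omega>"
  shows "Ck_on n UNIV \<phi>" "compact (closure {x. \<phi> x \<noteq> 0})" "closure {x. \<phi> x \<noteq> 0} \<subseteq> \<Omega>"
  using assms unfolding test_functions_def smooth_on_def compactly_supported_in_def by auto

lemma frechet_derivative_eq_0_outside_support:
  assumes "x \<notin> closure {x. f x \<noteq> 0}"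
  shows "frechet_derivative f (at x) = (\<lambda>_. 0)"
proof -
  have "((\<lambda>_. 0) has_derivative (\<lambda>_. 0)) (at x)" by simp
  then have "(f has_derivative (\<lambda>_. 0)) (at x)"
  proof (rule has_derivative_transform_within_open[of _ _ _ _ "- closure {x. f x \<noteq> 0}"])
    show "0 = f y" if "y \<in> - closure {x. f x \<noteq> 0}" for y
      using that closure_subset[of "{x. f x \<noteq> 0}"] by auto
  qed (use assms in auto)
  then show ?thesis by (metis frechet_derivative_at)
qed

lemma test_functions_pd:
  assumes "\<phi> \<in> test_functions \<Omega>" "b \<in> Basis"
  shows "pd b \<phi> \<in> test_functions \<Omega>"
proof (rule test_functionsI[OF _ test_functionsD(2,3)[OF assms(1)]])
  show "Ck_on n UNIV (pd b \<phi>)" for n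
    using test_functionsD(1)[OF assms(1), of "Suc n"] assms(2) by auto
  show "x \<in> closure {x. \<phi> x \<noteq> 0}" if "pd b \<phi> x \<noteq> 0" for x
  proof (rule ccontr)
    assume "x \<notin> closure {x. \<phi> x \<noteq> 0}"
    from frechet_derivative_eq_0_outside_support[OF this] show False using that by simp
  qed
qed

lemma test_functions_reflect:
  assumes "\<phi> \<in> test_functions UNIV" "compact K" "K \<subseteq> \<Omega>" "\<And>y. \<phi> (x - y) \<noteq> 0 \<Longrightarrow> y \<in> K"
  shows "(\<lambda>y. \<phi> (x - y)) \<in> test_functions \<Omega>"
proof (rule test_functionsI[OF _ assms(2-4)])
  show "Ck_on n UNIV (\<lambda>y. \<phi> (x - y))" for n
    using Ck_on_affine[OF test_functionsD(1)[OF assms(1)], of n x "-1"] by simp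
qed

lemma frechet_derivative_reflect:
  assumes "\<phi> \<in> test_functions UNIV"
  shows "frechet_derivative (\<lambda>y. \<phi> (x - y)) (at y) = (\<lambda>h. - frechet_derivative \<phi> (at (x - y)) h)"
proof -
  have d: "(\<phi> has_derivative frechet_derivative \<phi> (at (x - y))) (at (x - y))"
    by (rule test_functions_has_derivative[OF assms])
  have "((\<lambda>y. \<phi> (x - y)) has_derivative (\<lambda>h. frechet_derivative \<phi> (at (x - y)) (- h))) (at y)"
  proof (rule has_derivative_compose[of "\<lambda>y. x - y" uminus])
    show "((\<lambda>y. x - y) has_derivative uminus) (at y)"
      using has_derivative_diff[OF has_derivative_const[of x] has_derivative_ident, of "at y"]
      by (simp add: fun_Compl_def)
  qed (rule d)
  then have "frechet_derivative (\<lambda>y. \<phi> (x - y)) (at y) = (\<lambda>h. frechet_derivative \<phi> (at (x - y)) (- h))"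
    by (rule frechet_derivative_at[symmetric])
  then show ?thesis
    by (simp only: linear_neg[OF bounded_linear.linear[OF has_derivative_bounded_linear[OF d]]])
qed

lemma test_functions_bounded_linear:
  assumes "bounded_linear L" "\<phi> \<in> test_functions \<Omega>"
  shows "(\<lambda>x. L (\<phi> x)) \<in> test_functions \<Omega>"
proof (rule test_functionsI[OF _ test_functionsD(2,3)[OF assms(2)]])
  interpret bounded_linear L by fact
  show "x \<in> closure {x. \<phi> x \<noteq> 0}" if "L (\<phi> x) \<noteq> 0" for x
  proof -
    have "\<phi> x \<noteq> 0" using that zero by auto
    then show ?thesis using closure_subset[of "{x. \<phi> x \<noteq> 0}"] by blast
  qed
  show "Ck_on n UNIV (\<lambda>x. L (\<phi> x))" for n
    by (rule Ck_on_bounded_linear[OF assms(1) test_functionsD(1)[OF assms(2)]])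
qed

lemma frechet_derivative_bounded_linear:
  assumes "bounded_linear L" "\<phi> \<in> test_functions \<Omega>"
  shows "frechet_derivative (\<lambda>x. L (\<phi> x)) (at x) = (\<lambda>h. L (frechet_derivative \<phi> (at x) h))"
  using bounded_linear.has_derivative[OF assms(1) test_functions_has_derivative[OF assms(2)]]
  by (metis frechet_derivative_at)

lemma test_functions_support_bounded:
  assumes "\<phi> \<in> test_functions \<Omega>"
  obtains R where "R > 0" "\<And>x. \<phi> x \<noteq> 0 \<Longrightarrow> norm x < R"
proof -
  obtain R where "\<And>x. x \<in> closure {x. \<phi> x \<noteq> 0} \<Longrightarrow> norm x \<le> R"
    using compact_imp_bounded[OF test_functionsD(2)[OF assms]] unfolding bounded_iff by blast
  then have "\<phi> x \<noteq> 0 \<Longrightarrow> norm x < max R 0 + 1" for x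
    using closure_subset[of "{x. \<phi> x \<noteq> 0}"] by fastforce
  then show ?thesis by (intro that[of "max R 0 + 1"]) auto
qed

lemma continuous_bounded_support_bounded:
  fixes f :: "'a::euclidean_space \<Rightarrow> 'b::real_normed_vector"
  assumes "continuous_on UNIV f" "\<And>x. f x \<noteq> 0 \<Longrightarrow> norm x \<le> R"
  obtains B where "B \<ge> 0" "\<And>x. norm (f x) \<le> B"
proof -
  have "bounded (f ` cball 0 R)"
    by (intro compact_imp_bounded compact_continuous_image continuous_on_subset[OF assms(1)]) auto
  then obtain B where "\<forall>y\<in>f ` cball 0 R. norm y \<le> B"
    unfolding bounded_iff by blast
  then have B: "norm x \<le> R \<Longrightarrow> norm (f x) \<le> B" for x
    by simp
  have "norm (f x) \<le> max B 0" for x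
    using B[of x] assms(2)[of x] by (cases "f x = 0") auto
  then show ?thesis by (intro that[of "max B 0"]) auto
qed

lemma continuous_bounded_support_uniformly_continuous:
  fixes f :: "'a::euclidean_space \<Rightarrow> 'b::real_normed_vector"
  assumes "continuous_on UNIV f" "\<And>x. f x \<noteq> 0 \<Longrightarrow> norm x \<le> R" "e > 0"
  obtains d where "d > 0" "\<And>x y. dist x y < d \<Longrightarrow> dist (f x) (f y) < e"
proof -
  have "uniformly_continuous_on (cball 0 (R + 1)) f"
    by (intro compact_uniformly_continuous continuous_on_subset[OF assms(1)]) auto
  then obtain d where d: "d > 0"
    "\<And>x y. x \<in> cball 0 (R+1) \<Longrightarrow> y \<in> cball 0 (R+1) \<Longrightarrow> dist x y < d \<Longrightarrow> dist (f x) (f y) < e"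
    unfolding uniformly_continuous_on_def using assms(3) by (metis dist_commute)
  have "dist (f x) (f y) < e" if "dist x y < min d 1" for x y
  proof (cases "norm x \<le> R \<or> norm y \<le> R")
    case True
    have "norm x \<le> norm y + dist x y" "norm y \<le> norm x + dist x y"
      unfolding dist_norm using norm_triangle_sub[of x y] norm_triangle_sub[of y x] by (auto simp: norm_minus_commute)
    then have "norm x \<le> R + 1" "norm y \<le> R + 1" using True that by linarith+
    then show ?thesis using d(2)[of x y] that by auto
  next
    case False
    then have "f x = 0" "f y = 0" using assms(2) by blast+
    then show ?thesis using assms(3) by simp
  qed
  then show ?thesis using d(1) by (intro that[of "min d 1"]) auto
qed

lemma test_functions_bounded:
  assumes "\<phi> \<in> test_functions \<Omega>"
  obtains B where "B \<ge> 0" "\<And>x. norm (\<phi> x) \<le> B"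
proof -
  obtain R where "\<And>x. \<phi> x \<noteq> 0 \<Longrightarrow> norm x < R"
    using test_functions_support_bounded[OF assms] by blast
  then show ?thesis
    using continuous_bounded_support_bounded[OF test_functions_continuous[OF assms], of R] that
      less_imp_le by blast
qed

lemma integrable_continuous_bounded_support:
  fixes f :: "'a::euclidean_space \<Rightarrow> 'b::{banach, second_countable_topology}"
  assumes "continuous_on UNIV f" "\<And>x. f x \<noteq> 0 \<Longrightarrow> norm x \<le> R"
  shows "integrable lborel f"
proof -
  have "integrable lborel (\<lambda>x. indicator (cball 0 R) x *\<^sub>R f x)"
    by (intro borel_integrable_compact continuous_on_subset[OF assms(1)]) auto
  also have "(\<lambda>x. indicator (cball 0 R) x *\<^sub>R f x) = f"
    using assms(2) by (auto simp: indicator_def fun_eq_iff)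
  finally show ?thesis .
qed

lemma test_functions_integrable:
  fixes \<phi> :: "'a::euclidean_space \<Rightarrow> 'b::{banach, second_countable_topology}"
  assumes "\<phi> \<in> test_functions \<Omega>"
  shows "integrable lborel \<phi>"
proof -
  obtain R where "\<And>x. \<phi> x \<noteq> 0 \<Longrightarrow> norm x < R"
    using test_functions_support_bounded[OF assms] by blast
  then show ?thesis
    using integrable_continuous_bounded_support[OF test_functions_continuous[OF assms], of R]
      less_imp_le by blast
qed

section \<open>Mollifiers\<close>

definition mollifier :: "real \<Rightarrow> ('a::euclidean_space \<Rightarrow> real) \<Rightarrow> bool" where
  "mollifier r \<rho> \<longleftrightarrow> \<rho> \<in> test_functions UNIV \<and> (\<forall>x. 0 \<le> \<rho> x) \<and> (\<forall>x. \<rho> x \<noteq> 0 \<longrightarrow> norm x < r) \<and>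
     integral\<^sup>L lborel \<rho> = 1"

text \<open>Any nonzero test function yields mollifiers, by squaring, rescaling and normalizing; so the
  usual bump function need not be constructed.\<close>

lemma mollifier_exists:
  fixes \<phi> :: "'a::euclidean_space \<Rightarrow> real"
  assumes \<phi>: "\<phi> \<in> test_functions \<Omega>" "\<phi> p \<noteq> 0" and "r > 0"
  shows "\<exists>\<rho>::'a \<Rightarrow> real. mollifier r \<rho>"
proof -
  obtain R where R: "R > 0" "\<And>x. \<phi> x \<noteq> 0 \<Longrightarrow> norm x < R"
    using test_functions_support_bounded[OF \<phi>(1)] by blast
  define c where "c = R / r"
  have c: "c > 0" using R \<open>r > 0\<close> by (simp add: c_def)
  define \<psi> where "\<psi> x = \<phi> (0 + c *\<^sub>R x) * \<phi> (0 + c *\<^sub>R x)" for x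
  have supp: "norm x < r" if "\<psi> x \<noteq> 0" for x
  proof -
    have "norm (c *\<^sub>R x) < R" using that by (intro R) (auto simp: \<psi>_def)
    moreover have "norm (c *\<^sub>R x) = c * norm x" "R = c * r"
      using c \<open>r > 0\<close> R(1) by (auto simp: c_def)
    ultimately have "c * norm x < c * r" by metis
    then show ?thesis using c by simp
  qed
  have \<psi>: "\<psi> \<in> test_functions UNIV"
  proof (rule test_functionsI[of _ "cball 0 r"])
    show "Ck_on n UNIV \<psi>" for n
      unfolding \<psi>_def[abs_def] by (intro Ck_on_mult Ck_on_affine test_functionsD(1)[OF \<phi>(1)])
  qed (auto intro: less_imp_le supp)
  have cont: "continuous_on UNIV \<psi>" and int: "integrable lborel \<psi>"
    using \<psi> by (auto intro: test_functions_continuous test_functions_integrable)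
  have nn: "\<psi> x \<ge> 0" for x by (simp add: \<psi>_def)
  have p: "\<psi> (p /\<^sub>R c) > 0" using \<phi>(2) c by (auto simp: \<psi>_def zero_less_mult_iff linorder_neq_iff)
  have pos: "integral\<^sup>L lborel \<psi> > 0"
  proof (rule ccontr)
    assume "\<not> 0 < integral\<^sup>L lborel \<psi>"
    then have "integral\<^sup>L lborel \<psi> = 0" using nn by (simp add: integral_nonneg_AE order_antisym)
    then have "AE x in lborel. \<psi> x = 0"
      using integral_nonneg_eq_0_iff_AE[OF int] nn by simp
    moreover have "open {x. \<psi> x \<noteq> 0}" using cont by (intro open_Collect_neq) auto
    moreover have "{x. \<psi> x \<noteq> 0} \<noteq> {}" using p by force
    ultimately have "\<not> negligible {x. \<psi> x \<noteq> 0}" by (intro open_not_negligible)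
    moreover have "{x. \<psi> x \<noteq> 0} \<in> null_sets lborel"
      using \<open>AE x in lborel. \<psi> x = 0\<close> \<open>open {x. \<psi> x \<noteq> 0}\<close>
      by (subst AE_iff_null_sets) auto
    ultimately show False
      by (simp add: negligible_iff_null_sets null_sets_completionI)
  qed
  define \<rho> where "\<rho> x = (1 / integral\<^sup>L lborel \<psi>) *\<^sub>R \<psi> x" for x
  have "\<rho> \<in> test_functions UNIV"
    unfolding \<rho>_def[abs_def] by (rule test_functions_bounded_linear[OF bounded_linear_scaleR_right \<psi>])
  moreover have "integral\<^sup>L lborel \<rho> = 1"
    using pos by (simp add: \<rho>_def[abs_def])
  ultimately have "mollifier r \<rho>"
    using pos nn supp by (auto simp: mollifier_def \<rho>_def)
  then show ?thesis by blast
qed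

lemma mollifierD:
  assumes "mollifier r \<rho>"
  shows "\<rho> \<in> test_functions UNIV" "\<And>x. 0 \<le> \<rho> x" "\<And>x. \<rho> x \<noteq> 0 \<Longrightarrow> norm x < r"
    "integral\<^sup>L lborel \<rho> = 1" "integrable lborel \<rho>" "\<rho> \<in> borel_measurable borel"
proof -
  show \<rho>: "\<rho> \<in> test_functions UNIV" using assms by (simp add: mollifier_def)
  show "integrable lborel \<rho>" by (rule test_functions_integrable[OF \<rho>])
  show "\<rho> \<in> borel_measurable borel" by (rule test_functions_measurable[OF \<rho>])
qed (use assms in \<open>auto simp: mollifier_def\<close>)

section \<open>Integration by parts and convolution\<close>

lemma integral_lborel_translate:
  fixes f :: "'a::euclidean_space \<Rightarrow> 'b::{banach, second_countable_topology}"
  assumes "f \<in> borel_measurable borel"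
  shows "(\<integral>x. f (a + x) \<partial>lborel) = integral\<^sup>L lborel f"
    and "integrable lborel (\<lambda>x. f (a + x)) \<longleftrightarrow> integrable lborel f"
proof -
  have "integral\<^sup>L (distr lborel borel ((+) a)) f = (\<integral>x. f (a + x) \<partial>lborel)"
    using assms by (subst integral_distr) auto
  then show "(\<integral>x. f (a + x) \<partial>lborel) = integral\<^sup>L lborel f"
    by (simp add: lborel_distr_plus)
  have "integrable (distr lborel borel ((+) a)) f \<longleftrightarrow> integrable lborel (\<lambda>x. f (a + x))"
    using assms by (subst integrable_distr_eq) auto
  then show "integrable lborel (\<lambda>x. f (a + x)) \<longleftrightarrow> integrable lborel f"
    by (simp add: lborel_distr_plus)
qed

lemma distr_lborel_reflect: "distr lborel borel (\<lambda>y. a - y) = (lborel :: 'a::euclidean_space measure)"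
  using lborel_affine[of "-1" a] by (simp add: density_1)

lemma integral_lborel_reflect:
  fixes f :: "'a::euclidean_space \<Rightarrow> 'b::{banach, second_countable_topology}"
  assumes "f \<in> borel_measurable borel"
  shows "(\<integral>y. f (a - y) \<partial>lborel) = integral\<^sup>L lborel f"
    and "integrable lborel (\<lambda>y. f (a - y)) \<longleftrightarrow> integrable lborel f"
proof -
  have "integral\<^sup>L (distr lborel borel (\<lambda>y. a - y)) f = (\<integral>x. f (a - x) \<partial>lborel)"
    using assms by (subst integral_distr) auto
  then show "(\<integral>y. f (a - y) \<partial>lborel) = integral\<^sup>L lborel f"
    by (simp add: distr_lborel_reflect)
  have "integrable (distr lborel borel (\<lambda>y. a - y)) f \<longleftrightarrow> integrable lborel (\<lambda>x. f (a - x))"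
    using assms by (subst integrable_distr_eq) auto
  then show "integrable lborel (\<lambda>y. f (a - y)) \<longleftrightarrow> integrable lborel f"
    by (simp add: distr_lborel_reflect)
qed

lemma real_mvt_along:
  fixes f :: "'a::euclidean_space \<Rightarrow> real"
  assumes "\<And>x. (f has_derivative f' x) (at x)"
  shows "\<exists>t\<in>{0<..<1}. f (x + h) - f x = f' (x + t *\<^sub>R h) h"
proof -
  have d: "((\<lambda>t. f (x + t *\<^sub>R h)) has_derivative (\<lambda>s. f' (x + t *\<^sub>R h) (s *\<^sub>R h))) (at t)" for t
    by (rule has_derivative_compose[OF _ assms]) (auto intro!: derivative_eq_intros)
  have "\<exists>t\<in>{0<..<1}. f (x + 1 *\<^sub>R h) - f (x + 0 *\<^sub>R h) = f' (x + t *\<^sub>R h) ((1 - 0) *\<^sub>R h)"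
    by (rule mvt_simple) (auto intro: d has_derivative_at_withinI)
  then show ?thesis by simp
qed

text \<open>By translation invariance the difference quotients of \<open>f\<close> have integral zero.\<close>

lemma integral_derivative_eq_0:
  fixes f :: "'a::euclidean_space \<Rightarrow> real"
  assumes d: "\<And>x. (f has_derivative f' x) (at x)"
    and cont: "continuous_on UNIV (\<lambda>x. f' x b)"
    and supp: "\<And>x. f x \<noteq> 0 \<Longrightarrow> norm x \<le> R"
  shows "(\<integral>x. f' x b \<partial>lborel) = 0" "integrable lborel (\<lambda>x. f' x b)"
proof -
  have supp': "norm x \<le> R" if "f' x b \<noteq> 0" for x
  proof (rule ccontr)
    assume "\<not> norm x \<le> R"
    moreover have "closure {x. f x \<noteq> 0} \<subseteq> cball 0 R"
      using supp by (intro closure_minimal) auto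
    ultimately have "frechet_derivative f (at x) = (\<lambda>_. 0)"
      by (intro frechet_derivative_eq_0_outside_support) auto
    then show False using that frechet_derivative_at[OF d[of x]] by simp
  qed
  show int': "integrable lborel (\<lambda>x. f' x b)"
    by (rule integrable_continuous_bounded_support[OF cont supp'])
  obtain B where B: "B \<ge> 0" "\<And>x. norm (f' x b) \<le> B"
    using continuous_bounded_support_bounded[OF cont supp'] by blast
  have fc: "continuous_on UNIV f"
    using d by (intro has_derivative_continuous_on) (auto intro: has_derivative_at_withinI)
  have fm [measurable]: "f \<in> borel_measurable borel"
    using fc by (rule borel_measurable_continuous_onI)
  have fint: "integrable lborel f"
    by (rule integrable_continuous_bounded_support[OF fc supp])
  define t where "t n = 1 / real (Suc n)" for n
  have t: "t n > 0" "t n \<le> 1" for n by (auto simp: t_def)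
  have t0: "t \<longlonglongrightarrow> 0" unfolding t_def by (rule LIMSEQ_Suc[OF lim_1_over_n])
  define q where "q n x = (f (t n *\<^sub>R b + x) - f x) / t n" for n x
  have "(\<lambda>n. integral\<^sup>L lborel (q n)) \<longlonglongrightarrow> (\<integral>x. f' x b \<partial>lborel)"
  proof (rule integral_dominated_convergence[where w="\<lambda>x. indicator (cball 0 (R + norm b)) x * B"])
    show "(\<lambda>x. f' x b) \<in> borel_measurable lborel" using int' by auto
    show "q n \<in> borel_measurable lborel" for n unfolding q_def by measurable
    show "integrable lborel (\<lambda>x. indicator (cball 0 (R + norm b)) x * B :: real)"
      by (intro integrable_mult_left integrable_real_indicator emeasure_bounded_finite) auto
    show "AE x in lborel. (\<lambda>n. q n x) \<longlonglongrightarrow> f' x b"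
    proof (rule AE_I2)
      fix x
      have "((\<lambda>s. f (x + s *\<^sub>R b)) has_derivative (\<lambda>s. f' (x + 0 *\<^sub>R b) (s *\<^sub>R b))) (at 0)"
        by (rule has_derivative_compose[OF _ d]) (auto intro!: derivative_eq_intros)
      then have "((\<lambda>s. f (x + s *\<^sub>R b)) has_field_derivative f' x b) (at 0)"
        using has_derivative_bounded_linear[OF d[of x]]
        by (simp add: has_field_derivative_def linear_cmul bounded_linear.linear mult_commute_abs)
      then have "((\<lambda>s. (f (x + s *\<^sub>R b) - f x) / s) \<longlongrightarrow> f' x b) (at 0)"
        by (simp add: DERIV_def)
      moreover have "filterlim t (at 0) sequentially"
        using t0 t(1) by (auto simp: filterlim_at intro!: always_eventually) (metis less_irrefl)
      ultimately have "(\<lambda>n. (f (x + t n *\<^sub>R b) - f x) / t n) \<longlonglongrightarrow> f' x b"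
        by (rule filterlim_compose)
      then show "(\<lambda>n. q n x) \<longlonglongrightarrow> f' x b"
        by (simp add: q_def add.commute)
    qed
    show "AE x in lborel. norm (q n x) \<le> indicator (cball 0 (R + norm b)) x * B" for n
    proof (rule AE_I2)
      fix x
      obtain s where s: "f (x + t n *\<^sub>R b) - f x = f' (x + s *\<^sub>R t n *\<^sub>R b) (t n *\<^sub>R b)"
        using real_mvt_along[OF d] by blast
      have "\<bar>q n x\<bar> = \<bar>f' (x + s *\<^sub>R t n *\<^sub>R b) b\<bar>"
        using s t(1)[of n] has_derivative_bounded_linear[OF d[of "x + s *\<^sub>R t n *\<^sub>R b"]]
        by (simp add: q_def add.commute linear_cmul bounded_linear.linear)
      then have 1: "\<bar>q n x\<bar> \<le> B" using B(2) by (metis real_norm_def)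
      have 2: "q n x = 0" if "norm x > R + norm b"
      proof -
        have "f x = 0" using supp[of x] that norm_ge_zero[of b] by linarith
        moreover have "norm (t n *\<^sub>R b) \<le> norm b"
          using t[of n] by (simp add: mult_left_le_one_le)
        then have "norm (t n *\<^sub>R b + x) > R"
          using norm_diff_triangle_ineq[of x 0 "t n *\<^sub>R b + x" "t n *\<^sub>R b"] norm_triangle_ineq2[of x "- (t n *\<^sub>R b)"] that
          by (simp add: add.commute)
        then have "f (t n *\<^sub>R b + x) = 0" using supp by force
        ultimately show ?thesis by (simp add: q_def)
      qed
      show "norm (q n x) \<le> indicator (cball 0 (R + norm b)) x * B"
        using 1 2 by (auto simp: indicator_def)
    qed
  qed
  moreover have "integral\<^sup>L lborel (q n) = 0" for n
    using fint integral_lborel_translate[OF fm, of "t n *\<^sub>R b"]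
    by (simp add: q_def[abs_def])
  ultimately show "(\<integral>x. f' x b \<partial>lborel) = 0"
    by (simp add: LIMSEQ_const_iff)
qed

lemma pd_linear:
  assumes "\<phi> \<in> test_functions \<Omega>"
  shows "frechet_derivative \<phi> (at x) h = (\<Sum>b\<in>Basis. (h \<bullet> b) *\<^sub>R frechet_derivative \<phi> (at x) b)"
proof -
  interpret bounded_linear "frechet_derivative \<phi> (at x)"
    using test_functions_has_derivative[OF assms] by (rule has_derivative_bounded_linear)
  show ?thesis
    by (subst euclidean_representation[of h, symmetric]) (simp add: sum scaleR)
qed

lemma test_functions_uniformly_differentiable:
  fixes \<phi> :: "'a::euclidean_space \<Rightarrow> real"
  assumes \<phi>: "\<phi> \<in> test_functions \<Omega>" and "e > 0"
  obtains d where "d > 0"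
    "\<And>x h. norm h < d \<Longrightarrow> \<bar>\<phi> (x + h) - \<phi> x - frechet_derivative \<phi> (at x) h\<bar> \<le> e * norm h"
proof -
  define e' where "e' = e / real DIM('a)"
  have e': "e' > 0" using \<open>e > 0\<close> by (simp add: e'_def)
  have "\<exists>d>0. \<forall>x y. dist x y < d \<longrightarrow> dist (pd b \<phi> x) (pd b \<phi> y) < e'" if b: "b \<in> Basis" for b
  proof -
    have p: "pd b \<phi> \<in> test_functions \<Omega>" by (rule test_functions_pd[OF \<phi> b])
    obtain R where "\<And>x. pd b \<phi> x \<noteq> 0 \<Longrightarrow> norm x \<le> R"
      using test_functions_support_bounded[OF p] less_imp_le by metis
    from continuous_bounded_support_uniformly_continuous[OF test_functions_continuous[OF p] this e']
    show ?thesis by metis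
  qed
  then obtain d where d: "\<And>b. b \<in> Basis \<Longrightarrow> d b > 0"
    "\<And>b x y. b \<in> Basis \<Longrightarrow> dist x y < d b \<Longrightarrow> dist (pd b \<phi> x) (pd b \<phi> y) < e'"
    by metis
  define D where "D = Min (d ` Basis)"
  have D: "D > 0" "\<And>b. b \<in> Basis \<Longrightarrow> D \<le> d b"
    using d(1) by (auto simp: D_def)
  have "\<bar>\<phi> (x + h) - \<phi> x - frechet_derivative \<phi> (at x) h\<bar> \<le> e * norm h" if h: "norm h < D" for x h
  proof -
    obtain t where t: "t \<in> {0<..<1}"
      "\<phi> (x + h) - \<phi> x = frechet_derivative \<phi> (at (x + t *\<^sub>R h)) h"
      using real_mvt_along[OF test_functions_has_derivative[OF \<phi>]] by blast
    have th: "norm (t *\<^sub>R h) \<le> norm h" using t by (simp add: mult_left_le_one_le)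
    have "\<phi> (x + h) - \<phi> x - frechet_derivative \<phi> (at x) h =
        (\<Sum>b\<in>Basis. (h \<bullet> b) *\<^sub>R (pd b \<phi> (x + t *\<^sub>R h) - pd b \<phi> x))"
      unfolding t(2) pd_linear[OF \<phi>, of _ h] by (simp add: sum_subtractf right_diff_distrib)
    also have "\<bar>\<dots>\<bar> \<le> (\<Sum>b\<in>(Basis::'a set). norm h * e')"
    proof (rule order_trans[OF sum_abs], rule sum_mono)
      fix b :: 'a assume b: "b \<in> Basis"
      have "dist (x + t *\<^sub>R h) x < d b"
        using th h D(2)[OF b] by (simp add: dist_norm)
      then have "\<bar>pd b \<phi> (x + t *\<^sub>R h) - pd b \<phi> x\<bar> \<le> e'"
        using d(2)[OF b] by (simp add: dist_real_def less_imp_le)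
      then show "\<bar>(h \<bullet> b) *\<^sub>R (pd b \<phi> (x + t *\<^sub>R h) - pd b \<phi> x)\<bar> \<le> norm h * e'"
        using Basis_le_norm[OF b, of h] by (simp add: abs_mult mult_mono)
    qed
    also have "\<dots> = e * norm h" by (simp add: e'_def)
    finally show ?thesis .
  qed
  then show ?thesis using D(1) that by blast
qed

definition conv :: "('a::euclidean_space \<Rightarrow> real) \<Rightarrow> ('a \<Rightarrow> 'b::euclidean_space) \<Rightarrow> 'a \<Rightarrow> 'b" where
  "conv \<rho> w x = (\<integral>y. \<rho> (x - y) *\<^sub>R w y \<partial>lborel)"

lemma norm_integral_le:
  fixes f :: "'a \<Rightarrow> 'b::{banach, second_countable_topology}"
  assumes "integrable M g" "\<And>x. x \<in> space M \<Longrightarrow> norm (f x) \<le> g x"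
  shows "norm (integral\<^sup>L M f) \<le> integral\<^sup>L M g"
proof -
  have "norm (integral\<^sup>L M f) \<le> (\<integral>x. norm (f x) \<partial>M)" by (rule integral_norm_bound)
  also have "\<dots> \<le> integral\<^sup>L M g"
    using assms by (intro integral_mono') (auto intro: order_trans[OF norm_ge_zero])
  finally show ?thesis .
qed

lemma integrable_bounded_scaleR:
  fixes w :: "'a \<Rightarrow> 'b::{banach, second_countable_topology}"
  assumes "integrable M w" "\<rho> \<in> borel_measurable M" "\<And>x. \<bar>\<rho> x\<bar> \<le> B"
  shows "integrable M (\<lambda>x. \<rho> x *\<^sub>R w x)"
proof (rule Bochner_Integration.integrable_bound[of _ "\<lambda>x. B *\<^sub>R w x"])
  show "AE x in M. norm (\<rho> x *\<^sub>R w x) \<le> norm (B *\<^sub>R w x)"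
    using assms(3) by (intro AE_I2) (auto intro!: mult_right_mono order_trans[OF assms(3)])
qed (use assms in auto)

lemma integrable_conv:
  fixes \<rho> :: "'a::euclidean_space \<Rightarrow> real" and w :: "'a \<Rightarrow> 'b::euclidean_space"
  assumes \<rho>: "\<rho> \<in> test_functions \<Omega>" and w: "integrable lborel w"
  shows "integrable lborel (\<lambda>y. \<rho> (x - y) *\<^sub>R w y)"
proof -
  obtain B where B: "\<And>x. norm (\<rho> x) \<le> B" using test_functions_bounded[OF \<rho>] by blast
  have [measurable]: "\<rho> \<in> borel_measurable borel" by (rule test_functions_measurable[OF \<rho>])
  show ?thesis
    using B by (intro integrable_bounded_scaleR[OF w, where B=B]) auto
qed

lemma pd_integrable_conv:
  fixes \<rho> :: "'a::euclidean_space \<Rightarrow> real" and w :: "'a \<Rightarrow> 'b::euclidean_space"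
  assumes \<rho>: "\<rho> \<in> test_functions \<Omega>" and w: "integrable lborel w"
  shows "integrable lborel (\<lambda>y. frechet_derivative \<rho> (at (x - y)) h *\<^sub>R w y)"
  unfolding pd_linear[OF \<rho>, of _ h] scaleR_sum_left
  unfolding real_scaleR_def unfolding scaleR_scaleR[symmetric]
  by (intro Bochner_Integration.integrable_sum integrable_scaleR_right integrable_conv[OF test_functions_pd[OF \<rho>] w])
    assumption+

lemma conv_has_derivative:
  fixes \<rho> :: "'a::euclidean_space \<Rightarrow> real" and w :: "'a \<Rightarrow> 'b::euclidean_space"
  assumes \<rho>: "\<rho> \<in> test_functions \<Omega>" and w: "integrable lborel w"
  shows "(conv \<rho> w has_derivative (\<lambda>h. conv (pd h \<rho>) w x)) (at x)"
  unfolding has_derivative_at_alt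
proof (intro conjI allI impI)
  have int: "integrable lborel (\<lambda>y. frechet_derivative \<rho> (at (x - y)) h *\<^sub>R w y)" for h
    by (rule pd_integrable_conv[OF \<rho> w])
  have bl: "bounded_linear (frechet_derivative \<rho> (at y))" for y
    using test_functions_has_derivative[OF \<rho>] by (rule has_derivative_bounded_linear)
  have "linear (\<lambda>h. conv (pd h \<rho>) w x)"
  proof (rule linearI)
    have [simp]: "frechet_derivative \<rho> (at y) (h + k) = frechet_derivative \<rho> (at y) h + frechet_derivative \<rho> (at y) k"
      "frechet_derivative \<rho> (at y) (c *\<^sub>R h) = c * frechet_derivative \<rho> (at y) h" for y h k c
      using linear_add[OF bounded_linear.linear[OF bl]] linear_cmul[OF bounded_linear.linear[OF bl]] by auto
    show "conv (pd (h + k) \<rho>) w x = conv (pd h \<rho>) w x + conv (pd k \<rho>) w x" for h k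
      by (simp add: conv_def scaleR_add_left int)
    have "conv (pd (c *\<^sub>R h) \<rho>) w x = (\<integral>y. c *\<^sub>R (frechet_derivative \<rho> (at (x - y)) h *\<^sub>R w y) \<partial>lborel)" for c h
      by (simp add: conv_def)
    then show "conv (pd (c *\<^sub>R h) \<rho>) w x = c *\<^sub>R conv (pd h \<rho>) w x" for c h
      by (simp add: conv_def del: scaleR_scaleR)
  qed
  then show "bounded_linear (\<lambda>h. conv (pd h \<rho>) w x)"
    by (simp add: linear_conv_bounded_linear)
  fix e :: real assume e: "e > 0"
  define W where "W = (\<integral>y. norm (w y) \<partial>lborel)"
  have W: "W \<ge> 0" by (simp add: W_def)
  obtain d where d: "d > 0"
    "\<And>x h. norm h < d \<Longrightarrow> \<bar>\<rho> (x + h) - \<rho> x - frechet_derivative \<rho> (at x) h\<bar> \<le> e / (W + 1) * norm h"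
    using test_functions_uniformly_differentiable[OF \<rho>, of "e / (W + 1)"] e W by auto
  show "\<exists>d>0. \<forall>y. norm (y - x) < d \<longrightarrow>
      norm (conv \<rho> w y - conv \<rho> w x - conv (pd (y - x) \<rho>) w x) \<le> e * norm (y - x)"
  proof (intro exI[of _ d] conjI allI impI d(1))
    fix z assume z: "norm (z - x) < d"
    define h where "h = z - x"
    have zy: "z - y = (x - y) + h" for y by (simp add: h_def)
    have "conv \<rho> w z - conv \<rho> w x - conv (pd h \<rho>) w x =
        (\<integral>y. (\<rho> ((x - y) + h) - \<rho> (x - y) - frechet_derivative \<rho> (at (x - y)) h) *\<^sub>R w y \<partial>lborel)"
      unfolding conv_def using integrable_conv[OF \<rho> w, of x] integrable_conv[OF \<rho> w, of z] int[of h]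
      by (simp add: scaleR_diff_left zy)
    also have "norm \<dots> \<le> (\<integral>y. (e / (W + 1) * norm h) * norm (w y) \<partial>lborel)"
    proof (rule norm_integral_le)
      show "norm ((\<rho> (x - y + h) - \<rho> (x - y) - frechet_derivative \<rho> (at (x - y)) h) *\<^sub>R w y) \<le>
          (e / (W + 1) * norm h) * norm (w y)" for y
        using mult_right_mono[OF d(2)[of h "x - y"], of "norm (w y)"] z by (simp add: h_def)
    qed (use w in auto)
    also have "\<dots> = (e / (W + 1) * W) * norm h" by (simp add: W_def)
    also have "\<dots> \<le> e * norm h"
      using e W by (intro mult_right_mono) (auto simp: field_simps)
    finally show "norm (conv \<rho> w z - conv \<rho> w x - conv (pd (z - x) \<rho>) w x) \<le> e * norm (z - x)"
      by (simp add: h_def)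
  qed
qed

lemma conv_continuous:
  fixes \<rho> :: "'a::euclidean_space \<Rightarrow> real" and w :: "'a \<Rightarrow> 'b::euclidean_space"
  assumes "\<rho> \<in> test_functions \<Omega>" "integrable lborel w"
  shows "continuous_on S (conv \<rho> w)"
  using conv_has_derivative[OF assms]
  by (intro has_derivative_continuous_on) (auto intro: has_derivative_at_withinI)

lemma conv_linear_direction:
  fixes \<rho> :: "'a::euclidean_space \<Rightarrow> real" and w :: "'a \<Rightarrow> 'b::euclidean_space"
  assumes "\<rho> \<in> test_functions \<Omega>" "integrable lborel w"
  shows "conv (pd h \<rho>) w x = (\<Sum>b\<in>Basis. (h \<bullet> b) *\<^sub>R conv (pd b \<rho>) w x)"
proof -
  interpret bounded_linear "\<lambda>h. conv (pd h \<rho>) w x"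
    using conv_has_derivative[OF assms] by (rule has_derivative_bounded_linear)
  show ?thesis
    by (subst euclidean_representation[of h, symmetric]) (simp only: sum scaleR)
qed

text \<open>Both mixed derivatives are limits of the same second difference quotient.\<close>

lemma pd_commute:
  fixes \<phi> :: "'a::euclidean_space \<Rightarrow> real"
  assumes \<phi>: "\<phi> \<in> test_functions \<Omega>" and a: "a \<in> Basis" and b: "b \<in> Basis"
  shows "pd a (pd b \<phi>) x = pd b (pd a \<phi>) x"
proof -
  have key: "\<exists>y. dist y x \<le> 2 * t \<and> \<phi> (x + t *\<^sub>R a + t *\<^sub>R b) - \<phi> (x + t *\<^sub>R a) - \<phi> (x + t *\<^sub>R b) + \<phi> x
       = t^2 * pd b (pd a \<phi>) y" if t: "t > 0" and a: "a \<in> Basis" and b: "b \<in> Basis" for t a b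
  proof -
    define g where "g = (\<lambda>z. \<phi> (z + t *\<^sub>R b) - \<phi> z)"
    have sh: "((\<lambda>z. \<phi> (z + t *\<^sub>R b)) has_derivative frechet_derivative \<phi> (at (z + t *\<^sub>R b))) (at z)" for z
      by (rule has_derivative_compose[OF _ test_functions_has_derivative[OF \<phi>], where f'="\<lambda>h. h", simplified])
        (auto intro!: derivative_eq_intros)
    have g: "(g has_derivative (\<lambda>h. frechet_derivative \<phi> (at (z + t *\<^sub>R b)) h - frechet_derivative \<phi> (at z) h)) (at z)" for z
      unfolding g_def by (intro has_derivative_diff sh test_functions_has_derivative[OF \<phi>])
    obtain s where s: "s \<in> {0<..<1}" "g (x + t *\<^sub>R a) - g x =
       frechet_derivative \<phi> (at (x + s *\<^sub>R t *\<^sub>R a + t *\<^sub>R b)) (t *\<^sub>R a) - frechet_derivative \<phi> (at (x + s *\<^sub>R t *\<^sub>R a)) (t *\<^sub>R a)"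
      using real_mvt_along[OF g] by blast
    have bl: "bounded_linear (frechet_derivative \<psi> (at y))" if "\<psi> \<in> test_functions \<Omega>" for y and \<psi> :: "'a \<Rightarrow> real"
      using test_functions_has_derivative[OF that] by (rule has_derivative_bounded_linear)
    have pa: "pd a \<phi> \<in> test_functions \<Omega>" by (rule test_functions_pd[OF \<phi> a])
    obtain r where r: "r \<in> {0<..<1}" "pd a \<phi> (x + s *\<^sub>R t *\<^sub>R a + t *\<^sub>R b) - pd a \<phi> (x + s *\<^sub>R t *\<^sub>R a)
       = frechet_derivative (pd a \<phi>) (at (x + s *\<^sub>R t *\<^sub>R a + r *\<^sub>R t *\<^sub>R b)) (t *\<^sub>R b)"
      using real_mvt_along[OF test_functions_has_derivative[OF pa]] by blast
    define y where "y = x + s *\<^sub>R t *\<^sub>R a + r *\<^sub>R t *\<^sub>R b"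
    have "g (x + t *\<^sub>R a) - g x = t * (pd a \<phi> (x + s *\<^sub>R t *\<^sub>R a + t *\<^sub>R b) - pd a \<phi> (x + s *\<^sub>R t *\<^sub>R a))"
      unfolding s(2) by (simp add: bounded_linear.linear[OF bl[OF \<phi>]] linear_cmul right_diff_distrib)
    also have "\<dots> = t^2 * pd b (pd a \<phi>) y"
      unfolding r(2) y_def by (simp add: bounded_linear.linear[OF bl[OF pa]] linear_cmul power2_eq_square)
    finally have 1: "\<phi> (x + t *\<^sub>R a + t *\<^sub>R b) - \<phi> (x + t *\<^sub>R a) - \<phi> (x + t *\<^sub>R b) + \<phi> x = t^2 * pd b (pd a \<phi>) y"
      by (simp add: g_def)
    have "dist y x \<le> norm (s *\<^sub>R t *\<^sub>R a) + norm (r *\<^sub>R t *\<^sub>R b)"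
      unfolding y_def dist_norm using norm_triangle_ineq[of "s *\<^sub>R t *\<^sub>R a" "r *\<^sub>R t *\<^sub>R b"] by (simp add: add.assoc)
    also have "\<dots> = s * t + r * t" using s(1) r(1) t a b by simp
    also have "\<dots> \<le> 2 * t" 
    proof -
      have "s * t \<le> 1 * t" "r * t \<le> 1 * t"
        using s(1) r(1) t by (intro mult_right_mono; simp)+
      then show ?thesis by simp
    qed
    finally show ?thesis using 1 by blast
  qed
  define t where "t n = 1 / real (Suc n)" for n
  have t: "t n > 0" for n by (auto simp: t_def)
  have t0: "t \<longlonglongrightarrow> 0" unfolding t_def by (rule LIMSEQ_Suc[OF lim_1_over_n])
  have lim: "(\<lambda>n. (\<phi> (x + t n *\<^sub>R a + t n *\<^sub>R b) - \<phi> (x + t n *\<^sub>R a) - \<phi> (x + t n *\<^sub>R b) + \<phi> x) / (t n)^2) \<longlonglongrightarrow> pd b (pd a \<phi>) x"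
    if a: "a \<in> Basis" and b: "b \<in> Basis" for a b
  proof -
    obtain y where y: "\<And>n. dist (y n) x \<le> 2 * t n" "\<And>n. \<phi> (x + t n *\<^sub>R a + t n *\<^sub>R b) - \<phi> (x + t n *\<^sub>R a) - \<phi> (x + t n *\<^sub>R b) + \<phi> x
       = (t n)^2 * pd b (pd a \<phi>) (y n)"
      using key[OF t a b] by metis
    have "(\<lambda>n. dist (y n) x) \<longlonglongrightarrow> 0"
      by (rule tendsto_sandwich[of "\<lambda>_. 0" _ _ "\<lambda>n. 2 * t n"])
        (use y(1) tendsto_mult_right_zero[OF t0, of 2] in auto)
    then have yx: "y \<longlonglongrightarrow> x" by (rule tendsto_dist_iff[THEN iffD2])
    have "continuous_on UNIV (pd b (pd a \<phi>))"
      by (rule test_functions_continuous[OF test_functions_pd[OF test_functions_pd[OF \<phi> a] b]])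
    then have "isCont (pd b (pd a \<phi>)) x"
      using continuous_on_eq_continuous_at[OF open_UNIV] by blast
    from isCont_tendsto_compose[OF this yx]
    have "(\<lambda>n. pd b (pd a \<phi>) (y n)) \<longlonglongrightarrow> pd b (pd a \<phi>) x" .
    then show ?thesis using t by (simp add: y(2) less_imp_neq[THEN not_sym])
  qed
  have eq: "\<phi> (x + t n *\<^sub>R b + t n *\<^sub>R a) - \<phi> (x + t n *\<^sub>R b) - \<phi> (x + t n *\<^sub>R a) + \<phi> x =
      \<phi> (x + t n *\<^sub>R a + t n *\<^sub>R b) - \<phi> (x + t n *\<^sub>R a) - \<phi> (x + t n *\<^sub>R b) + \<phi> x" for n
    by (simp add: add.assoc add.commute[of "t n *\<^sub>R a"])
  show ?thesis
    by (rule LIMSEQ_unique[OF lim[OF b a, unfolded eq] lim[OF a b]])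
qed

section \<open>Approximation by mollification\<close>

definition L1_translation_continuous :: "('a::euclidean_space \<Rightarrow> 'b::euclidean_space) \<Rightarrow> bool" where
  "L1_translation_continuous f \<longleftrightarrow>
     (\<forall>e>0. \<exists>d>0. \<forall>h. norm h < d \<longrightarrow> (\<integral>x. norm (f (x - h) - f x) \<partial>lborel) < e)"

lemma integrable_shift:
  fixes f :: "'a::euclidean_space \<Rightarrow> 'b::{banach, second_countable_topology}"
  assumes "integrable lborel f"
  shows "integrable lborel (\<lambda>x. f (x - h))" "(\<integral>x. f (x - h) \<partial>lborel) = integral\<^sup>L lborel f"
  using integral_lborel_translate[of f "-h"] assms borel_measurable_integrable[OF assms] by auto

lemma L1_translation_continuous_closure:
  fixes f :: "'a::euclidean_space \<Rightarrow> 'b::euclidean_space"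
  assumes f: "integrable lborel f"
    and g: "\<And>e. e > 0 \<Longrightarrow> \<exists>g. integrable lborel g \<and> L1_translation_continuous g \<and>
      (\<integral>x. norm (f x - g x) \<partial>lborel) < e"
  shows "L1_translation_continuous f"
  unfolding L1_translation_continuous_def
proof (intro allI impI)
  fix e :: real assume "e > 0"
  then obtain g where g: "integrable lborel g" "L1_translation_continuous g"
      "(\<integral>x. norm (f x - g x) \<partial>lborel) < e / 3"
    using g[of "e / 3"] by auto
  obtain d where d: "d > 0" "\<And>h. norm h < d \<Longrightarrow> (\<integral>x. norm (g (x - h) - g x) \<partial>lborel) < e / 3"
    using g(2) \<open>e > 0\<close> unfolding L1_translation_continuous_def by (metis divide_pos_pos zero_less_numeral)
  have "(\<integral>x. norm (f (x - h) - f x) \<partial>lborel) < e" if h: "norm h < d" for h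
  proof -
    have fg: "integrable lborel (\<lambda>x. norm (f x - g x))" using f g by auto
    note i = integrable_shift[OF f, of h] integrable_shift[OF g(1), of h] integrable_shift[OF fg, of h]
    have "(\<integral>x. norm (f (x - h) - f x) \<partial>lborel) \<le>
        (\<integral>x. norm (f (x - h) - g (x - h)) + norm (g (x - h) - g x) + norm (f x - g x) \<partial>lborel)"
    proof (rule integral_mono)
      show "norm (f (x - h) - f x) \<le> norm (f (x - h) - g (x - h)) + norm (g (x - h) - g x) + norm (f x - g x)" for x
        using norm_triangle_ineq[of "f (x - h) - g (x - h)" "g (x - h) - g x"]
          norm_triangle_ineq[of "f (x - h) - g x" "g x - f x"] by (simp add: norm_minus_commute)
    qed (use f g i in auto)
    also have "\<dots> = (\<integral>x. norm (f (x - h) - g (x - h)) \<partial>lborel) + (\<integral>x. norm (g (x - h) - g x) \<partial>lborel)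
        + (\<integral>x. norm (f x - g x) \<partial>lborel)"
      using f g i by simp
    also have "\<dots> < e"
      using i(6) g(3) d(2)[OF h] by simp
    finally show ?thesis .
  qed
  then show "\<exists>d>0. \<forall>h. norm h < d \<longrightarrow> (\<integral>x. norm (f (x - h) - f x) \<partial>lborel) < e"
    using d(1) by blast
qed

lemma L1_translation_continuous_limit:
  fixes f :: "'a::euclidean_space \<Rightarrow> 'b::euclidean_space"
  assumes f: "integrable lborel f" and s: "\<And>i. integrable lborel (s i)" "\<And>i::nat. L1_translation_continuous (s i)"
    and lim: "\<And>x. (\<lambda>i. s i x) \<longlonglongrightarrow> f x" and bd: "\<And>i x. norm (s i x) \<le> 2 * norm (f x)"
  shows "L1_translation_continuous f"
proof (rule L1_translation_continuous_closure[OF f])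
  fix e :: real assume e: "e > 0"
  have "(\<lambda>i. \<integral>x. norm (f x - s i x) \<partial>lborel) \<longlonglongrightarrow> (\<integral>x. 0 \<partial>(lborel :: 'a measure))"
  proof (rule integral_dominated_convergence[where w="\<lambda>x. 3 * norm (f x)"])
    show "AE x in lborel. (\<lambda>i. norm (f x - s i x)) \<longlonglongrightarrow> 0"
    proof (rule AE_I2)
      fix x
      have "(\<lambda>i. norm (f x - s i x)) \<longlonglongrightarrow> norm (f x - f x)" by (intro tendsto_intros lim)
      then show "(\<lambda>i. norm (f x - s i x)) \<longlonglongrightarrow> 0" by simp
    qed
    show "AE x in lborel. norm (norm (f x - s i x)) \<le> 3 * norm (f x)" for i
    proof (rule AE_I2)
      show "norm (norm (f x - s i x)) \<le> 3 * norm (f x)" for x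
        using norm_triangle_ineq4[of "f x" "s i x"] bd[of i x] by simp
    qed
  qed (use f s in auto)
  then have "(\<lambda>i. \<integral>x. norm (f x - s i x) \<partial>lborel) \<longlonglongrightarrow> 0" by simp
  then have "eventually (\<lambda>i. (\<integral>x. norm (f x - s i x) \<partial>lborel) < e) sequentially"
    by (rule order_tendstoD(2)[OF _ e])
  then obtain i where "(\<integral>x. norm (f x - s i x) \<partial>lborel) < e"
    by (auto simp: eventually_sequentially)
  then show "\<exists>g. integrable lborel g \<and> L1_translation_continuous g \<and> (\<integral>x. norm (f x - g x) \<partial>lborel) < e"
    using s by blast
qed

lemma L1_translation_continuous_bounded_support:
  fixes f :: "'a::euclidean_space \<Rightarrow> 'b::euclidean_space"
  assumes f: "continuous_on UNIV f" "\<And>x. f x \<noteq> 0 \<Longrightarrow> norm x \<le> R"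
  shows "L1_translation_continuous f"
  unfolding L1_translation_continuous_def
proof (intro allI impI)
  fix e :: real assume e: "e > 0"
  define m where "m = measure lborel (cball (0::'a) (R + 1))"
  have m: "m \<ge> 0" by (simp add: m_def)
  define e' where "e' = e / (m + 1)"
  have e': "e' > 0" using e m by (simp add: e'_def)
  obtain d where d: "d > 0" "\<And>x y. dist x y < d \<Longrightarrow> dist (f x) (f y) < e'"
    using continuous_bounded_support_uniformly_continuous[OF f e'] by blast
  have "(\<integral>x. norm (f (x - h) - f x) \<partial>lborel) < e" if h: "norm h < min d 1" for h
  proof -
    have fin: "emeasure lborel (cball (0::'a) (R + 1)) < \<infinity>" by (rule emeasure_bounded_finite) auto
    have "norm (\<integral>x. norm (f (x - h) - f x) \<partial>lborel) \<le> (\<integral>x. indicator (cball (0::'a) (R + 1)) x * e' \<partial>lborel)"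
    proof (rule norm_integral_le)
      show "integrable lborel (\<lambda>x. indicator (cball (0::'a) (R + 1)) x * e' :: real)"
        using fin by (intro integrable_mult_left integrable_real_indicator) auto
      fix x
      have "dist (x - h) x < d" using h by (simp add: dist_norm)
      then have "norm (f (x - h) - f x) \<le> e'" using d(2) by (metis dist_norm less_imp_le)
      moreover have "f (x - h) = 0 \<and> f x = 0" if "norm x > R + 1"
      proof -
        have "norm (x - h) > R"
          using norm_triangle_ineq2[of x h] h that by linarith
        then show ?thesis using f(2)[of "x - h"] f(2)[of x] that by fastforce
      qed
      ultimately show "norm (norm (f (x - h) - f x)) \<le> indicator (cball 0 (R + 1)) x * e'"
        by (auto simp: indicator_def)
    qed
    also have "\<dots> = m * e'" by (simp add: m_def)
    also have "\<dots> < e" using e m by (simp add: e'_def field_simps)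
    finally show ?thesis by simp
  qed
  then show "\<exists>d>0. \<forall>h. norm h < d \<longrightarrow> (\<integral>x. norm (f (x - h) - f x) \<partial>lborel) < e"
    using d(1) by (intro exI[of _ "min d 1"]) auto
qed

lemma L1_translation_continuous_indicator:
  fixes A :: "'a::euclidean_space set" and v :: "'b::euclidean_space"
  assumes A: "A \<in> sets borel" "A \<subseteq> ball 0 R"
  shows "L1_translation_continuous (\<lambda>x. indicator A x *\<^sub>R v)"
proof (rule L1_translation_continuous_closure)
  have finb: "emeasure lborel B < \<infinity>" if "B \<subseteq> ball 0 R" for B :: "'a set"
    by (rule emeasure_bounded_finite[OF bounded_subset[OF bounded_ball that]])
  show "integrable lborel (\<lambda>x. indicator A x *\<^sub>R v)"
    using A finb[OF A(2)] by (intro integrable_indicator) auto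
  fix e :: real assume e: "e > 0"
  define e' where "e' = e / (2 * (norm v + 1))"
  have nv: "norm v + 1 > 0" by (simp add: add_nonneg_pos)
  have e': "e' > 0" using e nv by (simp add: e'_def)
  obtain U where U: "open U" "A \<subseteq> U" "emeasure lborel (U - A) < e'"
    using outer_regular_lborel[of A e'] A e' by auto
  have "A \<in> sets lebesgue" using A(1) by simp
  then obtain T where T: "closed T" "T \<subseteq> A" "emeasure lebesgue (A - T) < e'"
    by (rule sets_lebesgue_inner_closed[OF _ e'])
  define U' where "U' = U \<inter> ball 0 R"
  have U': "open U'" "T \<subseteq> U'" using U T A by (auto simp: U'_def)
  obtain c :: "'a \<Rightarrow> real" where c: "continuous_on UNIV c" "\<And>x. c x \<in> closed_segment 1 0"
     "\<And>x. x \<in> T \<Longrightarrow> c x = 1" "\<And>x. x \<in> - U' \<Longrightarrow> c x = 0"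
  proof (rule Urysohn[of T "- U'" 1 "0::real"])
    show "T \<inter> - U' = {}" using U'(2) by blast
  qed (use T(1) U'(1) that in auto)
  have c01: "0 \<le> c x" "c x \<le> 1" for x using c(2)[of x] by (auto simp: closed_segment_eq_real_ivl)
  have cc: "continuous_on UNIV (\<lambda>x. c x *\<^sub>R v)" by (intro continuous_intros c)
  have cs: "norm x \<le> R" if "c x *\<^sub>R v \<noteq> 0" for x
  proof -
    have "x \<in> U'" using that c(4)[of x] by auto
    then show ?thesis by (simp add: U'_def)
  qed
  have ci: "integrable lborel (\<lambda>x. c x *\<^sub>R v)"
    by (rule integrable_continuous_bounded_support[OF cc cs])
  have sub: "U' - T \<subseteq> (U - A) \<union> (A - T)" by (auto simp: U'_def)
  have "emeasure lborel (U' - T) \<le> emeasure lborel ((U - A) \<union> (A - T))"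
    using U T A sub by (intro emeasure_mono) auto
  also have "\<dots> \<le> emeasure lborel (U - A) + emeasure lborel (A - T)"
    using U T A by (intro emeasure_subadditive) auto
  also have "\<dots> \<le> ennreal e' + ennreal e'"
    using U(3) T(1,3) A by (intro add_mono) (auto simp: less_imp_le)
  also have "\<dots> = ennreal (2 * e')" using e' by (simp flip: ennreal_plus)
  finally have m: "measure lborel (U' - T) \<le> 2 * e'"
    using e' by (simp add: measure_def enn2real_leI)
  have "norm (\<integral>x. norm (indicator A x *\<^sub>R v - c x *\<^sub>R v) \<partial>lborel) \<le> (\<integral>x. indicator (U' - T) x * norm v \<partial>lborel)"
  proof (rule norm_integral_le)
    show "integrable lborel (\<lambda>x. indicator (U' - T) x * norm v)"
      using U' T finb[of "U' - T"] by (intro integrable_mult_left integrable_real_indicator) (auto simp: U'_def)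
    fix x
    have "\<bar>indicator A x - c x\<bar> \<le> indicator (U' - T) x"
      using c01[of x] c(3)[of x] c(4)[of x] T(2) A U(2) unfolding U'_def indicator_def by auto
    then show "norm (norm (indicator A x *\<^sub>R v - c x *\<^sub>R v)) \<le> indicator (U' - T) x * norm v"
      by (simp flip: scaleR_diff_left add: mult_right_mono)
  qed
  also have "\<dots> = measure lborel (U' - T) * norm v" by simp
  also have "\<dots> \<le> 2 * e' * norm v" using m by (intro mult_right_mono) auto
  also have "\<dots> < e" using e nv by (simp add: e'_def field_simps)
  finally have "(\<integral>x. norm (indicator A x *\<^sub>R v - c x *\<^sub>R v) \<partial>lborel) < e" by simp
  then show "\<exists>g. integrable lborel g \<and> L1_translation_continuous g \<and>
      (\<integral>x. norm (indicator A x *\<^sub>R v - g x) \<partial>lborel) < e"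
    using ci L1_translation_continuous_bounded_support[OF cc cs] by blast
qed

lemma integrable_imp_L1_translation_continuous:
  fixes f :: "'a::euclidean_space \<Rightarrow> 'b::euclidean_space"
  assumes "integrable lborel f"
  shows "L1_translation_continuous f"
  using assms
proof (induction rule: integrable_induct)
  case (base A c)
  show ?case
  proof (rule L1_translation_continuous_limit[where s="\<lambda>i x. indicator (A \<inter> ball 0 (real i)) x *\<^sub>R c"])
    show "integrable lborel (\<lambda>x. indicator A x *\<^sub>R c)"
      using base by (intro integrable_indicator) auto
    show "integrable lborel (\<lambda>x. indicator (A \<inter> ball 0 (real i)) x *\<^sub>R c)" for i
    proof (rule integrable_indicator)
      show "emeasure lborel (A \<inter> ball 0 (real i)) < \<infinity>"
        by (intro emeasure_bounded_finite) (auto intro: bounded_subset[OF bounded_ball])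
    qed (use base in auto)
    show "L1_translation_continuous (\<lambda>x. indicator (A \<inter> ball 0 (real i)) x *\<^sub>R c)" for i
      using base by (intro L1_translation_continuous_indicator[where R="real i"]) auto
    show "(\<lambda>i. indicator (A \<inter> ball 0 (real i)) x *\<^sub>R c) \<longlonglongrightarrow> indicator A x *\<^sub>R c" for x
    proof (rule tendsto_eventually)
      obtain n where "norm x < real n" using reals_Archimedean2 by blast
      then have "x \<in> ball 0 (real i)" if "i \<ge> n" for i using that by auto
      then show "\<forall>\<^sub>F i in sequentially. indicator (A \<inter> ball 0 (real i)) x *\<^sub>R c = indicator A x *\<^sub>R c"
        unfolding eventually_sequentially by (intro exI[of _ n]) (auto simp: indicator_def)
    qed
  qed (auto simp: indicator_def)
next
  case (add f g)
  show ?case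
    unfolding L1_translation_continuous_def
  proof (intro allI impI)
    fix e :: real assume "e > 0"
    then have "e / 2 > 0" by simp
    from add(3) this obtain d1 where d1: "d1 > 0"
        "\<And>h. norm h < d1 \<Longrightarrow> (\<integral>x. norm (f (x - h) - f x) \<partial>lborel) < e / 2"
      unfolding L1_translation_continuous_def by blast
    from add(4) \<open>e / 2 > 0\<close> obtain d2 where d2: "d2 > 0"
        "\<And>h. norm h < d2 \<Longrightarrow> (\<integral>x. norm (g (x - h) - g x) \<partial>lborel) < e / 2"
      unfolding L1_translation_continuous_def by blast
    have "(\<integral>x. norm (f (x - h) + g (x - h) - (f x + g x)) \<partial>lborel) < e" if h: "norm h < min d1 d2" for h
    proof -
      note i = integrable_shift[OF add(1), of h] integrable_shift[OF add(2), of h]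
      have "(\<integral>x. norm (f (x - h) + g (x - h) - (f x + g x)) \<partial>lborel)
          \<le> (\<integral>x. norm (f (x - h) - f x) + norm (g (x - h) - g x) \<partial>lborel)"
        using add i by (intro integral_mono) (auto intro: norm_diff_triangle_ineq)
      also have "\<dots> = (\<integral>x. norm (f (x - h) - f x) \<partial>lborel) + (\<integral>x. norm (g (x - h) - g x) \<partial>lborel)"
        using add i by simp
      also have "\<dots> < e" using d1(2)[of h] d2(2)[of h] h by simp
      finally show ?thesis .
    qed
    then show "\<exists>d>0. \<forall>h. norm h < d \<longrightarrow> (\<integral>x. norm (f (x - h) + g (x - h) - (f x + g x)) \<partial>lborel) < e"
      using d1(1) d2(1) by (intro exI[of _ "min d1 d2"]) auto
  qed
next
  case (lim f s)
  then show ?case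
    by (intro L1_translation_continuous_limit[where s=s and f=f]) auto
qed

text \<open>This inequality reduces \<open>L\<^sup>2\<close> continuity of translations for \<open>f\<close> to \<open>L\<^sup>1\<close> continuity
  for \<open>\<bar>f\<bar> f\<close>.\<close>

lemma norm_diff_power2_le:
  fixes a b :: "'a::real_inner"
  shows "(norm (a - b))\<^sup>2 \<le> 2 * norm (norm a *\<^sub>R a - norm b *\<^sub>R b)"
proof (cases "a = b")
  case False
  define s where "s = norm a + norm b"
  have sa: "norm (a - b) \<le> s" unfolding s_def by (rule norm_triangle_ineq4)
  have ab: "(norm (a - b))\<^sup>2 = (norm a)\<^sup>2 + (norm b)\<^sup>2 - 2 * (a \<bullet> b)"
    by (simp add: power2_norm_eq_inner inner_diff_left inner_diff_right inner_commute)
  have "(norm a *\<^sub>R a - norm b *\<^sub>R b) \<bullet> (a - b) = norm a ^ 3 + norm b ^ 3 - s * (a \<bullet> b)"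
    unfolding s_def by (simp add: inner_diff_left inner_diff_right inner_commute algebra_simps
      power3_eq_cube flip: power2_norm_eq_inner) (simp add: power2_eq_square)
  also have "\<dots> = s * (norm (a - b))\<^sup>2 / 2 + s * (norm a - norm b)\<^sup>2 / 2"
    unfolding ab by (simp add: s_def field_simps power2_eq_square power3_eq_cube)
  finally have "s * (norm (a - b))\<^sup>2 \<le> 2 * ((norm a *\<^sub>R a - norm b *\<^sub>R b) \<bullet> (a - b))"
    by (simp add: s_def)
  also have "\<dots> \<le> 2 * (norm (norm a *\<^sub>R a - norm b *\<^sub>R b) * norm (a - b))"
    using norm_cauchy_schwarz by simp
  finally have "s * (norm (a - b))\<^sup>2 \<le> 2 * (norm (norm a *\<^sub>R a - norm b *\<^sub>R b) * norm (a - b))" .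
  moreover have "norm (a - b) * (norm (a - b))\<^sup>2 \<le> s * (norm (a - b))\<^sup>2"
    using sa by (intro mult_right_mono) auto
  ultimately have "norm (a - b) * (norm (a - b))\<^sup>2 \<le> norm (a - b) * (2 * norm (norm a *\<^sub>R a - norm b *\<^sub>R b))"
    by (simp add: mult_ac)
  then show ?thesis using False by simp
qed simp

lemma L2_translation_continuous:
  fixes f :: "'a::euclidean_space \<Rightarrow> 'b::euclidean_space"
  assumes [measurable]: "f \<in> borel_measurable borel" and f: "integrable lborel (\<lambda>x. (norm (f x))\<^sup>2)" and "e > 0"
  shows "\<exists>d>0. \<forall>h. norm h < d \<longrightarrow> (\<integral>\<^sup>+x. ennreal ((norm (f (x - h) - f x))\<^sup>2) \<partial>lborel) \<le> ennreal e"
proof -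
  define F where "F x = norm (f x) *\<^sub>R f x" for x
  have [measurable]: "F \<in> borel_measurable borel" unfolding F_def by measurable
  have F: "integrable lborel F"
    by (rule Bochner_Integration.integrable_bound[OF f]) (auto simp: F_def power2_eq_square)
  obtain d where d: "d > 0" "\<And>h. norm h < d \<Longrightarrow> (\<integral>x. norm (F (x - h) - F x) \<partial>lborel) < e / 2"
    using integrable_imp_L1_translation_continuous[OF F] \<open>e > 0\<close>
    unfolding L1_translation_continuous_def by (metis half_gt_zero)
  have "(\<integral>\<^sup>+x. ennreal ((norm (f (x - h) - f x))\<^sup>2) \<partial>lborel) \<le> ennreal e" if h: "norm h < d" for h
  proof -
    have i: "integrable lborel (\<lambda>x. 2 * norm (F (x - h) - F x))"
      using F integrable_shift[OF F, of h] by auto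
    have "(\<integral>\<^sup>+x. ennreal ((norm (f (x - h) - f x))\<^sup>2) \<partial>lborel) \<le> (\<integral>\<^sup>+x. ennreal (2 * norm (F (x - h) - F x)) \<partial>lborel)"
      unfolding F_def by (intro nn_integral_mono ennreal_leI norm_diff_power2_le)
    also have "\<dots> = ennreal (\<integral>x. 2 * norm (F (x - h) - F x) \<partial>lborel)"
      by (rule nn_integral_eq_integral[OF i]) auto
    also have "\<dots> \<le> ennreal e" using d(2)[OF h] by (intro ennreal_leI) simp
    finally show ?thesis .
  qed
  then show ?thesis using d(1) by blast
qed

lemma L1_translation_continuous_nn:
  fixes f :: "'a::euclidean_space \<Rightarrow> 'b::euclidean_space"
  assumes f: "integrable lborel f" and "e > 0"
  shows "\<exists>d>0. \<forall>h. norm h < d \<longrightarrow> (\<integral>\<^sup>+x. ennreal (norm (f (x - h) - f x)) \<partial>lborel) \<le> ennreal e"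
proof -
  obtain d where d: "d > 0" "\<And>h. norm h < d \<Longrightarrow> (\<integral>x. norm (f (x - h) - f x) \<partial>lborel) < e"
    using integrable_imp_L1_translation_continuous[OF f] \<open>e > 0\<close>
    unfolding L1_translation_continuous_def by metis
  have "(\<integral>\<^sup>+x. ennreal (norm (f (x - h) - f x)) \<partial>lborel) \<le> ennreal e" if h: "norm h < d" for h
  proof -
    have i: "integrable lborel (\<lambda>x. norm (f (x - h) - f x))"
      using f integrable_shift[OF f, of h] by auto
    show ?thesis
      using nn_integral_eq_integral[OF i] d(2)[OF h] by (auto intro: ennreal_leI)
  qed
  then show ?thesis using d(1) by blast
qed

lemma conv_diff_eq:
  fixes w :: "'a::euclidean_space \<Rightarrow> 'b::euclidean_space"
  assumes \<rho>: "mollifier r \<rho>" and w: "integrable lborel w"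
  shows "conv \<rho> w x - w x = (\<integral>y. \<rho> y *\<^sub>R (w (x - y) - w x) \<partial>lborel)"
    and "integrable lborel (\<lambda>y. \<rho> y *\<^sub>R (w (x - y) - w x))"
proof -
  note m = mollifierD[OF \<rho>]
  have [measurable]: "\<rho> \<in> borel_measurable borel" "w \<in> borel_measurable borel"
    using m(6) w by auto
  have i: "integrable lborel (\<lambda>y. \<rho> (x - y) *\<^sub>R w y)" by (rule integrable_conv[OF m(1) w])
  have eq: "(\<lambda>y. \<rho> (x - (x - y)) *\<^sub>R w (x - y)) = (\<lambda>y. \<rho> y *\<^sub>R w (x - y))" by simp
  have 1: "integrable lborel (\<lambda>y. \<rho> y *\<^sub>R w (x - y))" "conv \<rho> w x = (\<integral>y. \<rho> y *\<^sub>R w (x - y) \<partial>lborel)"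
    using integral_lborel_reflect[of "\<lambda>y. \<rho> (x - y) *\<^sub>R w y" x] i unfolding eq conv_def by auto
  have 2: "integrable lborel (\<lambda>y. \<rho> y *\<^sub>R w x)" using m(5) by auto
  show "integrable lborel (\<lambda>y. \<rho> y *\<^sub>R (w (x - y) - w x))"
    unfolding scaleR_diff_right using 1 2 by auto
  show "conv \<rho> w x - w x = (\<integral>y. \<rho> y *\<^sub>R (w (x - y) - w x) \<partial>lborel)"
    unfolding scaleR_diff_right using 1 2 m(4,5) by simp
qed

lemma conv_error_bound:
  fixes w :: "'a::euclidean_space \<Rightarrow> 'b::euclidean_space" and N :: "real \<Rightarrow> real"
  assumes \<rho>: "mollifier r \<rho>" and w [measurable]: "w \<in> borel_measurable borel"
    and N [measurable]: "N \<in> borel_measurable borel"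
    and T: "\<And>y. norm y < r \<Longrightarrow> (\<integral>\<^sup>+x. ennreal (N (norm (w (x - y) - w x))) \<partial>lborel) \<le> ennreal e"
    and H: "\<And>x. ennreal (N (norm (conv \<rho> w x - w x))) \<le> (\<integral>\<^sup>+y. ennreal (\<rho> y) * ennreal (N (norm (w (x - y) - w x))) \<partial>lborel)"
  shows "(\<integral>\<^sup>+x. ennreal (N (norm (conv \<rho> w x - w x))) \<partial>lborel) \<le> ennreal e"
proof -
  note m = mollifierD[OF \<rho>]
  have [measurable]: "\<rho> \<in> borel_measurable borel" by (rule m(6))
  have "(\<integral>\<^sup>+x. ennreal (N (norm (conv \<rho> w x - w x))) \<partial>lborel)
      \<le> (\<integral>\<^sup>+x. \<integral>\<^sup>+y. ennreal (\<rho> y) * ennreal (N (norm (w (x - y) - w x))) \<partial>lborel \<partial>lborel)"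
    by (intro nn_integral_mono H)
  also have "\<dots> = (\<integral>\<^sup>+y. \<integral>\<^sup>+x. ennreal (\<rho> y) * ennreal (N (norm (w (x - y) - w x))) \<partial>lborel \<partial>lborel)"
    by (rule lborel_pair.Fubini') measurable
  also have "\<dots> = (\<integral>\<^sup>+y. ennreal (\<rho> y) * (\<integral>\<^sup>+x. ennreal (N (norm (w (x - y) - w x))) \<partial>lborel) \<partial>lborel)"
    by (intro nn_integral_cong nn_integral_cmult) measurable
  also have "\<dots> \<le> (\<integral>\<^sup>+y. ennreal (\<rho> y) * ennreal e \<partial>lborel)"
  proof (rule nn_integral_mono)
    fix y
    show "ennreal (\<rho> y) * (\<integral>\<^sup>+x. ennreal (N (norm (w (x - y) - w x))) \<partial>lborel) \<le> ennreal (\<rho> y) * ennreal e"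
      using T[of y] m(3)[of y] by (cases "\<rho> y = 0") (auto intro: mult_left_mono)
  qed
  also have "\<dots> = (\<integral>\<^sup>+y. ennreal (\<rho> y) \<partial>lborel) * ennreal e"
    by (intro nn_integral_multc) measurable
  also have "(\<integral>\<^sup>+y. ennreal (\<rho> y) \<partial>lborel) = 1"
    using nn_integral_eq_integral[OF m(5)] m(2,4) by simp
  finally show ?thesis by simp
qed

lemma mollifier_norm_bound:
  fixes w :: "'a::euclidean_space \<Rightarrow> 'b::euclidean_space"
  assumes \<rho>: "mollifier r \<rho>" and w: "integrable lborel w"
  shows "norm (conv \<rho> w x - w x) \<le> (\<integral>y. \<rho> y * norm (w (x - y) - w x) \<partial>lborel)"
    and "integrable lborel (\<lambda>y. \<rho> y * norm (w (x - y) - w x))"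
proof -
  note m = mollifierD[OF \<rho>]
  have "norm (conv \<rho> w x - w x) \<le> (\<integral>y. norm (\<rho> y *\<^sub>R (w (x - y) - w x)) \<partial>lborel)"
    unfolding conv_diff_eq[OF assms] by (rule integral_norm_bound)
  then show "norm (conv \<rho> w x - w x) \<le> (\<integral>y. \<rho> y * norm (w (x - y) - w x) \<partial>lborel)"
    using m(2) by simp
  show "integrable lborel (\<lambda>y. \<rho> y * norm (w (x - y) - w x))"
    using integrable_norm[OF conv_diff_eq(2)[OF assms, of x]] m(2) by simp
qed

lemma conv_error_L1:
  fixes w :: "'a::euclidean_space \<Rightarrow> 'b::euclidean_space"
  assumes \<rho>: "mollifier r \<rho>" and w: "integrable lborel w"
    and T: "\<And>y. norm y < r \<Longrightarrow> (\<integral>\<^sup>+x. ennreal (norm (w (x - y) - w x)) \<partial>lborel) \<le> ennreal e"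
  shows "(\<integral>\<^sup>+x. ennreal (norm (conv \<rho> w x - w x)) \<partial>lborel) \<le> ennreal e"
proof (rule conv_error_bound[OF \<rho>, where N="\<lambda>t. t"])
  note m = mollifierD[OF \<rho>]
  fix x
  have "ennreal (norm (conv \<rho> w x - w x)) \<le> ennreal (\<integral>y. \<rho> y * norm (w (x - y) - w x) \<partial>lborel)"
    by (intro ennreal_leI mollifier_norm_bound[OF \<rho> w])
  also have "\<dots> = (\<integral>\<^sup>+y. ennreal (\<rho> y * norm (w (x - y) - w x)) \<partial>lborel)"
    using m(2) by (intro nn_integral_eq_integral[symmetric] mollifier_norm_bound[OF \<rho> w]) auto
  also have "\<dots> = (\<integral>\<^sup>+y. ennreal (\<rho> y) * ennreal (norm (w (x - y) - w x)) \<partial>lborel)"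
    using m(2) by (simp add: ennreal_mult)
  finally show "ennreal (norm (conv \<rho> w x - w x)) \<le> (\<integral>\<^sup>+y. ennreal (\<rho> y) * ennreal (norm (w (x - y) - w x)) \<partial>lborel)" .
qed (use w T in auto)

lemma conv_error_L2:
  fixes w :: "'a::euclidean_space \<Rightarrow> 'b::euclidean_space"
  assumes \<rho>: "mollifier r \<rho>" and w: "integrable lborel w"
    and T: "\<And>y. norm y < r \<Longrightarrow> (\<integral>\<^sup>+x. ennreal ((norm (w (x - y) - w x))\<^sup>2) \<partial>lborel) \<le> ennreal e"
  shows "(\<integral>\<^sup>+x. ennreal ((norm (conv \<rho> w x - w x))\<^sup>2) \<partial>lborel) \<le> ennreal e"
proof (rule conv_error_bound[OF \<rho>, where N="\<lambda>t. t\<^sup>2"])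
  note m = mollifierD[OF \<rho>]
  have [measurable]: "\<rho> \<in> borel_measurable borel" "w \<in> borel_measurable borel"
    using m(6) w by auto
  fix x
  define k where "k y = norm (w (x - y) - w x)" for y
  define a where "a = (\<integral>y. \<rho> y * k y \<partial>lborel)"
  have k [measurable]: "k \<in> borel_measurable borel" unfolding k_def by measurable
  have ik: "integrable lborel (\<lambda>y. \<rho> y * k y)"
    unfolding k_def by (rule mollifier_norm_bound[OF \<rho> w])
  have na: "norm (conv \<rho> w x - w x) \<le> a"
    unfolding a_def k_def by (rule mollifier_norm_bound[OF \<rho> w])
  have "ennreal (a\<^sup>2) \<le> (\<integral>\<^sup>+y. ennreal (\<rho> y * (k y)\<^sup>2) \<partial>lborel)"
  proof (cases "(\<integral>\<^sup>+y. ennreal (\<rho> y * (k y)\<^sup>2) \<partial>lborel) = \<infinity>")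
    case False
    then have i2: "integrable lborel (\<lambda>y. \<rho> y * (k y)\<^sup>2)"
      using m(2) by (intro integrableI_nonneg) (auto simp: less_top)
    have "0 \<le> (\<integral>y. \<rho> y * (k y - a)\<^sup>2 \<partial>lborel)"
      using m(2) by (intro integral_nonneg_AE) auto
    also have "(\<lambda>y. \<rho> y * (k y - a)\<^sup>2) = (\<lambda>y. \<rho> y * (k y)\<^sup>2 - (2 * a) * (\<rho> y * k y) + \<rho> y * a\<^sup>2)"
      by (auto simp: power2_eq_square algebra_simps)
    also have "(\<integral>y. \<rho> y * (k y)\<^sup>2 - (2 * a) * (\<rho> y * k y) + \<rho> y * a\<^sup>2 \<partial>lborel) =
        (\<integral>y. \<rho> y * (k y)\<^sup>2 \<partial>lborel) - (2 * a) * a + 1 * a\<^sup>2"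
      using i2 ik m(4,5) by (simp add: a_def)
    finally have "a\<^sup>2 \<le> (\<integral>y. \<rho> y * (k y)\<^sup>2 \<partial>lborel)" by (simp add: power2_eq_square)
    then show ?thesis
      using nn_integral_eq_integral[OF i2] m(2) by (simp add: ennreal_leI)
  qed simp
  also have "\<dots> = (\<integral>\<^sup>+y. ennreal (\<rho> y) * ennreal ((k y)\<^sup>2) \<partial>lborel)"
    using m(2) by (simp add: ennreal_mult)
  finally have "ennreal (a\<^sup>2) \<le> \<dots>" .
  moreover have "(norm (conv \<rho> w x - w x))\<^sup>2 \<le> a\<^sup>2"
    using na by (intro power_mono) auto
  ultimately show "ennreal ((norm (conv \<rho> w x - w x))\<^sup>2) \<le> (\<integral>\<^sup>+y. ennreal (\<rho> y) * ennreal ((norm (w (x - y) - w x))\<^sup>2) \<partial>lborel)"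
    unfolding k_def by (meson ennreal_leI order_trans)
qed (use w T in auto)

lemma integrable_tendsto_0_of_nn_integral:
  fixes f :: "nat \<Rightarrow> 'a \<Rightarrow> real"
  assumes f [measurable]: "\<And>n. f n \<in> borel_measurable M" and nn: "\<And>n x. f n x \<ge> 0"
    and e: "\<And>e. e > 0 \<Longrightarrow> \<forall>\<^sub>F n in sequentially. (\<integral>\<^sup>+x. ennreal (f n x) \<partial>M) \<le> ennreal e"
  shows "\<forall>\<^sub>F n in sequentially. integrable M (f n)" "(\<lambda>n. integral\<^sup>L M (f n)) \<longlonglongrightarrow> 0"
proof -
  have i: "integrable M (f n)" if "(\<integral>\<^sup>+x. ennreal (f n x) \<partial>M) \<le> ennreal e" for n e
    using that nn by (intro integrableI_nonneg f) (auto intro: le_less_trans)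
  show "\<forall>\<^sub>F n in sequentially. integrable M (f n)"
  proof (rule eventually_mono)
    show "\<forall>\<^sub>F n in sequentially. (\<integral>\<^sup>+x. ennreal (f n x) \<partial>M) \<le> ennreal 1" by (rule e) simp
  qed (rule i)
  show "(\<lambda>n. integral\<^sup>L M (f n)) \<longlonglongrightarrow> 0"
  proof (rule tendstoI)
    fix e :: real assume "e > 0"
    then have "\<forall>\<^sub>F n in sequentially. (\<integral>\<^sup>+x. ennreal (f n x) \<partial>M) \<le> ennreal (e / 2)" by (intro e) auto
    then show "\<forall>\<^sub>F n in sequentially. dist (integral\<^sup>L M (f n)) 0 < e"
    proof (rule eventually_mono)
      fix n assume n: "(\<integral>\<^sup>+x. ennreal (f n x) \<partial>M) \<le> ennreal (e / 2)"
      then have "ennreal (integral\<^sup>L M (f n)) \<le> ennreal (e / 2)"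
        using nn_integral_eq_integral[OF i[OF n]] nn by simp
      then show "dist (integral\<^sup>L M (f n)) 0 < e"
        using \<open>e > 0\<close> nn by (simp add: integral_nonneg_AE)
    qed
  qed
qed

definition mollifiers :: "(nat \<Rightarrow> 'a::euclidean_space \<Rightarrow> real) \<Rightarrow> bool" where
  "mollifiers \<rho> \<longleftrightarrow> (\<forall>n. mollifier (1 / real (Suc n)) (\<rho> n))"

lemma mollifiers_eventually:
  assumes "mollifiers \<rho>" "r > 0"
  shows "\<forall>\<^sub>F n in sequentially. mollifier r (\<rho> n)"
proof -
  have "\<forall>\<^sub>F n in sequentially. 1 / real (Suc n) < r"
    using order_tendstoD(2)[OF LIMSEQ_Suc[OF lim_1_over_n] assms(2)] by simp
  then show ?thesis
    by (rule eventually_mono) (use assms(1) in \<open>force simp: mollifiers_def mollifier_def\<close>)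
qed

lemma mollifiers_test: "mollifiers \<rho> \<Longrightarrow> \<rho> n \<in> test_functions UNIV"
  by (auto simp: mollifiers_def mollifier_def)

lemma mollifiers_subseq:
  assumes "mollifiers \<rho>" "strict_mono s"
  shows "mollifiers (\<lambda>n. \<rho> (s n))"
  unfolding mollifiers_def
proof
  fix n
  have "n \<le> s n" by (rule strict_mono_imp_increasing[OF assms(2)])
  then have "1 / real (Suc (s n)) \<le> 1 / real (Suc n)" by (intro divide_left_mono) auto
  moreover have "mollifier (1 / real (Suc (s n))) (\<rho> (s n))" using assms(1) by (simp add: mollifiers_def)
  ultimately show "mollifier (1 / real (Suc n)) (\<rho> (s n))"
    unfolding mollifier_def by (meson less_le_trans)
qed

lemma conv_measurable:
  fixes w :: "'a::euclidean_space \<Rightarrow> 'b::euclidean_space"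
  assumes "\<rho> \<in> test_functions \<Omega>" "integrable lborel w"
  shows "conv \<rho> w \<in> borel_measurable borel"
  by (intro borel_measurable_continuous_onI conv_continuous[OF assms])

lemma mollifiers_L1:
  fixes w :: "'a::euclidean_space \<Rightarrow> 'b::euclidean_space"
  assumes \<rho>: "mollifiers \<rho>" and w: "integrable lborel w"
  shows "\<forall>\<^sub>F n in sequentially. integrable lborel (\<lambda>x. norm (conv (\<rho> n) w x - w x))"
    "(\<lambda>n. \<integral>x. norm (conv (\<rho> n) w x - w x) \<partial>lborel) \<longlonglongrightarrow> 0"
proof -
  have m: "(\<lambda>x. norm (conv (\<rho> n) w x - w x)) \<in> borel_measurable lborel" for n
    using conv_measurable[OF mollifiers_test[OF \<rho>] w, of n] borel_measurable_integrable[OF w] by measurable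
  have *: "\<forall>\<^sub>F n in sequentially. (\<integral>\<^sup>+x. ennreal (norm (conv (\<rho> n) w x - w x)) \<partial>lborel) \<le> ennreal e"
    if e: "e > 0" for e
  proof -
    obtain d where d: "d > 0" "\<And>h. norm h < d \<Longrightarrow> (\<integral>\<^sup>+x. ennreal (norm (w (x - h) - w x)) \<partial>lborel) \<le> ennreal e"
      using L1_translation_continuous_nn[OF w e] by blast
    show ?thesis
      using mollifiers_eventually[OF \<rho> d(1)]
      by (rule eventually_mono) (rule conv_error_L1[OF _ w d(2)])
  qed
  show "\<forall>\<^sub>F n in sequentially. integrable lborel (\<lambda>x. norm (conv (\<rho> n) w x - w x))"
    "(\<lambda>n. \<integral>x. norm (conv (\<rho> n) w x - w x) \<partial>lborel) \<longlonglongrightarrow> 0"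
    by (rule integrable_tendsto_0_of_nn_integral[OF m _ *]; simp)+
qed

lemma mollifiers_L2:
  fixes w :: "'a::euclidean_space \<Rightarrow> 'b::euclidean_space"
  assumes \<rho>: "mollifiers \<rho>" and w: "integrable lborel w" "integrable lborel (\<lambda>x. (norm (w x))\<^sup>2)"
  shows "\<forall>\<^sub>F n in sequentially. integrable lborel (\<lambda>x. (norm (conv (\<rho> n) w x - w x))\<^sup>2)"
    "(\<lambda>n. \<integral>x. (norm (conv (\<rho> n) w x - w x))\<^sup>2 \<partial>lborel) \<longlonglongrightarrow> 0"
proof -
  have wm [measurable]: "w \<in> borel_measurable borel" using w(1) by auto
  have m: "(\<lambda>x. (norm (conv (\<rho> n) w x - w x))\<^sup>2) \<in> borel_measurable lborel" for n
    using conv_measurable[OF mollifiers_test[OF \<rho>] w(1), of n] by measurable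
  have *: "\<forall>\<^sub>F n in sequentially. (\<integral>\<^sup>+x. ennreal ((norm (conv (\<rho> n) w x - w x))\<^sup>2) \<partial>lborel) \<le> ennreal e"
    if e: "e > 0" for e
  proof -
    obtain d where d: "d > 0" "\<And>h. norm h < d \<Longrightarrow> (\<integral>\<^sup>+x. ennreal ((norm (w (x - h) - w x))\<^sup>2) \<partial>lborel) \<le> ennreal e"
      using L2_translation_continuous[OF wm w(2) e] by blast
    show ?thesis
      using mollifiers_eventually[OF \<rho> d(1)]
      by (rule eventually_mono) (rule conv_error_L2[OF _ w(1) d(2)])
  qed
  show "\<forall>\<^sub>F n in sequentially. integrable lborel (\<lambda>x. (norm (conv (\<rho> n) w x - w x))\<^sup>2)"
    "(\<lambda>n. \<integral>x. (norm (conv (\<rho> n) w x - w x))\<^sup>2 \<partial>lborel) \<longlonglongrightarrow> 0"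
    by (rule integrable_tendsto_0_of_nn_integral[OF m _ *]; simp)+
qed

lemma mollifiers_AE_subseq:
  fixes w :: "'a::euclidean_space \<Rightarrow> 'b::euclidean_space"
  assumes \<rho>: "mollifiers \<rho>" and w: "integrable lborel w"
  obtains s where "strict_mono s" "AE x in lborel. (\<lambda>n. conv (\<rho> (s n)) w x) \<longlonglongrightarrow> w x"
proof -
  obtain N where N: "\<And>n. n \<ge> N \<Longrightarrow> integrable lborel (\<lambda>x. norm (conv (\<rho> n) w x - w x))"
    using mollifiers_L1(1)[OF assms] by (auto simp: eventually_sequentially)
  have "integrable lborel (\<lambda>x. conv (\<rho> (n + N)) w x - w x)" for n
  proof -
    have "(\<lambda>x. conv (\<rho> (n + N)) w x - w x) \<in> borel_measurable lborel"
      using conv_measurable[OF mollifiers_test[OF \<rho>] w, of "n + N"] borel_measurable_integrable[OF w] by measurable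
    from integrable_norm_iff[OF this] show ?thesis using N[of "n + N"] by simp
  qed
  moreover have "(\<lambda>n. \<integral>x. norm (conv (\<rho> (n + N)) w x - w x) \<partial>lborel) \<longlonglongrightarrow> 0"
    using LIMSEQ_ignore_initial_segment[OF mollifiers_L1(2)[OF assms], of N] by simp
  ultimately obtain s where s: "strict_mono s"
      "AE x in lborel. (\<lambda>n. conv (\<rho> (s n + N)) w x - w x) \<longlonglongrightarrow> 0"
    using tendsto_L1_AE_subseq[of lborel "\<lambda>n x. conv (\<rho> (n + N)) w x - w x"] by auto
  have "strict_mono (\<lambda>n. s n + N)" using s(1) by (auto simp: strict_mono_def)
  moreover have "AE x in lborel. (\<lambda>n. conv (\<rho> (s n + N)) w x) \<longlonglongrightarrow> w x"
    using s(2) by (rule AE_mp) (auto simp: LIM_zero_iff)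
  ultimately show ?thesis using that by blast
qed

lemma tendsto_integral_inner_L2:
  fixes a b :: "'a \<Rightarrow> 'b::euclidean_space" and A B :: "nat \<Rightarrow> 'a \<Rightarrow> 'b"
  assumes [measurable]: "a \<in> borel_measurable M" "b \<in> borel_measurable M" "\<eta> \<in> borel_measurable M"
      "\<And>n. A n \<in> borel_measurable M" "\<And>n. B n \<in> borel_measurable M"
    and a: "integrable M (\<lambda>x. (norm (a x))\<^sup>2)" and b: "integrable M (\<lambda>x. (norm (b x))\<^sup>2)"
    and A: "\<forall>\<^sub>F n in sequentially. integrable M (\<lambda>x. (norm (A n x - a x))\<^sup>2)"
      "(\<lambda>n. \<integral>x. (norm (A n x - a x))\<^sup>2 \<partial>M) \<longlonglongrightarrow> 0"
    and B: "\<forall>\<^sub>F n in sequentially. integrable M (\<lambda>x. (norm (B n x - b x))\<^sup>2)"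
      "(\<lambda>n. \<integral>x. (norm (B n x - b x))\<^sup>2 \<partial>M) \<longlonglongrightarrow> 0"
    and \<eta>: "\<And>x. \<bar>\<eta> x\<bar> \<le> K"
  shows "(\<lambda>n. \<integral>x. \<eta> x * (A n x \<bullet> B n x) \<partial>M) \<longlonglongrightarrow> (\<integral>x. \<eta> x * (a x \<bullet> b x) \<partial>M)"
    and "integrable M (\<lambda>x. \<eta> x * (a x \<bullet> b x))"
proof -
  have K: "K \<ge> 0" using \<eta>[of undefined] by linarith
  have young: "\<bar>p \<bullet> q\<bar> \<le> (norm p)\<^sup>2 / t + t * (norm q)\<^sup>2" if "t > 0" for p q :: 'b and t :: real
  proof -
    have "\<bar>p \<bullet> q\<bar> \<le> norm p * norm q" by (rule Cauchy_Schwarz_ineq2)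
    moreover have "0 \<le> (norm p - t * norm q)\<^sup>2" by simp
    then have "2 * (t * (norm p * norm q)) \<le> (norm p)\<^sup>2 + t * t * (norm q)\<^sup>2"
      by (simp add: power2_eq_square algebra_simps)
    then have "2 * (norm p * norm q) \<le> (norm p)\<^sup>2 / t + t * (norm q)\<^sup>2"
      using that by (simp add: field_simps)
    moreover have "0 \<le> norm p * norm q" by simp
    ultimately show ?thesis by linarith
  qed
  show iab: "integrable M (\<lambda>x. \<eta> x * (a x \<bullet> b x))"
  proof (rule Bochner_Integration.integrable_bound[where f="\<lambda>x. K * ((norm (a x))\<^sup>2 + (norm (b x))\<^sup>2)"])
    show "AE x in M. norm (\<eta> x * (a x \<bullet> b x)) \<le> norm (K * ((norm (a x))\<^sup>2 + (norm (b x))\<^sup>2))"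
      using young[of 1] \<eta> K by (intro AE_I2) (auto simp: abs_mult intro!: mult_mono)
  qed (use a b in auto)
  define S where "S = (\<integral>x. (norm (a x))\<^sup>2 + (norm (b x))\<^sup>2 \<partial>M)"
  have S: "S \<ge> 0" by (simp add: S_def)
  show "(\<lambda>n. \<integral>x. \<eta> x * (A n x \<bullet> B n x) \<partial>M) \<longlonglongrightarrow> (\<integral>x. \<eta> x * (a x \<bullet> b x) \<partial>M)"
  proof (rule tendstoI)
    fix e :: real assume e: "e > 0"
    define t where "t = e / (2 * (K * S + 1))"
    have KS: "K * S + 1 > 0" using K S by (simp add: add_nonneg_pos)
    have t: "t > 0" using e KS by (simp add: t_def)
    define D where "D n x = (1 + 1 / t) * ((norm (A n x - a x))\<^sup>2 + (norm (B n x - b x))\<^sup>2) + t * ((norm (a x))\<^sup>2 + (norm (b x))\<^sup>2)" for n x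
    have ptw: "\<bar>A n x \<bullet> B n x - a x \<bullet> b x\<bar> \<le> D n x" for n x
    proof -
      have "A n x \<bullet> B n x - a x \<bullet> b x = (A n x - a x) \<bullet> (B n x - b x) + (A n x - a x) \<bullet> b x + (B n x - b x) \<bullet> a x"
        by (simp add: inner_diff_left inner_diff_right inner_commute)
      also have "\<bar>\<dots>\<bar> \<le> \<bar>(A n x - a x) \<bullet> (B n x - b x)\<bar> + \<bar>(A n x - a x) \<bullet> b x\<bar> + \<bar>(B n x - b x) \<bullet> a x\<bar>"
        by linarith
      also have "\<dots> \<le> D n x"
        using young[of 1 "A n x - a x" "B n x - b x"] young[OF t, of "A n x - a x" "b x"] young[OF t, of "B n x - b x" "a x"]
        by (simp add: D_def algebra_simps add_divide_distrib)
      finally show ?thesis .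
    qed
    define I where "I n = (\<integral>x. (norm (A n x - a x))\<^sup>2 \<partial>M) + (\<integral>x. (norm (B n x - b x))\<^sup>2 \<partial>M)" for n
    have "(\<lambda>n. K * ((1 + 1 / t) * I n)) \<longlonglongrightarrow> K * ((1 + 1 / t) * (0 + 0))"
      unfolding I_def by (intro tendsto_intros A B)
    then have "\<forall>\<^sub>F n in sequentially. K * ((1 + 1 / t) * I n) < e / 2"
      using e by (intro order_tendstoD(2)) auto
    then show "\<forall>\<^sub>F n in sequentially. dist (\<integral>x. \<eta> x * (A n x \<bullet> B n x) \<partial>M) (\<integral>x. \<eta> x * (a x \<bullet> b x) \<partial>M) < e"
      using A(1) B(1)
    proof eventually_elim
      case (elim n)
      have iD: "integrable M (D n)"
        unfolding D_def using elim a b by auto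
      have bd: "\<bar>\<eta> x * (A n x \<bullet> B n x) - \<eta> x * (a x \<bullet> b x)\<bar> \<le> K * D n x" for x
        using mult_mono[OF \<eta>[of x] ptw[of n x] K] by (simp add: abs_mult flip: right_diff_distrib)
      have idiff: "integrable M (\<lambda>x. \<eta> x * (A n x \<bullet> B n x) - \<eta> x * (a x \<bullet> b x))"
        by (rule Bochner_Integration.integrable_bound[where f="\<lambda>x. K * D n x"])
          (use iD bd in \<open>auto intro: order_trans[OF bd abs_ge_self]\<close>)
      have iAB: "integrable M (\<lambda>x. \<eta> x * (A n x \<bullet> B n x))"
        using Bochner_Integration.integrable_add[OF idiff iab] by simp
      have "dist (\<integral>x. \<eta> x * (A n x \<bullet> B n x) \<partial>M) (\<integral>x. \<eta> x * (a x \<bullet> b x) \<partial>M)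
          = norm (\<integral>x. \<eta> x * (A n x \<bullet> B n x) - \<eta> x * (a x \<bullet> b x) \<partial>M)"
        using iab iAB by (simp add: dist_norm)
      also have "\<dots> \<le> (\<integral>x. K * D n x \<partial>M)"
        by (rule norm_integral_le) (use iD bd in auto)
      also have "\<dots> = K * ((1 + 1 / t) * I n) + t * (K * S)"
        unfolding D_def I_def S_def using elim a b by (simp add: algebra_simps)
      also have "t * (K * S) < e / 2"
        using e KS by (simp add: t_def field_simps)
      finally show ?case using elim(1) by linarith
    qed
  qed
qed

lemma integrable_test_function_mult:
  fixes \<phi> f :: "'a::euclidean_space \<Rightarrow> real"
  assumes \<phi>: "\<phi> \<in> test_functions \<Omega>" and f: "continuous_on UNIV f"
  shows "integrable lborel (\<lambda>x. \<phi> x * f x)"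
proof -
  obtain R where R: "\<And>x. \<phi> x \<noteq> 0 \<Longrightarrow> norm x < R"
    using test_functions_support_bounded[OF \<phi>] by blast
  show ?thesis
  proof (rule integrable_continuous_bounded_support)
    show "continuous_on UNIV (\<lambda>x. \<phi> x * f x)"
      by (intro continuous_intros f test_functions_continuous[OF \<phi>])
    show "\<phi> x * f x \<noteq> 0 \<Longrightarrow> norm x \<le> R" for x
      using R[of x] by auto
  qed
qed

lemma integral_by_parts_test_function:
  fixes \<phi> f :: "'a::euclidean_space \<Rightarrow> real"
  assumes \<phi>: "\<phi> \<in> test_functions \<Omega>" and b: "b \<in> Basis"
    and f: "\<And>x. (f has_derivative f' x) (at x)" "continuous_on UNIV (\<lambda>x. f' x b)"
  shows "(\<integral>x. \<phi> x * f' x b \<partial>lborel) = - (\<integral>x. pd b \<phi> x * f x \<partial>lborel)"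
proof -
  have fc: "continuous_on UNIV f"
    using f(1) by (intro has_derivative_continuous_on) (auto intro: has_derivative_at_withinI)
  obtain R where R: "\<And>x. \<phi> x \<noteq> 0 \<Longrightarrow> norm x < R"
    using test_functions_support_bounded[OF \<phi>] by blast
  note pb = test_functions_pd[OF \<phi> b]
  have "(\<integral>x. (\<phi> x * f' x b + frechet_derivative \<phi> (at x) b * f x) \<partial>lborel) = 0"
  proof (rule integral_derivative_eq_0(1)[where f="\<lambda>x. \<phi> x * f x"
        and f'="\<lambda>x h. \<phi> x * f' x h + frechet_derivative \<phi> (at x) h * f x" and R=R])
    show "((\<lambda>x. \<phi> x * f x) has_derivative (\<lambda>h. \<phi> x * f' x h + frechet_derivative \<phi> (at x) h * f x)) (at x)" for x
      by (intro has_derivative_mult test_functions_has_derivative[OF \<phi>] f(1))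
    show "continuous_on UNIV (\<lambda>x. \<phi> x * f' x b + frechet_derivative \<phi> (at x) b * f x)"
      by (intro continuous_intros f(2) fc test_functions_continuous[OF \<phi>] test_functions_continuous[OF pb])
    show "\<phi> x * f x \<noteq> 0 \<Longrightarrow> norm x \<le> R" for x
      using R[of x] by auto
  qed
  moreover have "integrable lborel (\<lambda>x. \<phi> x * f' x b)" "integrable lborel (\<lambda>x. pd b \<phi> x * f x)"
    by (rule integrable_test_function_mult[OF \<phi> f(2)], rule integrable_test_function_mult[OF pb fc])
  ultimately show ?thesis by simp
qed

text \<open>The divergence of the stress-energy tensor of a smooth map, tested against \<open>\<phi>\<close>.\<close>

lemma conv_stress_identity:
  fixes \<rho> \<phi> :: "'a::euclidean_space \<Rightarrow> real" and w :: "'a \<Rightarrow> 'b::euclidean_space"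
  assumes \<rho>: "\<rho> \<in> test_functions UNIV" and w: "integrable lborel w"
    and \<phi>: "\<phi> \<in> test_functions \<Omega>" and j: "j \<in> Basis"
  shows "(\<integral>x. \<phi> x * ((\<Sum>i\<in>Basis. conv (pd i (pd i \<rho>)) w x) \<bullet> conv (pd j \<rho>) w x) \<partial>lborel) =
    (\<Sum>i\<in>Basis. (\<integral>x. pd j \<phi> x * (conv (pd i \<rho>) w x \<bullet> conv (pd i \<rho>) w x) \<partial>lborel)) / 2
    - (\<Sum>i\<in>Basis. (\<integral>x. pd i \<phi> x * (conv (pd i \<rho>) w x \<bullet> conv (pd j \<rho>) w x) \<partial>lborel))"
proof -
  define d where "d i = conv (pd i \<rho>) w" for i
  define dd where "dd i k = conv (pd i (pd k \<rho>)) w" for i k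
  have td: "pd i \<rho> \<in> test_functions UNIV" if "i \<in> Basis" for i
    by (rule test_functions_pd[OF \<rho> that])
  have tdd: "pd i (pd k \<rho>) \<in> test_functions UNIV" if "i \<in> Basis" "k \<in> Basis" for i k
    by (rule test_functions_pd[OF td[OF that(2)] that(1)])
  have hd: "(d k has_derivative (\<lambda>h. dd h k x)) (at x)" if "k \<in> Basis" for k x
    unfolding d_def dd_def by (rule conv_has_derivative[OF td[OF that] w])
  have cd: "continuous_on UNIV (d k)" if "k \<in> Basis" for k
    unfolding d_def by (rule conv_continuous[OF td[OF that] w])
  have cdd: "continuous_on UNIV (dd i k)" if "i \<in> Basis" "k \<in> Basis" for i k
    unfolding dd_def by (rule conv_continuous[OF tdd[OF that] w])
  have sym: "dd i k = dd k i" if "i \<in> Basis" "k \<in> Basis" for i k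
  proof -
    have "pd i (pd k \<rho>) = pd k (pd i \<rho>)" using pd_commute[OF \<rho> that] by blast
    then show ?thesis unfolding dd_def by (rule arg_cong)
  qed
  have inn: "((\<lambda>x. d i x \<bullet> d k x) has_derivative (\<lambda>h. d i x \<bullet> dd h k x + dd h i x \<bullet> d k x)) (at x)"
    if "i \<in> Basis" "k \<in> Basis" for i k x
    by (intro has_derivative_inner hd that)
  have 1: "(\<integral>x. \<phi> x * (dd i i x \<bullet> d j x) \<partial>lborel) =
      - (\<integral>x. \<phi> x * (d i x \<bullet> dd i j x) \<partial>lborel) - (\<integral>x. pd i \<phi> x * (d i x \<bullet> d j x) \<partial>lborel)"
    if i: "i \<in> Basis" for i
  proof -
    have "(\<integral>x. \<phi> x * (d i x \<bullet> dd i j x + dd i i x \<bullet> d j x) \<partial>lborel) = - (\<integral>x. pd i \<phi> x * (d i x \<bullet> d j x) \<partial>lborel)"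
      by (rule integral_by_parts_test_function[OF \<phi> i inn[OF i j]])
        (intro continuous_intros cd cdd i j)
    moreover have "integrable lborel (\<lambda>x. \<phi> x * (d i x \<bullet> dd i j x))" "integrable lborel (\<lambda>x. \<phi> x * (dd i i x \<bullet> d j x))"
      by (intro integrable_test_function_mult[OF \<phi>] continuous_intros cd cdd i j)+
    ultimately show ?thesis by (simp add: distrib_left)
  qed
  have 2: "(\<integral>x. \<phi> x * (d i x \<bullet> dd i j x) \<partial>lborel) = - (\<integral>x. pd j \<phi> x * (d i x \<bullet> d i x) \<partial>lborel) / 2"
    if i: "i \<in> Basis" for i
  proof -
    have "(\<integral>x. \<phi> x * (d i x \<bullet> dd j i x + dd j i x \<bullet> d i x) \<partial>lborel) = - (\<integral>x. pd j \<phi> x * (d i x \<bullet> d i x) \<partial>lborel)"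
      by (rule integral_by_parts_test_function[OF \<phi> j inn[OF i i]])
        (intro continuous_intros cd cdd i j)
    also have "(\<lambda>x. \<phi> x * (d i x \<bullet> dd j i x + dd j i x \<bullet> d i x)) = (\<lambda>x. 2 * (\<phi> x * (d i x \<bullet> dd i j x)))"
      unfolding sym[OF i j] by (simp add: inner_commute mult.left_commute)
    finally show ?thesis by simp
  qed
  have "(\<integral>x. \<phi> x * ((\<Sum>i\<in>Basis. dd i i x) \<bullet> d j x) \<partial>lborel) = (\<Sum>i\<in>Basis. \<integral>x. \<phi> x * (dd i i x \<bullet> d j x) \<partial>lborel)"
    unfolding inner_sum_left sum_distrib_left
    by (intro Bochner_Integration.integral_sum integrable_test_function_mult[OF \<phi>] continuous_intros cd cdd j)
  also have "\<dots> = (\<Sum>i\<in>Basis. (\<integral>x. pd j \<phi> x * (d i x \<bullet> d i x) \<partial>lborel) / 2 - (\<integral>x. pd i \<phi> x * (d i x \<bullet> d j x) \<partial>lborel))"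
    by (intro sum.cong refl) (simp add: 1 2)
  finally show ?thesis
    by (simp add: d_def dd_def sum_subtractf sum_divide_distrib)
qed

text \<open>A smooth convex substitute for the norm, with gradient bounded by one.\<close>

definition smooth_norm :: "'b::real_inner \<Rightarrow> real" where
  "smooth_norm y = sqrt (1 + (norm y)\<^sup>2)"

lemma smooth_norm_ge: "1 \<le> smooth_norm y" "norm y \<le> smooth_norm y" "0 < smooth_norm y"
proof -
  show "1 \<le> smooth_norm y" unfolding smooth_norm_def by simp
  then show "0 < smooth_norm y" by linarith
  show "norm y \<le> smooth_norm y" unfolding smooth_norm_def by (rule real_le_rsqrt) simp
qed

lemma smooth_norm_power2: "(smooth_norm y)\<^sup>2 = 1 + (norm y)\<^sup>2"
  unfolding smooth_norm_def by (simp add: add_nonneg_nonneg)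

lemma smooth_norm_continuous [continuous_intros]:
  "continuous_on S f \<Longrightarrow> continuous_on S (\<lambda>x. smooth_norm (f x))"
  unfolding smooth_norm_def by (intro continuous_intros)

lemma smooth_norm_measurable [measurable]: "(smooth_norm :: 'b::euclidean_space \<Rightarrow> real) \<in> borel_measurable borel"
  by (intro borel_measurable_continuous_onI continuous_intros)

lemma smooth_norm_le: "smooth_norm y \<le> 1 + norm y"
  unfolding smooth_norm_def by (rule real_le_lsqrt) (auto simp: power2_eq_square algebra_simps)

lemma smooth_norm_lipschitz: "\<bar>smooth_norm a - smooth_norm b\<bar> \<le> norm (a - b)"
proof -
  have "(smooth_norm a - smooth_norm b) * (smooth_norm a + smooth_norm b) = (norm a - norm b) * (norm a + norm b)"
    using smooth_norm_power2[of a] smooth_norm_power2[of b] by (simp add: power2_eq_square algebra_simps)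
  then have "\<bar>smooth_norm a - smooth_norm b\<bar> * (smooth_norm a + smooth_norm b) = \<bar>norm a - norm b\<bar> * (norm a + norm b)"
    using smooth_norm_ge(3)[of a] smooth_norm_ge(3)[of b]
    by (metis abs_mult abs_of_nonneg add_nonneg_nonneg less_imp_le norm_ge_zero)
  also have "\<dots> \<le> \<bar>norm a - norm b\<bar> * (smooth_norm a + smooth_norm b)"
    using smooth_norm_ge(2)[of a] smooth_norm_ge(2)[of b] by (intro mult_left_mono) auto
  finally have "\<bar>smooth_norm a - smooth_norm b\<bar> \<le> \<bar>norm a - norm b\<bar>"
    using smooth_norm_ge(3)[of a] smooth_norm_ge(3)[of b] by (auto simp: mult_le_cancel_right)
  then show ?thesis using norm_triangle_ineq3[of a b] by linarith
qed

lemma smooth_norm_has_derivative: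
  fixes v :: "'a::real_normed_vector \<Rightarrow> 'b::real_inner"
  assumes "(v has_derivative v') (at x)"
  shows "((\<lambda>x. smooth_norm (v x)) has_derivative (\<lambda>h. (v x \<bullet> v' h) / smooth_norm (v x))) (at x)"
proof -
  have "((\<lambda>x. 1 + v x \<bullet> v x) has_derivative (\<lambda>h. 2 * (v x \<bullet> v' h))) (at x)"
    using has_derivative_add[OF has_derivative_const has_derivative_inner[OF assms assms]]
    by (simp add: inner_commute)
  moreover have "0 < 1 + v x \<bullet> v x" by (simp add: add_pos_nonneg)
  ultimately have "((\<lambda>x. sqrt (1 + v x \<bullet> v x)) has_derivative (\<lambda>h. (2 * (v x \<bullet> v' h)) * (inverse (sqrt (1 + v x \<bullet> v x)) / 2))) (at x)"
    by (intro has_derivative_real_sqrt) auto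
  then show ?thesis
    by (simp add: smooth_norm_def power2_norm_eq_inner field_simps)
qed

lemma conv_smooth_norm_inequality:
  fixes \<rho> \<psi> :: "'a::euclidean_space \<Rightarrow> real" and w :: "'a \<Rightarrow> 'b::euclidean_space"
  assumes \<rho>: "\<rho> \<in> test_functions UNIV" and w: "integrable lborel w"
    and \<psi>: "\<psi> \<in> test_functions \<Omega>" "\<And>x. 0 \<le> \<psi> x"
  shows "(\<integral>x. \<psi> x * ((conv \<rho> w x \<bullet> (\<Sum>i\<in>Basis. conv (pd i (pd i \<rho>)) w x)) / smooth_norm (conv \<rho> w x)) \<partial>lborel)
    \<le> (\<integral>x. (\<Sum>i\<in>Basis. pd i (pd i \<psi>) x) * smooth_norm (conv \<rho> w x) \<partial>lborel)"
proof -
  define v where "v = conv \<rho> w"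
  define g where "g x = smooth_norm (v x)" for x
  define d where "d i = conv (pd i \<rho>) w" for i
  define dd where "dd i k = conv (pd i (pd k \<rho>)) w" for i k
  have td: "pd i \<rho> \<in> test_functions UNIV" if "i \<in> Basis" for i
    by (rule test_functions_pd[OF \<rho> that])
  have tdd: "pd i (pd k \<rho>) \<in> test_functions UNIV" if "i \<in> Basis" "k \<in> Basis" for i k
    by (rule test_functions_pd[OF td[OF that(2)] that(1)])
  have hv: "(v has_derivative (\<lambda>h. d h x)) (at x)" for x
    unfolding d_def v_def by (rule conv_has_derivative[OF \<rho> w])
  have hd: "(d k has_derivative (\<lambda>h. dd h k x)) (at x)" if "k \<in> Basis" for k x
    unfolding d_def dd_def by (rule conv_has_derivative[OF td[OF that] w])
  have cv: "continuous_on UNIV v"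
    unfolding v_def by (rule conv_continuous[OF \<rho> w])
  have cg: "continuous_on UNIV g"
    unfolding g_def[abs_def] by (intro continuous_intros cv)
  have cd: "continuous_on UNIV (d k)" if "k \<in> Basis" for k
    unfolding d_def by (rule conv_continuous[OF td[OF that] w])
  have cdd: "continuous_on UNIV (dd i k)" if "i \<in> Basis" "k \<in> Basis" for i k
    unfolding dd_def by (rule conv_continuous[OF tdd[OF that] w])
  have g0: "g x > 0" "g x \<noteq> 0" for x using smooth_norm_ge(3)[of "v x"] by (auto simp: g_def)
  define f where "f i x = (v x \<bullet> d i x) / g x" for i x
  define f' where "f' i h x = (v x \<bullet> dd h i x + d h x \<bullet> d i x) / g x - (v x \<bullet> d i x) * (v x \<bullet> d h x) / (g x) ^ 3" for i h x
  have hg: "(g has_derivative (\<lambda>h. f h x)) (at x)" for x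
    unfolding g_def[abs_def] f_def by (rule smooth_norm_has_derivative[OF hv])
  have hf: "(f i has_derivative (\<lambda>h. f' i h x)) (at x)" if i: "i \<in> Basis" for i x
  proof -
    have "((\<lambda>x. (v x \<bullet> d i x) / g x) has_derivative
       (\<lambda>h. - (v x \<bullet> d i x) * (inverse (g x) * f h x * inverse (g x)) + (v x \<bullet> dd h i x + d h x \<bullet> d i x) / g x)) (at x)"
      by (intro has_derivative_divide has_derivative_inner hv hd[OF i] hg g0(2))
    moreover have "- (v x \<bullet> d i x) * (inverse (g x) * f h x * inverse (g x)) + (v x \<bullet> dd h i x + d h x \<bullet> d i x) / g x = f' i h x" for h
      using g0[of x] by (simp add: f'_def f_def divide_inverse power3_eq_cube)
    ultimately show ?thesis unfolding f_def[abs_def] by simp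
  qed
  have cf: "continuous_on UNIV (f i)" if "i \<in> Basis" for i
    unfolding f_def[abs_def] using g0(2) by (intro continuous_intros cv cd cg that) auto
  have cf': "continuous_on UNIV (f' i i)" if "i \<in> Basis" for i
    unfolding f'_def[abs_def] using g0(2) by (intro continuous_intros cv cd cdd cg that) auto
  have lower: "(v x \<bullet> dd i i x) / g x \<le> f' i i x" for i x
  proof -
    have "(v x \<bullet> d i x)\<^sup>2 \<le> (norm (v x) * norm (d i x))\<^sup>2"
      using Cauchy_Schwarz_ineq2[of "v x" "d i x"] by (metis abs_ge_zero power2_abs power_mono)
    also have "\<dots> \<le> (g x * norm (d i x))\<^sup>2"
      using smooth_norm_ge(2)[of "v x"] by (intro power_mono mult_right_mono) (auto simp: g_def)
    finally have "(v x \<bullet> d i x) * (v x \<bullet> d i x) \<le> (g x)\<^sup>2 * (d i x \<bullet> d i x)"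
      by (simp add: power2_eq_square power2_norm_eq_inner[symmetric] mult_ac)
    then have "(v x \<bullet> d i x) * (v x \<bullet> d i x) / (g x) ^ 3 \<le> (g x)\<^sup>2 * (d i x \<bullet> d i x) / (g x) ^ 3"
      using g0 by (intro divide_right_mono) (auto simp: less_imp_le)
    also have "\<dots> = (d i x \<bullet> d i x) / g x"
      using g0(2)[of x] by (simp add: power2_eq_square power3_eq_cube)
    finally show ?thesis by (simp add: f'_def add_divide_distrib)
  qed
  have parts: "(\<integral>x. pd i (pd i \<psi>) x * g x \<partial>lborel) = (\<integral>x. \<psi> x * f' i i x \<partial>lborel)" if i: "i \<in> Basis" for i
    using integral_by_parts_test_function[OF test_functions_pd[OF \<psi>(1) i] i hg cf[OF i]]
      integral_by_parts_test_function[OF \<psi>(1) i hf[OF i] cf'[OF i]] by simp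
  have "(\<integral>x. (\<Sum>i\<in>Basis. pd i (pd i \<psi>) x) * g x \<partial>lborel) = (\<Sum>i\<in>Basis. \<integral>x. pd i (pd i \<psi>) x * g x \<partial>lborel)"
    unfolding sum_distrib_right
    by (intro Bochner_Integration.integral_sum integrable_test_function_mult[OF test_functions_pd[OF test_functions_pd[OF \<psi>(1)]]] cg)
  also have "\<dots> = (\<Sum>i\<in>Basis. \<integral>x. \<psi> x * f' i i x \<partial>lborel)"
    by (intro sum.cong refl parts)
  also have "\<dots> \<ge> (\<Sum>i\<in>Basis. \<integral>x. \<psi> x * ((v x \<bullet> dd i i x) / g x) \<partial>lborel)"
    using g0(2) by (intro sum_mono integral_mono integrable_test_function_mult[OF \<psi>(1)] mult_left_mono lower \<psi>(2) cf'
      continuous_intros cv cdd cg) auto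
  also have "(\<Sum>i\<in>Basis. \<integral>x. \<psi> x * ((v x \<bullet> dd i i x) / g x) \<partial>lborel)
      = (\<integral>x. (\<Sum>i\<in>Basis. \<psi> x * ((v x \<bullet> dd i i x) / g x)) \<partial>lborel)"
    using g0(2) by (intro Bochner_Integration.integral_sum[symmetric] integrable_test_function_mult[OF \<psi>(1)]
      continuous_intros cv cdd cg) auto
  finally show ?thesis
    by (simp add: v_def g_def dd_def inner_sum_right sum_distrib_left sum_divide_distrib)
qed

section \<open>Local boundedness\<close>

lemma integral_lborel_affine:
  fixes f :: "'a::euclidean_space \<Rightarrow> real"
  assumes f: "integrable lborel f" and c: "c > 0"
  shows "integrable lborel (\<lambda>y. f (x + c *\<^sub>R y))"
    "(\<integral>y. f (x + c *\<^sub>R y) \<partial>lborel) = integral\<^sup>L lborel f / c ^ DIM('a)"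
proof -
  have [measurable]: "f \<in> borel_measurable borel" using f by auto
  define D where "D = distr lborel borel (\<lambda>y::'a. x + c *\<^sub>R y)"
  have eq: "lborel = density D (\<lambda>_. ennreal (\<bar>c\<bar> ^ DIM('a)))"
    unfolding D_def using lborel_affine[of c x] c by simp
  have cp: "\<bar>c\<bar> ^ DIM('a) > 0" using c by simp
  have fD: "f \<in> borel_measurable D" unfolding D_def by measurable
  have "integrable (density D (\<lambda>_. ennreal (\<bar>c\<bar> ^ DIM('a)))) f" using f eq by simp
  then have iD: "integrable D (\<lambda>y. \<bar>c\<bar> ^ DIM('a) *\<^sub>R f y)"
    using fD cp by (subst (asm) integrable_density) auto
  then have "integrable D f" using cp by simp
  then show "integrable lborel (\<lambda>y. f (x + c *\<^sub>R y))"
    unfolding D_def by (subst (asm) integrable_distr_eq) auto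
  have "integral\<^sup>L lborel f = integral\<^sup>L (density D (\<lambda>_. ennreal (\<bar>c\<bar> ^ DIM('a)))) f"
    using eq by simp
  also have "\<dots> = (\<integral>y. \<bar>c\<bar> ^ DIM('a) *\<^sub>R f y \<partial>D)"
    using fD cp by (subst integral_density) auto
  also have "\<dots> = c ^ DIM('a) * integral\<^sup>L D f" using c by simp
  also have "integral\<^sup>L D f = (\<integral>y. f (x + c *\<^sub>R y) \<partial>lborel)"
    unfolding D_def by (subst integral_distr) auto
  finally show "(\<integral>y. f (x + c *\<^sub>R y) \<partial>lborel) = integral\<^sup>L lborel f / c ^ DIM('a)"
    using c by (simp add: field_simps)
qed

text \<open>The kernel \<open>bump\<close> and its potential \<open>bump_potential\<close>, with
  \<open>\<nabla> bump_potential y = - bump y *\<^sub>R y\<close>, turn the radial derivative of an average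
  into an average of the Laplacian.\<close>

definition bump :: "'a::euclidean_space \<Rightarrow> real" where
  "bump y = max 0 (1 - y \<bullet> y)"

definition bump_potential :: "'a::euclidean_space \<Rightarrow> real" where
  "bump_potential y = (max 0 (1 - y \<bullet> y))\<^sup>2 / 4"

lemma bump_properties:
  "0 \<le> bump y" "bump y \<le> 1" "bump y \<noteq> 0 \<Longrightarrow> norm y < 1" "continuous_on S bump"
  "0 \<le> bump_potential y" "bump_potential y \<noteq> 0 \<Longrightarrow> norm y < 1" "continuous_on S bump_potential"
proof -
  show "continuous_on S bump" "continuous_on S bump_potential"
    unfolding bump_def[abs_def] bump_potential_def[abs_def] by (intro continuous_intros; simp)+
  have "norm y < 1" if "1 - y \<bullet> y > 0"
    using that by (simp add: norm_eq_sqrt_inner)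
  then show "bump y \<noteq> 0 \<Longrightarrow> norm y < 1" "bump_potential y \<noteq> 0 \<Longrightarrow> norm y < 1"
    by (auto simp: bump_def bump_potential_def max_def split: if_splits)
qed (auto simp: bump_def bump_potential_def)

lemma positive_part_power2_has_derivative:
  "((\<lambda>t::real. (max 0 t)\<^sup>2) has_derivative (\<lambda>h. 2 * max 0 t * h)) (at t)"
  unfolding has_derivative_at_alt
proof (intro conjI allI impI)
  show "bounded_linear (\<lambda>h. 2 * max 0 t * h)" by (rule bounded_linear_mult_right)
  fix e :: real assume e: "e > 0"
  have key: "\<bar>(max 0 s)\<^sup>2 - (max 0 t)\<^sup>2 - 2 * max 0 t * (s - t)\<bar> \<le> (s - t)\<^sup>2" for s :: real
  proof -
    have "(max 0 s)\<^sup>2 - (max 0 t)\<^sup>2 - 2 * max 0 t * (s - t) = (max 0 s - max 0 t)\<^sup>2 + 2 * max 0 t * (max 0 s - s - (max 0 t - t))"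
      by (simp add: power2_eq_square algebra_simps)
    consider "s \<ge> 0" "t \<ge> 0" | "s \<ge> 0" "t < 0" | "s < 0" "t \<ge> 0" | "s < 0" "t < 0" by linarith
    then show ?thesis
    proof cases
      case 1
      then have "(max 0 s)\<^sup>2 - (max 0 t)\<^sup>2 - 2 * max 0 t * (s - t) = (s - t)\<^sup>2"
        by (simp add: power2_eq_square algebra_simps)
      then show ?thesis by simp
    next
      case 2
      then have "s\<^sup>2 \<le> (s - t)\<^sup>2" by (intro power_mono) auto
      then show ?thesis using 2 by simp
    next
      case 3
      define p q where "p = s * s" and "q = (s - t) * (s - t)"
      have "t * t + 2 * t * (s - t) = p - q" by (simp add: p_def q_def algebra_simps)
      moreover have "p \<le> q"
        using 3 mult_mono[of "- s" "t - s" "- s" "t - s"] by (simp add: p_def q_def algebra_simps)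
      moreover have "0 \<le> p" by (simp add: p_def)
      ultimately have "\<bar>t * t + 2 * t * (s - t)\<bar> \<le> q" by simp
      then show ?thesis using 3 by (simp add: power2_eq_square q_def)
    qed simp
  qed
  show "\<exists>d>0. \<forall>s. norm (s - t) < d \<longrightarrow> norm ((max 0 s)\<^sup>2 - (max 0 t)\<^sup>2 - 2 * max 0 t * (s - t)) \<le> e * norm (s - t)"
  proof (intro exI[of _ e] conjI allI impI e)
    fix s assume "norm (s - t) < e"
    then have "\<bar>s - t\<bar> * \<bar>s - t\<bar> \<le> e * \<bar>s - t\<bar>" by (intro mult_right_mono) auto
    then show "norm ((max 0 s)\<^sup>2 - (max 0 t)\<^sup>2 - 2 * max 0 t * (s - t)) \<le> e * norm (s - t)"
      using key[of s] by (simp add: power2_eq_square)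
  qed
qed

lemma bump_potential_has_derivative:
  "(bump_potential has_derivative (\<lambda>h. - (y \<bullet> h) * bump y)) (at y)"
proof -
  have "((\<lambda>y. 1 - y \<bullet> y) has_derivative (\<lambda>h. - (2 * (y \<bullet> h)))) (at y)"
    using has_derivative_diff[OF has_derivative_const has_derivative_inner[OF has_derivative_ident has_derivative_ident], of 1 y UNIV]
    by (simp add: inner_commute)
  from bounded_linear.has_derivative[OF bounded_linear_divide[of 4]
      has_derivative_compose[OF this positive_part_power2_has_derivative]]
  have "((\<lambda>y. (max 0 (1 - y \<bullet> y))\<^sup>2 / 4) has_derivative (\<lambda>h. (2 * max 0 (1 - y \<bullet> y) * (- (2 * (y \<bullet> h)))) / 4)) (at y)" .
  then show ?thesis
    by (simp add: bump_potential_def[abs_def] bump_def mult_ac)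
qed

lemma integral_bump_pos: "0 < integral\<^sup>L lborel (bump :: 'a::euclidean_space \<Rightarrow> real)"
proof -
  have "integral\<^sup>L lborel (bump :: 'a \<Rightarrow> real) \<ge> (\<integral>y. indicator (ball (0::'a) (1/2)) y * (3/4) \<partial>lborel)"
  proof (rule integral_mono)
    show "integrable lborel (bump :: 'a \<Rightarrow> real)"
      by (rule integrable_continuous_bounded_support[where R=1]) (use bump_properties in \<open>auto intro: less_imp_le\<close>)
    show "integrable lborel (\<lambda>y. indicator (ball (0::'a) (1/2)) y * (3/4) :: real)"
      by (intro integrable_mult_left integrable_real_indicator emeasure_bounded_finite) auto
    fix y :: 'a
    show "indicator (ball 0 (1/2)) y * (3/4) \<le> bump y"
    proof (cases "norm y < 1 / 2")
      case True
      then have "norm y * norm y \<le> 1/2 * (1/2)" by (intro mult_mono) auto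
      then have "y \<bullet> y \<le> 1/4" by (simp add: power2_norm_eq_inner[symmetric] power2_eq_square)
      then show ?thesis using True by (simp add: bump_def)
    qed (auto simp: bump_properties)
  qed
  moreover have "(\<integral>y. indicator (ball (0::'a) (1/2)) y * (3/4) \<partial>lborel) > (0::real)"
  proof -
    have "measure lborel (ball (0::'a) (1/2)) > 0"
      using content_ball_pos[of "1/2" "0::'a"] by simp
    then show ?thesis by simp
  qed
  ultimately show ?thesis by linarith
qed

lemma conv_subharmonic_bound:
  fixes \<rho> :: "'a::euclidean_space \<Rightarrow> real" and w :: "'a \<Rightarrow> real"
  assumes \<rho>: "\<rho> \<in> test_functions UNIV" and w: "integrable lborel w" and s: "s > 0"
    and L: "\<And>z. z \<in> ball x s \<Longrightarrow> - C \<le> (\<Sum>i\<in>Basis. conv (pd i (pd i \<rho>)) w z)"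
    and h: "integrable lborel (conv \<rho> w)"
  shows "conv \<rho> w x * integral\<^sup>L lborel (bump :: 'a \<Rightarrow> real) \<le>
    (\<integral>z. \<bar>conv \<rho> w z\<bar> \<partial>lborel) / s ^ DIM('a) + C * s\<^sup>2 / 2 * integral\<^sup>L lborel (bump_potential :: 'a \<Rightarrow> real)"
proof -
  define v where "v = conv \<rho> w"
  define d where "d i = conv (pd i \<rho>) w" for i
  define dd where "dd i k = conv (pd i (pd k \<rho>)) w" for i k
  define Q where "Q = integral\<^sup>L lborel (bump_potential :: 'a \<Rightarrow> real)"
  have td: "pd i \<rho> \<in> test_functions UNIV" if "i \<in> Basis" for i
    by (rule test_functions_pd[OF \<rho> that])
  have tdd: "pd i (pd k \<rho>) \<in> test_functions UNIV" if "i \<in> Basis" "k \<in> Basis" for i k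
    by (rule test_functions_pd[OF td[OF that(2)] that(1)])
  have hv: "(v has_derivative (\<lambda>h. d h z)) (at z)" for z
    unfolding d_def v_def by (rule conv_has_derivative[OF \<rho> w])
  have hd: "(d k has_derivative (\<lambda>h. dd h k z)) (at z)" if "k \<in> Basis" for k z
    unfolding d_def dd_def by (rule conv_has_derivative[OF td[OF that] w])
  have cv: "continuous_on UNIV v"
    unfolding v_def by (rule conv_continuous[OF \<rho> w])
  have cd: "continuous_on UNIV (d k)" if "k \<in> Basis" for k
    unfolding d_def by (rule conv_continuous[OF td[OF that] w])
  have cdd: "continuous_on UNIV (dd i k)" if "i \<in> Basis" "k \<in> Basis" for i k
    unfolding dd_def by (rule conv_continuous[OF tdd[OF that] w])
  have aff: "((\<lambda>y. x + t *\<^sub>R y) has_derivative (\<lambda>h. t *\<^sub>R h)) (at y)" for t and y :: 'a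
    by (auto intro!: derivative_eq_intros)
  define f where "f t y = v (x + t *\<^sub>R y) * bump y" for t y
  define fx where "fx t y = (\<Sum>i\<in>Basis. (y \<bullet> i) * d i (x + t *\<^sub>R y)) * bump y" for t y
  define S where "S = cbox (- One) (One :: 'a)"
  have outside: "bump y = 0" if "y \<notin> S" for y :: 'a
  proof (rule ccontr)
    assume "bump y \<noteq> 0"
    then have "norm y < 1" using bump_properties(3) by blast
    then have "\<bar>y \<bullet> i\<bar> \<le> 1" if "i \<in> Basis" for i
      using Basis_le_norm[OF that, of y] by simp
    then have "y \<in> S" by (force simp: S_def mem_box abs_le_iff)
    then show False using that by simp
  qed
  have cf: "continuous_on UNIV (f t)" for t
    unfolding f_def[abs_def]
    by (intro continuous_intros bump_properties continuous_on_compose2[OF cv]) auto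
  have cfx: "continuous_on UNIV (\<lambda>(t, y). fx t y)"
    unfolding fx_def split_beta
    by (intro continuous_intros bump_properties continuous_on_compose2[OF cd] continuous_on_compose2[OF bump_properties(4), of UNIV]) auto
  have cfx1: "continuous_on UNIV (fx t)" for t
  proof -
    have "continuous_on UNIV (\<lambda>y::'a. (t, y))"
      by (rule continuous_on_Pair[OF continuous_on_const continuous_on_id])
    from continuous_on_compose2[OF cfx this] show ?thesis by simp
  qed
  have toS: "integral S g = integral\<^sup>L lborel g" if g: "continuous_on UNIV g" "\<And>y. y \<notin> S \<Longrightarrow> g y = 0" for g :: "'a \<Rightarrow> real"
  proof -
    obtain R where R: "\<And>y. y \<in> S \<Longrightarrow> norm y \<le> R"
      using bounded_cbox unfolding S_def bounded_iff by blast
    have "integrable lborel g"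
      using g R by (intro integrable_continuous_bounded_support[where R=R]) blast+
    moreover have "integral S g = integral UNIV (\<lambda>y. if y \<in> S then g y else 0)"
      by (simp add: integral_restrict_UNIV)
    moreover have "(\<lambda>y. if y \<in> S then g y else 0) = g" using g(2) by auto
    ultimately show ?thesis by (simp add: integral_lborel)
  qed
  define m where "m t = integral S (f t)" for t
  have m_eq: "m t = (\<integral>y. f t y \<partial>lborel)" for t
    unfolding m_def by (rule toS[OF cf]) (simp add: f_def outside)
  have deriv: "(m has_field_derivative integral S (fx t)) (at t)" for t
    unfolding m_def S_def
  proof (rule leibniz_rule_field_derivative[where U=UNIV])
    fix t y
    have "((\<lambda>t. v (x + t *\<^sub>R y)) has_derivative (\<lambda>k. d (k *\<^sub>R y) (x + t *\<^sub>R y))) (at t)"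
      by (rule has_derivative_compose[OF _ hv, of "\<lambda>t. x + t *\<^sub>R y" "\<lambda>k. k *\<^sub>R y"]) (auto intro!: derivative_eq_intros)
    moreover have "d (k *\<^sub>R y) z = (\<Sum>i\<in>Basis. (y \<bullet> i) * d i z) * k" for k z
      unfolding d_def conv_linear_direction[OF \<rho> w, of "k *\<^sub>R y"]
      by (simp add: sum_distrib_left mult_ac)
    ultimately have "((\<lambda>t. v (x + t *\<^sub>R y)) has_field_derivative (\<Sum>i\<in>Basis. (y \<bullet> i) * d i (x + t *\<^sub>R y))) (at t)"
      by (simp add: has_field_derivative_def)
    then show "((\<lambda>t. f t y) has_field_derivative fx t y) (at t)"
      unfolding f_def fx_def by (rule DERIV_cmult_right)
  next
    show "f t integrable_on cbox (- One) One" for t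
      by (rule integrable_continuous) (rule continuous_on_subset[OF cf], simp)
    show "continuous_on (UNIV \<times> cbox (- One) One) (\<lambda>(t, y). fx t y)"
      by (rule continuous_on_subset[OF cfx]) simp
  qed auto
  have deriv_ge: "- (t * C * Q) \<le> integral S (fx t)" if t: "0 \<le> t" "t \<le> s" for t
  proof -
    define P where "P i y = dd i i (x + t *\<^sub>R y) * bump_potential y" for i y
    have cP: "continuous_on UNIV (P i)" if "i \<in> Basis" for i
      unfolding P_def[abs_def]
      by (intro continuous_intros bump_properties continuous_on_compose2[OF cdd[OF that that]]) auto
    have iP: "integrable lborel (P i)" if "i \<in> Basis" for i
      by (rule integrable_continuous_bounded_support[OF cP[OF that], where R=1])
        (use bump_properties(6) in \<open>force simp: P_def\<close>)
    have cD: "continuous_on UNIV (\<lambda>y. (y \<bullet> i) * d i (x + t *\<^sub>R y) * bump y)" if "i \<in> Basis" for i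
      by (intro continuous_intros bump_properties continuous_on_compose2[OF cd[OF that]]) auto
    have iD: "integrable lborel (\<lambda>y. (y \<bullet> i) * d i (x + t *\<^sub>R y) * bump y)" if "i \<in> Basis" for i
      by (rule integrable_continuous_bounded_support[OF cD[OF that], where R=1])
        (use bump_properties(3) in force)
    have step: "(\<integral>y. (y \<bullet> i) * d i (x + t *\<^sub>R y) * bump y \<partial>lborel) = t * integral\<^sup>L lborel (P i)" if i: "i \<in> Basis" for i
    proof -
      have "(\<integral>y. (d i (x + t *\<^sub>R y) * (- (y \<bullet> i) * bump y) + dd (t *\<^sub>R i) i (x + t *\<^sub>R y) * bump_potential y) \<partial>lborel) = 0"
      proof (rule integral_derivative_eq_0(1)[where R=1 and f="\<lambda>y. d i (x + t *\<^sub>R y) * bump_potential y"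
         and f'="\<lambda>y h. d i (x + t *\<^sub>R y) * (- (y \<bullet> h) * bump y) + dd (t *\<^sub>R h) i (x + t *\<^sub>R y) * bump_potential y"])
        show "((\<lambda>y. d i (x + t *\<^sub>R y) * bump_potential y) has_derivative
          (\<lambda>h. d i (x + t *\<^sub>R y) * (- (y \<bullet> h) * bump y) + dd (t *\<^sub>R h) i (x + t *\<^sub>R y) * bump_potential y)) (at y)" for y
          by (intro has_derivative_mult bump_potential_has_derivative has_derivative_compose[OF aff hd[OF i]])
        show "norm y \<le> 1" if "d i (x + t *\<^sub>R y) * bump_potential y \<noteq> 0" for y
          using that bump_properties(6)[of y] by auto
        have "dd (t *\<^sub>R i) i z = t * dd i i z" for z
          using linear_cmul[OF bounded_linear.linear[OF has_derivative_bounded_linear[OF hd[OF i, of z]]], of t i] by simp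
        then show "continuous_on UNIV (\<lambda>y. d i (x + t *\<^sub>R y) * (- (y \<bullet> i) * bump y) + dd (t *\<^sub>R i) i (x + t *\<^sub>R y) * bump_potential y)"
          by simp (intro continuous_intros bump_properties continuous_on_compose2[OF cd[OF i]] continuous_on_compose2[OF cdd[OF i i]]; simp)
      qed
      also have "(\<lambda>y. d i (x + t *\<^sub>R y) * (- (y \<bullet> i) * bump y) + dd (t *\<^sub>R i) i (x + t *\<^sub>R y) * bump_potential y) =
         (\<lambda>y. t * P i y - (y \<bullet> i) * d i (x + t *\<^sub>R y) * bump y)"
      proof -
        have "dd (t *\<^sub>R i) i z = t * dd i i z" for z
          using linear_cmul[OF bounded_linear.linear[OF has_derivative_bounded_linear[OF hd[OF i, of z]]], of t i] by simp
        then show ?thesis by (auto simp: P_def mult_ac)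
      qed
      finally show ?thesis using iP[OF i] iD[OF i] by simp
    qed
    have "integral S (fx t) = (\<integral>y. fx t y \<partial>lborel)"
      by (rule toS[OF cfx1]) (simp add: fx_def outside)
    also have "\<dots> = (\<Sum>i\<in>Basis. \<integral>y. (y \<bullet> i) * d i (x + t *\<^sub>R y) * bump y \<partial>lborel)"
      unfolding fx_def sum_distrib_right by (intro Bochner_Integration.integral_sum iD)
    also have "\<dots> = (\<Sum>i\<in>Basis. t * integral\<^sup>L lborel (P i))"
      by (intro sum.cong refl step)
    also have "\<dots> = t * (\<integral>y. (\<Sum>i\<in>Basis. P i y) \<partial>lborel)"
      by (simp add: sum_distrib_left Bochner_Integration.integral_sum iP)
    also have "\<dots> \<ge> t * (\<integral>y. - C * bump_potential (y::'a) \<partial>lborel)"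
    proof (rule mult_left_mono[OF integral_mono t(1)])
      show "integrable lborel (\<lambda>y. \<Sum>i\<in>Basis. P i y)" by (intro Bochner_Integration.integrable_sum iP)
      show "integrable lborel (\<lambda>y::'a. - C * bump_potential y)"
        by (rule integrable_continuous_bounded_support[where R=1])
          (use bump_properties in \<open>auto intro!: continuous_intros less_imp_le\<close>)
      fix y :: 'a
      show "- C * bump_potential y \<le> (\<Sum>i\<in>Basis. P i y)"
      proof (cases "bump_potential y = 0")
        case False
        then have "norm y < 1" by (rule bump_properties(6))
        then have "norm (t *\<^sub>R y) < s"
          using t s by (cases "t = 0") (auto simp: intro: le_less_trans[of _ "t * norm y" s] mult_le_less_imp_less[of t s "norm y" 1, simplified])
        then have "x + t *\<^sub>R y \<in> ball x s" by (simp add: dist_norm)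
        from L[OF this] have "- C * bump_potential y \<le> (\<Sum>i\<in>Basis. dd i i (x + t *\<^sub>R y)) * bump_potential y"
          unfolding dd_def by (intro mult_right_mono bump_properties)
        then show ?thesis by (simp add: P_def sum_distrib_right)
      qed (simp add: P_def)
    qed
    finally show ?thesis by (simp add: Q_def mult_ac)
  qed
  have "m 0 + C * Q * 0\<^sup>2 / 2 \<le> m s + C * Q * s\<^sup>2 / 2"
  proof (rule DERIV_nonneg_imp_nondecreasing[where f="\<lambda>t. m t + C * Q * t\<^sup>2 / 2"])
    show "0 \<le> s" using s by simp
    fix t assume t: "0 \<le> t" "t \<le> s"
    have "((\<lambda>t. m t + C * Q * t\<^sup>2 / 2) has_field_derivative integral S (fx t) + C * Q * t) (at t)"
      by (auto intro!: derivative_eq_intros deriv)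
    moreover have "0 \<le> integral S (fx t) + C * Q * t"
      using deriv_ge[OF t] by (simp add: mult_ac)
    ultimately show "\<exists>y. ((\<lambda>t. m t + C * Q * t\<^sup>2 / 2) has_real_derivative y) (at t) \<and> 0 \<le> y" by blast
  qed
  moreover have "m 0 = v x * integral\<^sup>L lborel (bump :: 'a \<Rightarrow> real)"
    unfolding m_eq by (simp add: f_def[abs_def])
  moreover have "m s \<le> (\<integral>z. \<bar>v z\<bar> \<partial>lborel) / s ^ DIM('a)"
  proof -
    have iv: "integrable lborel (\<lambda>z. \<bar>v z\<bar>)" using h by (simp add: v_def)
    have "norm (m s) \<le> (\<integral>y. \<bar>v (x + s *\<^sub>R y)\<bar> \<partial>lborel)"
      unfolding m_eq
    proof (rule norm_integral_le[OF integral_lborel_affine(1)[OF iv s]])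
      show "norm (f s y) \<le> \<bar>v (x + s *\<^sub>R y)\<bar>" for y
        using bump_properties(1,2)[of y] by (simp add: f_def abs_mult mult_left_le)
    qed
    also have "\<dots> = (\<integral>z. \<bar>v z\<bar> \<partial>lborel) / s ^ DIM('a)"
      by (rule integral_lborel_affine(2)[OF iv s])
    finally show ?thesis by simp
  qed
  ultimately show ?thesis
    by (simp add: v_def Q_def mult_ac)
qed

definition very_weak_laplacian :: "'a::euclidean_space set \<Rightarrow> ('a \<Rightarrow> 'b::euclidean_space) \<Rightarrow> ('a \<Rightarrow> 'b) \<Rightarrow> bool" where
  "very_weak_laplacian \<Omega> u f \<longleftrightarrow> (\<forall>\<phi>::'a \<Rightarrow> real. \<phi> \<in> test_functions \<Omega> \<longrightarrow>
     (\<integral>x. (\<Sum>i\<in>Basis. pd i (pd i \<phi>) x) *\<^sub>R u x \<partial>lborel) = (\<integral>x. \<phi> x *\<^sub>R f x \<partial>lborel))"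

lemma pd_support:
  assumes "\<And>z. \<rho> z \<noteq> 0 \<Longrightarrow> z \<in> S" "closed S" "pd i \<rho> z \<noteq> 0"
  shows "z \<in> S"
proof (rule ccontr)
  assume "z \<notin> S"
  moreover have "closure {x. \<rho> x \<noteq> 0} \<subseteq> S"
    using assms(1,2) by (intro closure_minimal) auto
  ultimately have "z \<notin> closure {x. \<rho> x \<noteq> 0}" by blast
  from frechet_derivative_eq_0_outside_support[OF this] show False using assms(3) by simp
qed

lemma pd_reflect:
  assumes "\<phi> \<in> test_functions UNIV"
  shows "pd i (\<lambda>y. \<phi> (x - y)) = (\<lambda>y. - pd i \<phi> (x - y))"
  using frechet_derivative_reflect[OF assms] by (intro ext) simp

lemma pd_pd_reflect:
  assumes "\<phi> \<in> test_functions UNIV" and i: "i \<in> Basis"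
  shows "pd i (pd i (\<lambda>y. \<phi> (x - y))) y = pd i (pd i \<phi>) (x - y)"
proof -
  have t: "pd i \<phi> \<in> test_functions UNIV" by (rule test_functions_pd[OF assms])
  obtain R where "\<And>z. pd i \<phi> z \<noteq> 0 \<Longrightarrow> norm z < R"
    using test_functions_support_bounded[OF t] by blast
  then have "(\<lambda>y. pd i \<phi> (x - y)) \<in> test_functions UNIV"
    by (intro test_functions_reflect[OF t, of "cball x R"]) (auto simp: dist_norm intro: less_imp_le)
  from frechet_derivative_bounded_linear[OF bounded_linear_minus[OF bounded_linear_ident] this]
  show "pd i (pd i (\<lambda>y. \<phi> (x - y))) y = pd i (pd i \<phi>) (x - y)"
    unfolding pd_reflect[OF assms(1)] frechet_derivative_reflect[OF t] by simp
qed

lemma conv_restrict: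
  assumes "\<And>z. \<eta> z \<noteq> 0 \<Longrightarrow> norm z \<le> r" "cball x r \<subseteq> K"
  shows "conv \<eta> (\<lambda>y. indicator K y *\<^sub>R u y) x = (\<integral>y. \<eta> (x - y) *\<^sub>R u y \<partial>lborel)"
  unfolding conv_def
proof (rule Bochner_Integration.integral_cong[OF refl])
  fix y
  show "\<eta> (x - y) *\<^sub>R indicator K y *\<^sub>R u y = \<eta> (x - y) *\<^sub>R u y"
  proof (cases "\<eta> (x - y) = 0")
    case False
    then have "y \<in> cball x r" using assms(1) by (simp add: dist_norm)
    then show ?thesis using assms(2) by auto
  qed simp
qed

lemma conv_laplacian:
  fixes \<rho> :: "'a::euclidean_space \<Rightarrow> real" and u f :: "'a \<Rightarrow> 'b::euclidean_space"
  assumes uf: "very_weak_laplacian \<Omega> u f" and K: "K \<subseteq> \<Omega>" "integrable lborel (\<lambda>y. indicator K y *\<^sub>R u y)"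
    and \<rho>: "\<rho> \<in> test_functions UNIV" "\<And>z. \<rho> z \<noteq> 0 \<Longrightarrow> norm z \<le> r" and x: "cball x r \<subseteq> K"
  shows "(\<Sum>i\<in>Basis. conv (pd i (pd i \<rho>)) (\<lambda>y. indicator K y *\<^sub>R u y) x) = conv \<rho> (\<lambda>y. indicator K y *\<^sub>R f y) x"
proof -
  have t: "(\<lambda>y. \<rho> (x - y)) \<in> test_functions \<Omega>"
  proof (rule test_functions_reflect[OF \<rho>(1), of "cball x r"])
    show "\<rho> (x - y) \<noteq> 0 \<Longrightarrow> y \<in> cball x r" for y using \<rho>(2)[of "x - y"] by (simp add: dist_norm)
  qed (use x K in auto)
  have tdd: "pd i (pd i \<rho>) \<in> test_functions UNIV" if "i \<in> Basis" for i
    by (rule test_functions_pd[OF test_functions_pd[OF \<rho>(1) that] that])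
  have s1: "norm z \<le> r" if "pd i \<rho> z \<noteq> 0" for i z
    using pd_support[where S="cball 0 r" and \<rho>=\<rho>, OF _ _ that] \<rho>(2) by simp
  have s2: "norm z \<le> r" if "pd i (pd i \<rho>) z \<noteq> 0" for i z
    using pd_support[where S="cball 0 r" and \<rho>="pd i \<rho>", OF _ _ that] s1 by simp
  have "(\<Sum>i\<in>Basis. conv (pd i (pd i \<rho>)) (\<lambda>y. indicator K y *\<^sub>R u y) x) =
     (\<integral>y. (\<Sum>i\<in>Basis. pd i (pd i \<rho>) (x - y) *\<^sub>R (indicator K y *\<^sub>R u y)) \<partial>lborel)"
    unfolding conv_def
    by (rule Bochner_Integration.integral_sum[symmetric]) (rule integrable_conv[OF tdd K(2)])
  also have "\<dots> = (\<integral>y. (\<Sum>i\<in>Basis. pd i (pd i (\<lambda>y. \<rho> (x - y))) y) *\<^sub>R u y \<partial>lborel)"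
  proof (rule Bochner_Integration.integral_cong[OF refl])
    fix y
    have eq: "pd i (pd i \<rho>) (x - y) *\<^sub>R (indicator K y *\<^sub>R u y) = pd i (pd i \<rho>) (x - y) *\<^sub>R u y" for i
    proof (cases "pd i (pd i \<rho>) (x - y) = 0")
      case False
      then have "y \<in> cball x r" using s2 by (simp add: dist_norm)
      then show ?thesis using x by auto
    qed simp
    show "(\<Sum>i\<in>Basis. pd i (pd i \<rho>) (x - y) *\<^sub>R (indicator K y *\<^sub>R u y)) = (\<Sum>i\<in>Basis. pd i (pd i (\<lambda>y. \<rho> (x - y))) y) *\<^sub>R u y"
      unfolding eq scaleR_sum_left by (intro sum.cong refl) (simp add: pd_pd_reflect[OF \<rho>(1)])
  qed
  also have "\<dots> = (\<integral>y. \<rho> (x - y) *\<^sub>R f y \<partial>lborel)"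
    using uf t unfolding very_weak_laplacian_def by blast
  also have "\<dots> = conv \<rho> (\<lambda>y. indicator K y *\<^sub>R f y) x"
    by (rule conv_restrict[OF \<rho>(2) x, symmetric])
  finally show ?thesis .
qed

lemma norm_divide_smooth_norm_le: "norm (y /\<^sub>R smooth_norm y) \<le> 1"
  using smooth_norm_ge(2,3)[of y] by (simp add: divide_simps)

lemma weak_smooth_norm_laplacian_ge:
  fixes u f :: "'a::euclidean_space \<Rightarrow> 'b::euclidean_space" and \<rho> :: "nat \<Rightarrow> 'a \<Rightarrow> real"
  assumes \<rho>: "mollifiers \<rho>" and uf: "very_weak_laplacian \<Omega> u f"
    and K: "K3 \<subseteq> \<Omega>" "compact K2" "K2 \<subseteq> K3" "d > 0" "\<And>x. x \<in> K2 \<Longrightarrow> cball x d \<subseteq> K3"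
    and u: "integrable lborel (\<lambda>y. indicator K3 y *\<^sub>R u y)" and f: "integrable lborel (\<lambda>y. indicator K3 y *\<^sub>R f y)"
    and C: "\<And>x. - C \<le> (u x \<bullet> f x) / smooth_norm (u x)"
    and \<psi>: "\<psi> \<in> test_functions UNIV" "\<And>x. 0 \<le> \<psi> x" "\<And>x. \<psi> x \<noteq> 0 \<Longrightarrow> x \<in> K2"
  shows "- C * integral\<^sup>L lborel \<psi> \<le> (\<integral>x. (\<Sum>i\<in>Basis. pd i (pd i \<psi>) x) * smooth_norm (u x) \<partial>lborel)"
proof -
  define w where "w y = indicator K3 y *\<^sub>R u y" for y
  define F where "F y = indicator K3 y *\<^sub>R f y" for y
  have w: "integrable lborel w" and F: "integrable lborel F" using u f by (auto simp: w_def[abs_def] F_def[abs_def])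
  have [measurable]: "w \<in> borel_measurable borel" "F \<in> borel_measurable borel" "\<psi> \<in> borel_measurable borel"
    using w F test_functions_measurable[OF \<psi>(1)] by auto
  obtain s where s: "strict_mono s" "AE x in lborel. (\<lambda>n. conv (\<rho> (s n)) w x) \<longlonglongrightarrow> w x"
    using mollifiers_AE_subseq[OF \<rho> w] by blast
  define \<eta> where "\<eta> n = \<rho> (s n)" for n
  have \<eta>: "mollifiers \<eta>" unfolding \<eta>_def[abs_def] by (rule mollifiers_subseq[OF \<rho> s(1)])
  define v where "v n = conv (\<eta> n) w" for n
  define Fn where "Fn n = conv (\<eta> n) F" for n
  have v_AE: "AE x in lborel. (\<lambda>n. v n x) \<longlonglongrightarrow> w x"
    using s(2) by (simp add: v_def \<eta>_def)
  have cv: "continuous_on UNIV (v n)" and cF: "continuous_on UNIV (Fn n)" for n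
    unfolding v_def Fn_def
    by (rule conv_continuous[OF mollifiers_test[OF \<eta>] w], rule conv_continuous[OF mollifiers_test[OF \<eta>] F])
  have [measurable]: "v n \<in> borel_measurable borel" "Fn n \<in> borel_measurable borel" for n
    by (rule borel_measurable_continuous_onI[OF cv], rule borel_measurable_continuous_onI[OF cF])
  define \<Delta> where "\<Delta> x = (\<Sum>i\<in>Basis. pd i (pd i \<psi>) x)" for x
  have tdd: "pd i (pd i \<psi>) \<in> test_functions UNIV" if "i \<in> Basis" for i
    by (rule test_functions_pd[OF test_functions_pd[OF \<psi>(1) that] that])
  have c\<Delta>: "continuous_on UNIV \<Delta>" unfolding \<Delta>_def[abs_def]
    by (intro continuous_on_sum test_functions_continuous[OF tdd])
  have \<Delta>K: "x \<in> K2" if x: "\<Delta> x \<noteq> 0" for x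
  proof -
    have cl: "closed K2" using K(2) by (rule compact_imp_closed)
    obtain i where i: "pd i (pd i \<psi>) x \<noteq> 0"
      using sum.not_neutral_contains_not_neutral[OF x[unfolded \<Delta>_def]] by blast
    have "pd i \<psi> z \<noteq> 0 \<Longrightarrow> z \<in> K2" for z by (rule pd_support[OF \<psi>(3) cl])
    from pd_support[OF this cl i] show ?thesis .
  qed
  obtain R where R: "\<And>x. x \<in> K2 \<Longrightarrow> norm x \<le> R"
    using compact_imp_bounded[OF K(2)] unfolding bounded_iff by blast
  obtain B where B: "B \<ge> 0" "\<And>x. norm (\<Delta> x) \<le> B"
    using continuous_bounded_support_bounded[OF c\<Delta>, of R] \<Delta>K R by blast
  obtain B' where B': "B' \<ge> 0" "\<And>x. norm (\<psi> x) \<le> B'"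
    using test_functions_bounded[OF \<psi>(1)] by blast
  have i\<psi>: "integrable lborel \<psi>" by (rule test_functions_integrable[OF \<psi>(1)])
  have i\<Delta>: "integrable lborel \<Delta>"
    unfolding \<Delta>_def[abs_def] by (intro Bochner_Integration.integrable_sum test_functions_integrable[OF tdd])
  have [measurable]: "\<Delta> \<in> borel_measurable borel" using i\<Delta> by auto

  have i\<Delta>v: "integrable lborel (\<lambda>x. \<Delta> x * smooth_norm (v n x))" for n
  proof (rule integrable_continuous_bounded_support)
    show "continuous_on UNIV (\<lambda>x. \<Delta> x * smooth_norm (v n x))" by (intro continuous_intros c\<Delta> cv)
    show "norm x \<le> R" if "\<Delta> x * smooth_norm (v n x) \<noteq> 0" for x
      by (rule R[OF \<Delta>K]) (use that in auto)
  qed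
  have i\<Delta>w: "integrable lborel (\<lambda>x. \<Delta> x * smooth_norm (w x))"
  proof (rule Bochner_Integration.integrable_bound[where f="\<lambda>x. \<bar>\<Delta> x\<bar> + B * norm (w x)"])
    show "AE x in lborel. norm (\<Delta> x * smooth_norm (w x)) \<le> norm (\<bar>\<Delta> x\<bar> + B * norm (w x))"
    proof (rule AE_I2)
      fix x
      have "\<bar>\<Delta> x\<bar> * smooth_norm (w x) \<le> \<bar>\<Delta> x\<bar> * (1 + norm (w x))"
        by (intro mult_left_mono smooth_norm_le) auto
      also have "\<dots> \<le> \<bar>\<Delta> x\<bar> + B * norm (w x)"
        using B(2)[of x] by (simp add: distrib_left mult_right_mono)
      finally show "norm (\<Delta> x * smooth_norm (w x)) \<le> norm (\<bar>\<Delta> x\<bar> + B * norm (w x))"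
        using smooth_norm_ge(3)[of "w x"] by (simp add: abs_mult)
    qed
  qed (use i\<Delta> w in auto)
  have lim1: "(\<lambda>n. \<integral>x. \<Delta> x * smooth_norm (v n x) \<partial>lborel) \<longlonglongrightarrow> (\<integral>x. \<Delta> x * smooth_norm (w x) \<partial>lborel)"
  proof (rule LIM_zero_cancel, rule Lim_null_comparison)
    show "(\<lambda>n. B * (\<integral>x. norm (v n x - w x) \<partial>lborel)) \<longlonglongrightarrow> 0"
      using tendsto_mult_right_zero[OF mollifiers_L1(2)[OF \<eta> w], of B] by (simp add: v_def)
    show "\<forall>\<^sub>F n in sequentially. norm ((\<integral>x. \<Delta> x * smooth_norm (v n x) \<partial>lborel) - (\<integral>x. \<Delta> x * smooth_norm (w x) \<partial>lborel))
        \<le> B * (\<integral>x. norm (v n x - w x) \<partial>lborel)"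
      using mollifiers_L1(1)[OF \<eta> w]
    proof eventually_elim
      case (elim n)
      have "norm ((\<integral>x. \<Delta> x * smooth_norm (v n x) \<partial>lborel) - (\<integral>x. \<Delta> x * smooth_norm (w x) \<partial>lborel))
          = norm (\<integral>x. \<Delta> x * (smooth_norm (v n x) - smooth_norm (w x)) \<partial>lborel)"
        using i\<Delta>v i\<Delta>w by (simp add: right_diff_distrib)
      also have "\<dots> \<le> (\<integral>x. B * norm (v n x - w x) \<partial>lborel)"
      proof (rule norm_integral_le)
        show "integrable lborel (\<lambda>x. B * norm (v n x - w x))" using elim by (simp add: v_def)
        show "norm (\<Delta> x * (smooth_norm (v n x) - smooth_norm (w x))) \<le> B * norm (v n x - w x)" for x
          using mult_mono[OF B(2)[of x] smooth_norm_lipschitz[of "v n x" "w x"] B(1)] by (simp add: abs_mult)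
      qed
      finally show ?case by simp
    qed
  qed

  define q where "q n x = v n x /\<^sub>R smooth_norm (v n x)" for n x
  define q0 where "q0 x = w x /\<^sub>R smooth_norm (w x)" for x
  have q1: "norm (q n x) \<le> 1" "norm (q0 x) \<le> 1" for n x
    unfolding q_def q0_def by (rule norm_divide_smooth_norm_le)+
  have [measurable]: "q n \<in> borel_measurable borel" "q0 \<in> borel_measurable borel" for n
    unfolding q_def[abs_def] q0_def[abs_def] by measurable
  have ib: "integrable lborel (\<lambda>x. \<psi> x * (p x \<bullet> H x))"
    if [measurable]: "p \<in> borel_measurable borel" and p: "\<And>x. norm (p x) \<le> b" and H: "integrable lborel H"
    for p H :: "'a \<Rightarrow> 'b" and b
  proof (rule Bochner_Integration.integrable_bound[where f="\<lambda>x. B' * (b * norm (H x))"])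
    have b: "b \<ge> 0" using p[of 0] norm_ge_zero order_trans by blast
    show "AE x in lborel. norm (\<psi> x * (p x \<bullet> H x)) \<le> norm (B' * (b * norm (H x)))"
    proof (rule AE_I2)
      fix x
      have "\<bar>p x \<bullet> H x\<bar> \<le> b * norm (H x)"
        using Cauchy_Schwarz_ineq2[of "p x" "H x"] mult_right_mono[OF p[of x], of "norm (H x)"] by simp
      then show "norm (\<psi> x * (p x \<bullet> H x)) \<le> norm (B' * (b * norm (H x)))"
        using mult_mono[OF B'(2)[of x] _ B'(1)] b B'(1) by (simp add: abs_mult)
    qed
    show "(\<lambda>x. \<psi> x * (p x \<bullet> H x)) \<in> borel_measurable lborel"
      using H by measurable
  qed (use H in auto)
  have lim2a: "(\<lambda>n. \<integral>x. \<psi> x * (q n x \<bullet> F x) \<partial>lborel) \<longlonglongrightarrow> (\<integral>x. \<psi> x * (q0 x \<bullet> F x) \<partial>lborel)"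
  proof (rule integral_dominated_convergence[where w="\<lambda>x. B' * norm (F x)"])
    show "AE x in lborel. (\<lambda>n. \<psi> x * (q n x \<bullet> F x)) \<longlonglongrightarrow> \<psi> x * (q0 x \<bullet> F x)"
      using v_AE
    proof (rule AE_mp, intro AE_I2 impI)
      fix x assume l: "(\<lambda>n. v n x) \<longlonglongrightarrow> w x"
      have "isCont smooth_norm (w x)"
        using smooth_norm_continuous[OF continuous_on_id, of "UNIV :: 'b set"]
        by (simp add: continuous_on_eq_continuous_at)
      from isCont_tendsto_compose[OF this l]
      have "(\<lambda>n. smooth_norm (v n x)) \<longlonglongrightarrow> smooth_norm (w x)" .
      then show "(\<lambda>n. \<psi> x * (q n x \<bullet> F x)) \<longlonglongrightarrow> \<psi> x * (q0 x \<bullet> F x)"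
        unfolding q_def q0_def using smooth_norm_ge(3)[of "w x"] by (intro tendsto_intros l) auto
    qed
    show "AE x in lborel. norm (\<psi> x * (q n x \<bullet> F x)) \<le> B' * norm (F x)" for n
    proof (rule AE_I2)
      fix x
      have "\<bar>q n x \<bullet> F x\<bar> \<le> norm (F x)"
        using Cauchy_Schwarz_ineq2[of "q n x" "F x"] mult_right_mono[OF q1(1)[of n x], of "norm (F x)"] by simp
      then show "norm (\<psi> x * (q n x \<bullet> F x)) \<le> B' * norm (F x)"
        using mult_mono[OF B'(2)[of x] _ B'(1)] by (simp add: abs_mult)
    qed
  qed (use F in auto)
  have lim2b: "(\<lambda>n. (\<integral>x. \<psi> x * (q n x \<bullet> Fn n x) \<partial>lborel) - (\<integral>x. \<psi> x * (q n x \<bullet> F x) \<partial>lborel)) \<longlonglongrightarrow> 0"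
  proof (rule Lim_null_comparison)
    show "(\<lambda>n. B' * (\<integral>x. norm (Fn n x - F x) \<partial>lborel)) \<longlonglongrightarrow> 0"
      using tendsto_mult_right_zero[OF mollifiers_L1(2)[OF \<eta> F], of B'] by (simp add: Fn_def)
    show "\<forall>\<^sub>F n in sequentially. norm ((\<integral>x. \<psi> x * (q n x \<bullet> Fn n x) \<partial>lborel) - (\<integral>x. \<psi> x * (q n x \<bullet> F x) \<partial>lborel))
        \<le> B' * (\<integral>x. norm (Fn n x - F x) \<partial>lborel)"
      using mollifiers_L1(1)[OF \<eta> F]
    proof eventually_elim
      case (elim n)
      have iFF: "integrable lborel (\<lambda>x. Fn n x - F x)"
        using elim integrable_norm_iff[of "\<lambda>x. Fn n x - F x" lborel] by (simp add: Fn_def[symmetric])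
      have iFn: "integrable lborel (Fn n)"
        using Bochner_Integration.integrable_add[OF iFF F] by simp
      have "norm ((\<integral>x. \<psi> x * (q n x \<bullet> Fn n x) \<partial>lborel) - (\<integral>x. \<psi> x * (q n x \<bullet> F x) \<partial>lborel))
          = norm (\<integral>x. \<psi> x * (q n x \<bullet> (Fn n x - F x)) \<partial>lborel)"
        using ib[where p="q n", OF _ q1(1) iFn] ib[where p="q n", OF _ q1(1) F] by (simp add: inner_diff_right right_diff_distrib)
      also have "\<dots> \<le> (\<integral>x. B' * norm (Fn n x - F x) \<partial>lborel)"
      proof (rule norm_integral_le)
        show "integrable lborel (\<lambda>x. B' * norm (Fn n x - F x))" using iFF by auto
        fix x
        have "\<bar>q n x \<bullet> (Fn n x - F x)\<bar> \<le> norm (Fn n x - F x)"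
          using Cauchy_Schwarz_ineq2[of "q n x" "Fn n x - F x"]
            mult_right_mono[OF q1(1)[of n x], of "norm (Fn n x - F x)"] by simp
        then show "norm (\<psi> x * (q n x \<bullet> (Fn n x - F x))) \<le> B' * norm (Fn n x - F x)"
          using mult_mono[OF B'(2)[of x] _ B'(1)] by (simp add: abs_mult)
      qed
      finally show ?case by simp
    qed
  qed
  have lim2: "(\<lambda>n. \<integral>x. \<psi> x * (q n x \<bullet> Fn n x) \<partial>lborel) \<longlonglongrightarrow> (\<integral>x. \<psi> x * (q0 x \<bullet> F x) \<partial>lborel)"
    using tendsto_add[OF lim2b lim2a] by simp
  have "(\<integral>x. \<psi> x * (q0 x \<bullet> F x) \<partial>lborel) \<le> (\<integral>x. \<Delta> x * smooth_norm (w x) \<partial>lborel)"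
  proof (rule tendsto_le[OF _ lim1 lim2])
    show "\<forall>\<^sub>F n in sequentially. (\<integral>x. \<psi> x * (q n x \<bullet> Fn n x) \<partial>lborel) \<le> (\<integral>x. \<Delta> x * smooth_norm (v n x) \<partial>lborel)"
      using mollifiers_eventually[OF \<eta> K(4)]
    proof eventually_elim
      case (elim n)
      note m = mollifierD[OF elim]
      have "(\<lambda>x. \<psi> x * (q n x \<bullet> Fn n x)) =
        (\<lambda>x. \<psi> x * ((conv (\<eta> n) w x \<bullet> (\<Sum>i\<in>Basis. conv (pd i (pd i (\<eta> n))) w x)) / smooth_norm (conv (\<eta> n) w x)))"
      proof
        fix x
        show "\<psi> x * (q n x \<bullet> Fn n x) = \<psi> x * ((conv (\<eta> n) w x \<bullet> (\<Sum>i\<in>Basis. conv (pd i (pd i (\<eta> n))) w x)) / smooth_norm (conv (\<eta> n) w x))"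
        proof (cases "\<psi> x = 0")
          case False
          then have "cball x d \<subseteq> K3" using \<psi>(3) K(5) by blast
          from conv_laplacian[OF uf K(1) u m(1) less_imp_le[OF m(3)] this]
          have "(\<Sum>i\<in>Basis. conv (pd i (pd i (\<eta> n))) w x) = Fn n x"
            by (simp add: w_def[abs_def] F_def[abs_def] Fn_def)
          then show ?thesis by (simp add: q_def v_def divide_inverse mult_ac)
        qed simp
      qed
      then show ?case
        using conv_smooth_norm_inequality[OF m(1) w \<psi>(1,2)] by (simp add: \<Delta>_def v_def)
    qed
  qed simp
  moreover have "(\<lambda>x. \<Delta> x * smooth_norm (w x)) = (\<lambda>x. \<Delta> x * smooth_norm (u x))"
  proof
    show "\<Delta> x * smooth_norm (w x) = \<Delta> x * smooth_norm (u x)" for x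
      using \<Delta>K[of x] K(3) by (cases "\<Delta> x = 0") (auto simp: w_def)
  qed
  moreover have "- C * integral\<^sup>L lborel \<psi> \<le> (\<integral>x. \<psi> x * (q0 x \<bullet> F x) \<partial>lborel)"
  proof -
    have "(\<integral>x. \<psi> x * (- C) \<partial>lborel) \<le> (\<integral>x. \<psi> x * (q0 x \<bullet> F x) \<partial>lborel)"
    proof (rule integral_mono)
      show "integrable lborel (\<lambda>x. \<psi> x * (q0 x \<bullet> F x))" by (rule ib[OF _ q1(2) F]) measurable
      fix x
      show "\<psi> x * (- C) \<le> \<psi> x * (q0 x \<bullet> F x)"
      proof (cases "\<psi> x = 0")
        case False
        then have "x \<in> K3" using \<psi>(3) K(3) by blast
        then have "q0 x \<bullet> F x = (u x \<bullet> f x) / smooth_norm (u x)"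
          by (simp add: q0_def F_def w_def divide_inverse mult_ac)
        then show ?thesis using C[of x] \<psi>(2)[of x] by (intro mult_left_mono) auto
      qed simp
    qed (use i\<psi> in auto)
    then show ?thesis by (simp add: mult.commute)
  qed
  ultimately show ?thesis by (simp add: \<Delta>_def)
qed

text \<open>\<open>smooth_norm \<circ> u\<close> has Laplacian bounded below, so its mollifications satisfy a
  mean value inequality which is uniform in the mollification parameter.\<close>

lemma very_weak_solution_locally_bounded:
  fixes u f :: "'a::euclidean_space \<Rightarrow> 'b::euclidean_space" and \<rho> :: "nat \<Rightarrow> 'a \<Rightarrow> real"
  assumes \<rho>: "mollifiers \<rho>" and uf: "very_weak_laplacian \<Omega> u f"
    and \<Omega>: "open \<Omega>" and [measurable]: "u \<in> borel_measurable borel"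
    and u: "\<And>K. compact K \<Longrightarrow> K \<subseteq> \<Omega> \<Longrightarrow> integrable lborel (\<lambda>y. indicator K y *\<^sub>R u y)"
    and f: "\<And>K. compact K \<Longrightarrow> K \<subseteq> \<Omega> \<Longrightarrow> integrable lborel (\<lambda>y. indicator K y *\<^sub>R f y)"
    and C: "\<And>x. - C \<le> (u x \<bullet> f x) / smooth_norm (u x)"
    and K: "compact K" "K \<subseteq> \<Omega>"
  shows "\<exists>B. AE x in lborel. x \<in> K \<longrightarrow> norm (u x) \<le> B"
proof -
  obtain e where e: "e > 0" "(\<Union>x\<in>K. cball x e) \<subseteq> \<Omega>"
    using compact_subset_open_imp_cball_epsilon_subset[OF K(1) \<Omega> K(2)] by blast
  define d where "d = e / 3"
  have d: "d > 0" using e by (simp add: d_def)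
  define K1 where "K1 = (\<Union>x\<in>K. cball x d)"
  define K2 where "K2 = (\<Union>x\<in>K1. cball x d)"
  define K3 where "K3 = (\<Union>x\<in>K2. cball x d)"
  have cK: "compact K1" "compact K2" "compact K3"
    unfolding K1_def K2_def K3_def by (intro compact_minkowski_sum_cball K)+
  have sub12: "K2 \<subseteq> K3" using d unfolding K3_def by force
  have sub3: "K3 \<subseteq> \<Omega>"
  proof
    fix z assume "z \<in> K3"
    then obtain x y y' where "x \<in> K" "dist x y \<le> d" "dist y y' \<le> d" "dist y' z \<le> d"
      unfolding K3_def K2_def K1_def by auto
    then have "dist x z \<le> e"
      using dist_triangle[of x z y] dist_triangle[of y z y'] by (simp add: d_def)
    then have "z \<in> (\<Union>x\<in>K. cball x e)" using \<open>x \<in> K\<close> by auto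
    then show "z \<in> \<Omega>" using e(2) by blast
  qed
  define g where "g y = indicator K3 y *\<^sub>R smooth_norm (u y)" for y
  have K3m [measurable]: "K3 \<in> sets borel" using cK(3) by (intro borel_closed compact_imp_closed)
  have g: "integrable lborel g"
  proof (rule Bochner_Integration.integrable_bound[where f="\<lambda>y. indicator K3 y + norm (indicator K3 y *\<^sub>R u y)"])
    show "integrable lborel (\<lambda>y. indicator K3 y + norm (indicator K3 y *\<^sub>R u y) :: real)"
      using emeasure_compact_finite[OF cK(3)]
      by (intro Bochner_Integration.integrable_add integrable_real_indicator integrable_norm u cK(3) sub3) auto
    show "g \<in> borel_measurable lborel" unfolding g_def[abs_def] by measurable
    show "AE y in lborel. norm (g y) \<le> norm (indicator K3 y + norm (indicator K3 y *\<^sub>R u y))"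
    proof (rule AE_I2)
      show "norm (g y) \<le> norm (indicator K3 y + norm (indicator K3 y *\<^sub>R u y))" for y
        using smooth_norm_le[of "u y"] smooth_norm_ge(3)[of "u y"] by (auto simp: g_def indicator_def)
    qed
  qed
  obtain s where s: "strict_mono s" "AE x in lborel. (\<lambda>n. conv (\<rho> (s n)) g x) \<longlonglongrightarrow> g x"
    using mollifiers_AE_subseq[OF \<rho> g] by blast
  define \<eta> where "\<eta> n = \<rho> (s n)" for n
  have \<eta>: "mollifiers \<eta>" unfolding \<eta>_def[abs_def] by (rule mollifiers_subseq[OF \<rho> s(1)])
  define G where "G = (\<integral>x. \<bar>g x\<bar> \<partial>lborel)"
  define A where "A = integral\<^sup>L lborel (bump :: 'a \<Rightarrow> real)"
  have A: "A > 0" unfolding A_def by (rule integral_bump_pos)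
  define M where "M = ((G + 1) / d ^ DIM('a) + C * d\<^sup>2 / 2 * integral\<^sup>L lborel (bump_potential :: 'a \<Rightarrow> real)) / A"
  have "\<forall>\<^sub>F n in sequentially. (\<integral>x. norm (conv (\<eta> n) g x - g x) \<partial>lborel) < 1"
    by (rule order_tendstoD(2)[OF mollifiers_L1(2)[OF \<eta> g]]) simp
  then have bound: "\<forall>\<^sub>F n in sequentially. \<forall>x\<in>K. conv (\<eta> n) g x \<le> M"
    using mollifiers_L1(1)[OF \<eta> g] mollifiers_eventually[OF \<eta> d]
  proof eventually_elim
    case (elim n)
    note m = mollifierD[OF elim(3)]
    have ng: "(\<lambda>x. conv (\<eta> n) g x - g x) \<in> borel_measurable lborel"
      using conv_measurable[OF m(1) g] borel_measurable_integrable[OF g] by measurable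
    have id: "integrable lborel (\<lambda>x. conv (\<eta> n) g x - g x)"
      using elim(2) integrable_norm_iff[OF ng] by simp
    have ic: "integrable lborel (conv (\<eta> n) g)"
      using Bochner_Integration.integrable_add[OF id g] by simp
    have "(\<integral>x. \<bar>conv (\<eta> n) g x\<bar> \<partial>lborel) \<le> (\<integral>x. norm (conv (\<eta> n) g x - g x) + \<bar>g x\<bar> \<partial>lborel)"
      using ic id g by (intro integral_mono) auto
    also have "\<dots> \<le> G + 1" using id g elim(1) by (simp add: G_def)
    finally have n1: "(\<integral>x. \<bar>conv (\<eta> n) g x\<bar> \<partial>lborel) \<le> G + 1" .
    show ?case
    proof
      fix x assume x: "x \<in> K"
      have "- C \<le> (\<Sum>i\<in>Basis. conv (pd i (pd i (\<eta> n))) g z)" if z: "z \<in> ball x d" for z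
      proof -
        have zK1: "z \<in> K1" using z x unfolding K1_def by (auto intro: less_imp_le)
        then have zK2: "cball z d \<subseteq> K2" unfolding K2_def by blast
        define \<psi> where "\<psi> y = \<eta> n (z - y)" for y
        have \<psi>: "\<psi> x \<noteq> 0 \<Longrightarrow> x \<in> cball z d" for x
          using m(3)[of "z - x"] by (auto simp: \<psi>_def dist_norm)
        have t\<psi>: "\<psi> \<in> test_functions UNIV"
          unfolding \<psi>_def by (rule test_functions_reflect[OF m(1), of "cball z d"]) (use \<psi> in \<open>auto simp: \<psi>_def\<close>)
        have "- C * integral\<^sup>L lborel \<psi> \<le> (\<integral>x. (\<Sum>i\<in>Basis. pd i (pd i \<psi>) x) * smooth_norm (u x) \<partial>lborel)"
        proof (rule weak_smooth_norm_laplacian_ge[OF \<rho> uf sub3 cK(2) sub12 d])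
          show "cball x d \<subseteq> K3" if "x \<in> K2" for x using that unfolding K3_def by blast
          show "x \<in> K2" if "\<psi> x \<noteq> 0" for x using \<psi>[OF that] zK2 by blast
          show "0 \<le> \<psi> x" for x by (simp add: \<psi>_def m(2))
        qed (use u[OF cK(3) sub3] f[OF cK(3) sub3] C t\<psi> in auto)
        moreover have "integral\<^sup>L lborel \<psi> = 1"
          unfolding \<psi>_def[abs_def] using integral_lborel_reflect(1)[OF m(6), of z] m(4) by simp
        moreover have "(\<integral>x. (\<Sum>i\<in>Basis. pd i (pd i \<psi>) x) * smooth_norm (u x) \<partial>lborel)
          = (\<Sum>i\<in>Basis. conv (pd i (pd i (\<eta> n))) g z)"
        proof -
          have tdd: "pd i (pd i (\<eta> n)) \<in> test_functions UNIV" if "i \<in> Basis" for i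
            by (rule test_functions_pd[OF test_functions_pd[OF m(1) that] that])
          have s1: "norm y \<le> d" if "pd i (\<eta> n) y \<noteq> 0" for i y
            using pd_support[where S="cball 0 d" and \<rho>="\<eta> n", OF _ _ that] m(3) by (force intro: less_imp_le)
          have s2: "norm y \<le> d" if "pd i (pd i (\<eta> n)) y \<noteq> 0" for i y
            using pd_support[where S="cball 0 d" and \<rho>="pd i (\<eta> n)", OF _ _ that] s1 by simp
          have "(\<Sum>i\<in>Basis. conv (pd i (pd i (\<eta> n))) g z) =
             (\<integral>y. (\<Sum>i\<in>Basis. pd i (pd i (\<eta> n)) (z - y) *\<^sub>R g y) \<partial>lborel)"
            unfolding conv_def
            by (rule Bochner_Integration.integral_sum[symmetric]) (rule integrable_conv[OF tdd g])
          also have "\<dots> = (\<integral>y. (\<Sum>i\<in>Basis. pd i (pd i \<psi>) y) * smooth_norm (u y) \<partial>lborel)"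
          proof (rule Bochner_Integration.integral_cong[OF refl])
            fix y
            have eq: "pd i (pd i (\<eta> n)) (z - y) *\<^sub>R g y = pd i (pd i (\<eta> n)) (z - y) * smooth_norm (u y)" for i
            proof (cases "pd i (pd i (\<eta> n)) (z - y) = 0")
              case False
              then have "y \<in> cball z d" using s2 by (simp add: dist_norm)
              then have "y \<in> K3" using zK2 sub12 by blast
              then show ?thesis by (simp add: g_def)
            qed simp
            show "(\<Sum>i\<in>Basis. pd i (pd i (\<eta> n)) (z - y) *\<^sub>R g y) = (\<Sum>i\<in>Basis. pd i (pd i \<psi>) y) * smooth_norm (u y)"
              unfolding \<psi>_def[abs_def] eq sum_distrib_right
              by (intro sum.cong refl) (simp add: pd_pd_reflect[OF m(1)])
          qed
          finally show ?thesis by simp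
        qed
        ultimately show ?thesis by simp
      qed
      from conv_subharmonic_bound[OF m(1) g d this ic]
      have "conv (\<eta> n) g x * A \<le> (\<integral>x. \<bar>conv (\<eta> n) g x\<bar> \<partial>lborel) / d ^ DIM('a) + C * d\<^sup>2 / 2 * integral\<^sup>L lborel (bump_potential :: 'a \<Rightarrow> real)"
        by (simp add: A_def)
      also have "\<dots> \<le> M * A"
        using n1 A d by (simp add: M_def divide_right_mono)
      finally show "conv (\<eta> n) g x \<le> M" using A by simp
    qed
  qed
  have "AE x in lborel. x \<in> K \<longrightarrow> norm (u x) \<le> M"
    using s(2)
  proof (rule AE_mp, intro AE_I2 impI)
    fix x assume l: "(\<lambda>n. conv (\<rho> (s n)) g x) \<longlonglongrightarrow> g x" and x: "x \<in> K"
    have "g x \<le> M"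
    proof (rule tendsto_upperbound[OF l])
      show "\<forall>\<^sub>F n in sequentially. conv (\<rho> (s n)) g x \<le> M"
        using bound by (rule eventually_mono) (use x in \<open>auto simp: \<eta>_def\<close>)
    qed simp
    moreover have "x \<in> K3"
    proof -
      have self: "x \<in> cball x d" using d by simp
      have "x \<in> K1" unfolding K1_def using x self by blast
      then have "x \<in> K2" unfolding K2_def using self by blast
      then show ?thesis unfolding K3_def using self by blast
    qed
    ultimately show "norm (u x) \<le> M" using smooth_norm_ge(2)[of "u x"] by (simp add: g_def)
  qed
  then show ?thesis ..
qed

section \<open>The stress-energy identity for weak solutions\<close>

lemma conv_weak_derivative:
  fixes \<rho> :: "'a::euclidean_space \<Rightarrow> real" and u g :: "'a \<Rightarrow> 'b::euclidean_space"
  assumes ug: "\<And>\<phi>::'a \<Rightarrow> real. \<phi> \<in> test_functions \<Omega> \<Longrightarrow>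
      (\<integral>x. pd i \<phi> x *\<^sub>R u x \<partial>lborel) = - (\<integral>x. \<phi> x *\<^sub>R g x \<partial>lborel)"
    and K: "K \<subseteq> \<Omega>"
    and \<rho>: "\<rho> \<in> test_functions UNIV" "\<And>z. \<rho> z \<noteq> 0 \<Longrightarrow> norm z \<le> r" and x: "cball x r \<subseteq> K"
  shows "conv (pd i \<rho>) (\<lambda>y. indicator K y *\<^sub>R u y) x = conv \<rho> (\<lambda>y. indicator K y *\<^sub>R g y) x"
proof -
  have t: "(\<lambda>y. \<rho> (x - y)) \<in> test_functions \<Omega>"
  proof (rule test_functions_reflect[OF \<rho>(1), of "cball x r"])
    show "\<rho> (x - y) \<noteq> 0 \<Longrightarrow> y \<in> cball x r" for y using \<rho>(2)[of "x - y"] by (simp add: dist_norm)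
  qed (use x K in auto)
  have s1: "norm z \<le> r" if "pd i \<rho> z \<noteq> 0" for z
    using pd_support[where S="cball 0 r" and \<rho>=\<rho>, OF _ _ that] \<rho>(2) by simp
  have "conv (pd i \<rho>) (\<lambda>y. indicator K y *\<^sub>R u y) x = (\<integral>y. pd i \<rho> (x - y) *\<^sub>R u y \<partial>lborel)"
    by (rule conv_restrict[OF s1 x])
  also have "\<dots> = - (\<integral>y. pd i (\<lambda>y. \<rho> (x - y)) y *\<^sub>R u y \<partial>lborel)"
    unfolding frechet_derivative_reflect[OF \<rho>(1)] by simp
  also have "\<dots> = (\<integral>y. \<rho> (x - y) *\<^sub>R g y \<partial>lborel)"
    using ug[OF t] by simp
  also have "\<dots> = conv \<rho> (\<lambda>y. indicator K y *\<^sub>R g y) x"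
    by (rule conv_restrict[OF \<rho>(2) x, symmetric])
  finally show ?thesis .
qed

lemma conv_AE_bound:
  fixes w :: "'a::euclidean_space \<Rightarrow> 'b::euclidean_space"
  assumes \<rho>: "mollifier r \<rho>" and w: "integrable lborel w" and B: "AE x in lborel. norm (w x) \<le> B"
  shows "norm (conv \<rho> w x) \<le> B"
proof -
  note m = mollifierD[OF \<rho>]
  have i: "integrable lborel (\<lambda>y. \<rho> (x - y))"
    using integral_lborel_reflect(2)[OF m(6)] m(5) by simp
  have "norm (conv \<rho> w x) \<le> (\<integral>y. norm (\<rho> (x - y) *\<^sub>R w y) \<partial>lborel)"
    unfolding conv_def by (rule integral_norm_bound)
  also have "\<dots> \<le> (\<integral>y. \<rho> (x - y) * B \<partial>lborel)"
  proof (rule integral_mono_AE)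
    show "integrable lborel (\<lambda>y. norm (\<rho> (x - y) *\<^sub>R w y))"
      by (rule integrable_norm[OF integrable_conv[OF m(1) w]])
    show "AE y in lborel. norm (\<rho> (x - y) *\<^sub>R w y) \<le> \<rho> (x - y) * B"
      using B by (rule AE_mp) (intro AE_I2 impI, simp add: m(2) mult_left_mono)
  qed (use i in auto)
  also have "\<dots> = B"
    using integral_lborel_reflect(1)[OF m(6), of x] m(4) by simp
  finally show ?thesis .
qed

lemma very_weak_laplacianI:
  fixes u f :: "'a::euclidean_space \<Rightarrow> 'b::euclidean_space" and g :: "'a \<Rightarrow> 'a \<Rightarrow> 'b"
  assumes ug: "\<And>i \<phi>::'a \<Rightarrow> real. i \<in> Basis \<Longrightarrow> \<phi> \<in> test_functions \<Omega> \<Longrightarrow>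
      (\<integral>x. pd i \<phi> x *\<^sub>R u x \<partial>lborel) = - (\<integral>x. \<phi> x *\<^sub>R g i x \<partial>lborel)"
    and gf: "\<And>\<phi>::'a \<Rightarrow> real. \<phi> \<in> test_functions \<Omega> \<Longrightarrow>
      (\<integral>x. (\<Sum>i\<in>Basis. pd i \<phi> x *\<^sub>R g i x) \<partial>lborel) = - (\<integral>x. \<phi> x *\<^sub>R f x \<partial>lborel)"
    and u: "\<And>K. compact K \<Longrightarrow> K \<subseteq> \<Omega> \<Longrightarrow> integrable lborel (\<lambda>y. indicator K y *\<^sub>R u y)"
    and g: "\<And>i K. i \<in> Basis \<Longrightarrow> compact K \<Longrightarrow> K \<subseteq> \<Omega> \<Longrightarrow> integrable lborel (\<lambda>y. indicator K y *\<^sub>R g i y)"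
  shows "very_weak_laplacian \<Omega> u f"
  unfolding very_weak_laplacian_def
proof (intro allI impI)
  fix \<phi> :: "'a \<Rightarrow> real" assume \<phi>: "\<phi> \<in> test_functions \<Omega>"
  have int: "integrable lborel (\<lambda>y. \<psi> y *\<^sub>R h y)"
    if \<psi>: "\<psi> \<in> test_functions \<Omega>" and h: "\<And>K. compact K \<Longrightarrow> K \<subseteq> \<Omega> \<Longrightarrow> integrable lborel (\<lambda>y. indicator K y *\<^sub>R h y)"
    for \<psi> :: "'a \<Rightarrow> real" and h :: "'a \<Rightarrow> 'b"
  proof -
    define K where "K = closure {x. \<psi> x \<noteq> 0}"
    have K: "integrable lborel (\<lambda>y. indicator K y *\<^sub>R h y)"
      unfolding K_def by (rule h) (rule test_functionsD[OF \<psi>])+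
    obtain B where B: "\<And>x. norm (\<psi> x) \<le> B" using test_functions_bounded[OF \<psi>] by blast
    have "integrable lborel (\<lambda>y. \<psi> y *\<^sub>R (indicator K y *\<^sub>R h y))"
      using B test_functions_measurable[OF \<psi>] by (intro integrable_bounded_scaleR[OF K]) auto
    moreover have eq: "\<psi> y *\<^sub>R (indicator K y *\<^sub>R h y) = \<psi> y *\<^sub>R h y" for y
      using closure_subset[of "{x. \<psi> x \<noteq> 0}"] by (cases "\<psi> y = 0") (auto simp: K_def)
    ultimately show ?thesis unfolding eq by simp
  qed
  have p: "pd i \<phi> \<in> test_functions \<Omega>" if "i \<in> Basis" for i by (rule test_functions_pd[OF \<phi> that])
  have "(\<integral>x. (\<Sum>i\<in>Basis. pd i (pd i \<phi>) x) *\<^sub>R u x \<partial>lborel) = (\<Sum>i\<in>Basis. \<integral>x. pd i (pd i \<phi>) x *\<^sub>R u x \<partial>lborel)"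
    unfolding scaleR_sum_left
    by (rule Bochner_Integration.integral_sum) (rule int[OF test_functions_pd[OF p] u])
  also have "\<dots> = - (\<Sum>i\<in>Basis. \<integral>x. pd i \<phi> x *\<^sub>R g i x \<partial>lborel)"
    unfolding sum_negf[symmetric] by (intro sum.cong refl ug p)
  also have "(\<Sum>i\<in>Basis. \<integral>x. pd i \<phi> x *\<^sub>R g i x \<partial>lborel) = (\<integral>x. (\<Sum>i\<in>Basis. pd i \<phi> x *\<^sub>R g i x) \<partial>lborel)"
    by (rule Bochner_Integration.integral_sum[symmetric]) (rule int[OF p g])
  also have "- \<dots> = (\<integral>x. \<phi> x *\<^sub>R f x \<partial>lborel)" using gf[OF \<phi>] by simp
  finally show "(\<integral>x. (\<Sum>i\<in>Basis. pd i (pd i \<phi>) x) *\<^sub>R u x \<partial>lborel) = (\<integral>x. \<phi> x *\<^sub>R f x \<partial>lborel)" .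
qed

lemma compose_continuous_tendsto_L2:
  fixes w :: "'a::euclidean_space \<Rightarrow> 'b::euclidean_space" and H :: "'b \<Rightarrow> 'c::euclidean_space"
  assumes K: "compact K" and w: "w \<in> borel_measurable borel" and v: "\<And>n. v n \<in> borel_measurable borel"
    and H: "continuous_on UNIV H"
    and lim: "AE x in lborel. (\<lambda>n. v n x) \<longlonglongrightarrow> w x"
    and B: "\<And>n x. norm (v n x) \<le> B"
  shows "integrable lborel (\<lambda>x. (norm (indicator K x *\<^sub>R H (v n x) - indicator K x *\<^sub>R H (w x)))\<^sup>2)"
    and "(\<lambda>n. \<integral>x. (norm (indicator K x *\<^sub>R H (v n x) - indicator K x *\<^sub>R H (w x)))\<^sup>2 \<partial>lborel) \<longlonglongrightarrow> 0"
    and "AE x in lborel. norm (w x) \<le> B"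
    and "\<exists>b. \<forall>y. norm y \<le> B \<longrightarrow> norm (H y) \<le> b"
proof -
  note [measurable] = w v
  have [measurable]: "H \<in> borel_measurable borel" by (rule borel_measurable_continuous_onI[OF H])
  have [measurable]: "K \<in> sets borel" using K by (intro borel_closed compact_imp_closed)
  show wB: "AE x in lborel. norm (w x) \<le> B"
    using lim
  proof (rule AE_mp, intro AE_I2 impI)
    fix x assume l: "(\<lambda>n. v n x) \<longlonglongrightarrow> w x"
    show "norm (w x) \<le> B"
      by (rule LIMSEQ_le_const2[OF tendsto_norm[OF l]]) (use B in blast)
  qed
  have "bounded (H ` cball 0 B)"
    by (intro compact_imp_bounded compact_continuous_image continuous_on_subset[OF H]) auto
  then obtain b where "\<forall>y\<in>H ` cball 0 B. norm y \<le> b" unfolding bounded_iff by blast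
  then have b: "norm (H y) \<le> b" if "norm y \<le> B" for y using that by simp
  then show "\<exists>b. \<forall>y. norm y \<le> B \<longrightarrow> norm (H y) \<le> b" by blast
  define D where "D n x = (norm (indicator K x *\<^sub>R H (v n x) - indicator K x *\<^sub>R H (w x)))\<^sup>2" for n x
  have dom: "integrable lborel (\<lambda>x. indicator K x * (2 * b)\<^sup>2)"
    using emeasure_compact_finite[OF K] by (intro integrable_mult_left integrable_real_indicator) auto
  have bd: "AE x in lborel. norm (D n x) \<le> indicator K x * (2 * b)\<^sup>2" for n
    using wB
  proof (rule AE_mp, intro AE_I2 impI)
    fix x assume wx: "norm (w x) \<le> B"
    have "norm (H (v n x) - H (w x)) \<le> 2 * b"
      using norm_triangle_ineq4[of "H (v n x)" "H (w x)"] b[OF B[of n x]] b[OF wx] by simp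
    then have "(norm (H (v n x) - H (w x)))\<^sup>2 \<le> (2 * b)\<^sup>2" by (intro power_mono) auto
    then show "norm (D n x) \<le> indicator K x * (2 * b)\<^sup>2" by (auto simp: D_def indicator_def)
  qed
  have Dm [measurable]: "D n \<in> borel_measurable lborel" for n unfolding D_def[abs_def] by measurable
  have "integrable lborel (D n)"
    by (rule Bochner_Integration.integrable_bound[OF dom Dm]) (use bd[of n] in \<open>auto simp: abs_mult\<close>)
  then show "integrable lborel (\<lambda>x. (norm (indicator K x *\<^sub>R H (v n x) - indicator K x *\<^sub>R H (w x)))\<^sup>2)"
    by (simp add: D_def[abs_def])
  have "(\<lambda>n. integral\<^sup>L lborel (D n)) \<longlonglongrightarrow> (\<integral>x. 0 \<partial>(lborel :: 'a measure))"
  proof (rule integral_dominated_convergence[OF _ Dm dom _ bd])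
    show "AE x in lborel. (\<lambda>n. D n x) \<longlonglongrightarrow> 0"
      using lim
    proof (rule AE_mp, intro AE_I2 impI)
      fix x assume l: "(\<lambda>n. v n x) \<longlonglongrightarrow> w x"
      have "isCont H (w x)" using H by (simp add: continuous_on_eq_continuous_at)
      from isCont_tendsto_compose[OF this l]
      have "(\<lambda>n. H (v n x)) \<longlonglongrightarrow> H (w x)" .
      then have "(\<lambda>n. (norm (indicator K x *\<^sub>R H (v n x) - indicator K x *\<^sub>R H (w x)))\<^sup>2) \<longlonglongrightarrow>
          (norm (indicator K x *\<^sub>R H (w x) - indicator K x *\<^sub>R H (w x)))\<^sup>2"
        by (intro tendsto_intros)
      then show "(\<lambda>n. D n x) \<longlonglongrightarrow> 0" by (simp add: D_def)
    qed
  qed auto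
  then show "(\<lambda>n. \<integral>x. (norm (indicator K x *\<^sub>R H (v n x) - indicator K x *\<^sub>R H (w x)))\<^sup>2 \<partial>lborel) \<longlonglongrightarrow> 0"
    by (simp add: D_def[abs_def])
qed

lemma stress_energy_identity_borel:
  fixes u :: "'a::euclidean_space \<Rightarrow> 'b::euclidean_space" and g :: "'a \<Rightarrow> 'a \<Rightarrow> 'b"
    and V :: "'b \<Rightarrow> real" and \<rho> :: "nat \<Rightarrow> 'a \<Rightarrow> real"
  assumes \<rho>: "mollifiers \<rho>" and \<Omega>: "open \<Omega>"
    and um [measurable]: "u \<in> borel_measurable borel"
    and ug: "\<And>i \<phi>::'a \<Rightarrow> real. i \<in> Basis \<Longrightarrow> \<phi> \<in> test_functions \<Omega> \<Longrightarrow>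
      (\<integral>x. pd i \<phi> x *\<^sub>R u x \<partial>lborel) = - (\<integral>x. \<phi> x *\<^sub>R g i x \<partial>lborel)"
    and pde: "\<And>\<phi>::'a \<Rightarrow> real. \<phi> \<in> test_functions \<Omega> \<Longrightarrow>
      (\<integral>x. (\<Sum>i\<in>Basis. pd i \<phi> x *\<^sub>R g i x) \<partial>lborel) = - \<kappa> *\<^sub>R (\<integral>x. \<phi> x *\<^sub>R gV (u x) \<partial>lborel)"
    and u: "\<And>K. compact K \<Longrightarrow> K \<subseteq> \<Omega> \<Longrightarrow> integrable lborel (\<lambda>y. indicator K y *\<^sub>R u y)"
    and g: "\<And>i K. i \<in> Basis \<Longrightarrow> compact K \<Longrightarrow> K \<subseteq> \<Omega> \<Longrightarrow> integrable lborel (\<lambda>y. indicator K y *\<^sub>R g i y)"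
    and g2: "\<And>i K. i \<in> Basis \<Longrightarrow> compact K \<Longrightarrow> K \<subseteq> \<Omega> \<Longrightarrow> integrable lborel (\<lambda>y. (norm (indicator K y *\<^sub>R g i y))\<^sup>2)"
    and f: "\<And>K. compact K \<Longrightarrow> K \<subseteq> \<Omega> \<Longrightarrow> integrable lborel (\<lambda>y. indicator K y *\<^sub>R gV (u y))"
    and V: "\<And>y. (V has_derivative (\<lambda>h. gV y \<bullet> h)) (at y)" and gV: "continuous_on UNIV gV"
    and \<kappa>: "\<kappa> \<ge> 0" and C: "\<And>y. - C \<le> y \<bullet> gV y"
    and \<phi>: "\<phi> \<in> test_functions \<Omega>" and j: "j \<in> Basis"
  shows "(\<Sum>i\<in>Basis. (\<integral>x. pd j \<phi> x * (g i x \<bullet> g i x) \<partial>lborel)) / 2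
    - (\<Sum>i\<in>Basis. (\<integral>x. pd i \<phi> x * (g i x \<bullet> g j x) \<partial>lborel)) = - \<kappa> * (\<integral>x. pd j \<phi> x * V (u x) \<partial>lborel)"
proof -
  have gVm [measurable]: "gV \<in> borel_measurable borel" by (rule borel_measurable_continuous_onI[OF gV])
  have uf: "very_weak_laplacian \<Omega> u (\<lambda>x. \<kappa> *\<^sub>R gV (u x))"
  proof (rule very_weak_laplacianI[OF ug _ u g])
    fix \<phi> :: "'a \<Rightarrow> real" assume \<phi>: "\<phi> \<in> test_functions \<Omega>"
    have eq: "\<phi> x *\<^sub>R \<kappa> *\<^sub>R gV (u x) = \<kappa> *\<^sub>R \<phi> x *\<^sub>R gV (u x)" for x
      by (simp add: mult.commute)
    show "(\<integral>x. (\<Sum>i\<in>Basis. pd i \<phi> x *\<^sub>R g i x) \<partial>lborel) = - (\<integral>x. \<phi> x *\<^sub>R \<kappa> *\<^sub>R gV (u x) \<partial>lborel)"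
      unfolding eq integral_scaleR_right using pde[OF \<phi>] by simp
  qed auto
  have \<kappa>f: "integrable lborel (\<lambda>y. indicator K y *\<^sub>R \<kappa> *\<^sub>R gV (u y))" if "compact K" "K \<subseteq> \<Omega>" for K
    using integrable_scaleR_right[OF f[OF that], of \<kappa>] by (simp add: mult.commute)
  define S where "S = closure {x. \<phi> x \<noteq> 0}"
  have S: "compact S" "S \<subseteq> \<Omega>" unfolding S_def by (rule test_functionsD[OF \<phi>])+
  have \<phi>S: "x \<in> S" if "\<phi> x \<noteq> 0" for x using that closure_subset[of "{x. \<phi> x \<noteq> 0}"] by (auto simp: S_def)
  have pS: "x \<in> S" if "pd i \<phi> x \<noteq> 0" for i x
    by (rule pd_support[OF \<phi>S compact_imp_closed[OF S(1)] that])
  have tp: "pd i \<phi> \<in> test_functions \<Omega>" if "i \<in> Basis" for i by (rule test_functions_pd[OF \<phi> that])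
  obtain d where d: "d > 0" "(\<Union>x\<in>S. cball x d) \<subseteq> \<Omega>"
    using compact_subset_open_imp_cball_epsilon_subset[OF S(1) \<Omega> S(2)] by blast
  define K where "K = (\<Union>x\<in>S. cball x d)"
  have K: "compact K" "K \<subseteq> \<Omega>" "\<And>x. x \<in> S \<Longrightarrow> cball x d \<subseteq> K"
    using d S(1) compact_minkowski_sum_cball[of S d] by (auto simp: K_def)
  have SK: "x \<in> K" if "x \<in> S" for x using K(3)[OF that] d(1) by (metis centre_in_cball less_imp_le subsetD)
  have Km [measurable]: "K \<in> sets borel" using K(1) by (intro borel_closed compact_imp_closed)
  define w where "w y = indicator K y *\<^sub>R u y" for y
  define gK where "gK i y = indicator K y *\<^sub>R g i y" for i y
  define fK where "fK y = indicator K y *\<^sub>R gV (w y)" for y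
  have fK_eq: "fK = (\<lambda>y. indicator K y *\<^sub>R gV (u y))" by (auto simp: fK_def w_def indicator_def)
  have w: "integrable lborel w" unfolding w_def[abs_def] by (rule u[OF K(1,2)])
  have [measurable]: "w \<in> borel_measurable borel" using w by auto
  have gK: "integrable lborel (gK i)" "integrable lborel (\<lambda>x. (norm (gK i x))\<^sup>2)" if "i \<in> Basis" for i
    unfolding gK_def[abs_def] by (rule g[OF that K(1,2)], rule g2[OF that K(1,2)])
  have "\<exists>B. AE x in lborel. x \<in> K \<longrightarrow> norm (u x) \<le> B"
  proof (rule very_weak_solution_locally_bounded[OF \<rho> uf \<Omega> um u \<kappa>f _ K(1,2)])
    show "- (\<kappa> * \<bar>C\<bar>) \<le> (u x \<bullet> \<kappa> *\<^sub>R gV (u x)) / smooth_norm (u x)" for x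
    proof -
      have "\<kappa> * (u x \<bullet> gV (u x)) \<ge> \<kappa> * - \<bar>C\<bar>"
        using C[of "u x"] by (intro mult_left_mono \<kappa>) auto
      moreover have "\<kappa> * \<bar>C\<bar> \<le> (\<kappa> * \<bar>C\<bar>) * smooth_norm (u x)"
        using mult_left_mono[OF smooth_norm_ge(1)[of "u x"], of "\<kappa> * \<bar>C\<bar>"] \<kappa> by simp
      ultimately show ?thesis
        using smooth_norm_ge(3)[of "u x"] by (simp add: le_divide_eq)
    qed
  qed
  then obtain B where B: "AE x in lborel. x \<in> K \<longrightarrow> norm (u x) \<le> B" by blast
  define B0 where "B0 = max B 0"
  have wB: "AE x in lborel. norm (w x) \<le> B0"
    using B by (rule AE_mp) (intro AE_I2 impI, auto simp: w_def indicator_def B0_def)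
  obtain s where s: "strict_mono s" "AE x in lborel. (\<lambda>n. conv (\<rho> (s n)) w x) \<longlonglongrightarrow> w x"
    using mollifiers_AE_subseq[OF \<rho> w] by blast
  define \<eta> where "\<eta> n = \<rho> (s n)" for n
  have \<eta>: "mollifiers \<eta>" unfolding \<eta>_def[abs_def] by (rule mollifiers_subseq[OF \<rho> s(1)])
  have m\<eta>: "mollifier (1 / real (Suc n)) (\<eta> n)" for n using \<eta> by (simp add: mollifiers_def)
  have t\<eta>: "\<eta> n \<in> test_functions UNIV" for n by (rule mollifiers_test[OF \<eta>])
  define v where "v n = conv (\<eta> n) w" for n
  define Gn where "Gn n i = conv (\<eta> n) (gK i)" for n i
  have cv: "continuous_on UNIV (v n)" for n
    unfolding v_def by (rule conv_continuous[OF t\<eta> w])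
  have vm: "v n \<in> borel_measurable borel" for n by (rule borel_measurable_continuous_onI[OF cv])
  have Gm: "Gn n i \<in> borel_measurable borel" if "i \<in> Basis" for n i
    unfolding Gn_def by (rule conv_measurable[OF t\<eta> gK(1)[OF that]])
  have vlim: "AE x in lborel. (\<lambda>n. v n x) \<longlonglongrightarrow> w x" using s(2) by (simp add: v_def \<eta>_def)
  have vB: "norm (v n x) \<le> B0" for n x unfolding v_def by (rule conv_AE_bound[OF m\<eta> w wB])
  note HgV = compose_continuous_tendsto_L2[OF K(1) _ vm gV vlim vB, unfolded fK_def[symmetric]]
  obtain b where b: "\<And>y. norm y \<le> B0 \<Longrightarrow> norm (gV y) \<le> b" using HgV(4) by auto
  have fKm: "fK \<in> borel_measurable borel" unfolding fK_def[abs_def] by measurable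
  have fK1: "integrable lborel fK"
    unfolding fK_eq by (rule f[OF K(1,2)])
  have fK2: "integrable lborel (\<lambda>x. (norm (fK x))\<^sup>2)"
  proof (rule Bochner_Integration.integrable_bound[where f="\<lambda>x. indicator K x * b\<^sup>2"])
    show "integrable lborel (\<lambda>x. indicator K x * b\<^sup>2)"
      using emeasure_compact_finite[OF K(1)] by (intro integrable_mult_left integrable_real_indicator) auto
    show "AE x in lborel. norm ((norm (fK x))\<^sup>2) \<le> norm (indicator K x * b\<^sup>2)"
      using wB by (rule AE_mp) (intro AE_I2 impI, auto simp: fK_def indicator_def intro!: power_mono b)
  qed (use fKm in measurable)
  define Fn where "Fn n = conv (\<eta> n) fK" for n
  have Fm: "Fn n \<in> borel_measurable borel" for n
    unfolding Fn_def by (rule conv_measurable[OF t\<eta> fK1])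
  obtain B1 where B1: "\<And>x. norm (\<phi> x) \<le> B1" using test_functions_bounded[OF \<phi>] by blast
  have "\<exists>b. \<forall>x. norm (pd i \<phi> x) \<le> b" if "i \<in> Basis" for i
    using test_functions_bounded[OF tp[OF that]] by metis
  then obtain B2 where B2: "\<And>i x. i \<in> Basis \<Longrightarrow> norm (pd i \<phi> x) \<le> B2 i" by metis
  have \<phi>m: "\<phi> \<in> borel_measurable lborel" using test_functions_measurable[OF \<phi>] by simp
  have pm: "pd i \<phi> \<in> borel_measurable lborel" if "i \<in> Basis" for i
    using test_functions_measurable[OF tp[OF that]] by simp
  have Gm': "Gn n i \<in> borel_measurable lborel" "gK i \<in> borel_measurable lborel" if "i \<in> Basis" for n i
    using Gm[OF that] borel_measurable_integrable[OF gK(1)[OF that]] by simp_all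
  have GL: "\<forall>\<^sub>F n in sequentially. integrable lborel (\<lambda>x. (norm (Gn n i x - gK i x))\<^sup>2)"
    "(\<lambda>n. \<integral>x. (norm (Gn n i x - gK i x))\<^sup>2 \<partial>lborel) \<longlonglongrightarrow> 0" if "i \<in> Basis" for i
    unfolding Gn_def by (rule mollifiers_L2[OF \<eta> gK[OF that]])+
  have FL: "\<forall>\<^sub>F n in sequentially. integrable lborel (\<lambda>x. (norm (Fn n x - fK x))\<^sup>2)"
    "(\<lambda>n. \<integral>x. (norm (Fn n x - fK x))\<^sup>2 \<partial>lborel) \<longlonglongrightarrow> 0"
    unfolding Fn_def by (rule mollifiers_L2[OF \<eta> fK1 fK2])+
  have GG: "(\<lambda>n. \<integral>x. pd k \<phi> x * (Gn n i x \<bullet> Gn n l x) \<partial>lborel) \<longlonglongrightarrow> (\<integral>x. pd k \<phi> x * (gK i x \<bullet> gK l x) \<partial>lborel)"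
    if "i \<in> Basis" "k \<in> Basis" "l \<in> Basis" for i k l
    using that B2
    by (intro tendsto_integral_inner_L2(1)[where K="B2 k"] Gm' gK(2) GL pm) auto
  have FG: "(\<lambda>n. \<integral>x. \<phi> x * (Fn n x \<bullet> Gn n j x) \<partial>lborel) \<longlonglongrightarrow> (\<integral>x. \<phi> x * (fK x \<bullet> gK j x) \<partial>lborel)"
    using j B1 Fm fKm
    by (intro tendsto_integral_inner_L2(1)[where K=B1] Gm' gK(2) GL \<phi>m FL fK2) auto
  have on_S: "conv (pd i (\<eta> n)) w x = Gn n i x"
      "(\<Sum>i\<in>Basis. conv (pd i (pd i (\<eta> n))) w x) = \<kappa> *\<^sub>R Fn n x"
    if "mollifier d (\<eta> n)" and x: "x \<in> S" and i: "i \<in> Basis" for n x i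
  proof -
    note m = mollifierD[OF that(1)]
    show "conv (pd i (\<eta> n)) w x = Gn n i x"
      unfolding w_def[abs_def] Gn_def gK_def[abs_def]
      by (rule conv_weak_derivative[OF ug[OF i] K(2) m(1) less_imp_le[OF m(3)] K(3)[OF x]])
    have "(\<Sum>i\<in>Basis. conv (pd i (pd i (\<eta> n))) w x) = conv (\<eta> n) (\<lambda>y. indicator K y *\<^sub>R \<kappa> *\<^sub>R gV (u y)) x"
      unfolding w_def[abs_def]
      by (rule conv_laplacian[OF uf K(2) u[OF K(1,2)] m(1) less_imp_le[OF m(3)] K(3)[OF x]])
    also have "\<dots> = \<kappa> *\<^sub>R Fn n x"
    proof -
      have eq: "\<eta> n (x - y) *\<^sub>R indicator K y *\<^sub>R \<kappa> *\<^sub>R gV (u y) = \<kappa> *\<^sub>R \<eta> n (x - y) *\<^sub>R indicator K y *\<^sub>R gV (u y)" for y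
        by (simp add: mult_ac)
      show ?thesis
        unfolding Fn_def fK_eq conv_def eq by (rule integral_scaleR_right)
    qed
    finally show "(\<Sum>i\<in>Basis. conv (pd i (pd i (\<eta> n))) w x) = \<kappa> *\<^sub>R Fn n x" .
  qed
  have stress: "\<kappa> * (\<integral>x. \<phi> x * (fK x \<bullet> gK j x) \<partial>lborel) =
      (\<Sum>i\<in>Basis. (\<integral>x. pd j \<phi> x * (gK i x \<bullet> gK i x) \<partial>lborel)) / 2
      - (\<Sum>i\<in>Basis. (\<integral>x. pd i \<phi> x * (gK i x \<bullet> gK j x) \<partial>lborel))"
  proof (rule LIMSEQ_unique)
    show "(\<lambda>n. \<kappa> * (\<integral>x. \<phi> x * (Fn n x \<bullet> Gn n j x) \<partial>lborel)) \<longlonglongrightarrow> \<kappa> * (\<integral>x. \<phi> x * (fK x \<bullet> gK j x) \<partial>lborel)"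
      by (intro tendsto_intros FG)
    have "(\<lambda>n. (\<Sum>i\<in>Basis. (\<integral>x. pd j \<phi> x * (Gn n i x \<bullet> Gn n i x) \<partial>lborel)) / 2
      - (\<Sum>i\<in>Basis. (\<integral>x. pd i \<phi> x * (Gn n i x \<bullet> Gn n j x) \<partial>lborel))) \<longlonglongrightarrow>
      (\<Sum>i\<in>Basis. (\<integral>x. pd j \<phi> x * (gK i x \<bullet> gK i x) \<partial>lborel)) / 2
      - (\<Sum>i\<in>Basis. (\<integral>x. pd i \<phi> x * (gK i x \<bullet> gK j x) \<partial>lborel))"
      by (intro tendsto_intros GG j) auto
    moreover have "\<forall>\<^sub>F n in sequentially. (\<Sum>i\<in>Basis. (\<integral>x. pd j \<phi> x * (Gn n i x \<bullet> Gn n i x) \<partial>lborel)) / 2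
      - (\<Sum>i\<in>Basis. (\<integral>x. pd i \<phi> x * (Gn n i x \<bullet> Gn n j x) \<partial>lborel)) = \<kappa> * (\<integral>x. \<phi> x * (Fn n x \<bullet> Gn n j x) \<partial>lborel)"
      using mollifiers_eventually[OF \<eta> d(1)]
    proof eventually_elim
      case (elim n)
      have e1: "pd k \<phi> x * (conv (pd i (\<eta> n)) w x \<bullet> conv (pd l (\<eta> n)) w x) = pd k \<phi> x * (Gn n i x \<bullet> Gn n l x)"
        if "i \<in> Basis" "l \<in> Basis" for k i l x
        using on_S(1)[OF elim pS that(1), of x k] on_S(1)[OF elim pS that(2), of x k] by (cases "pd k \<phi> x = 0") auto
      have e2: "\<phi> x * ((\<Sum>i\<in>Basis. conv (pd i (pd i (\<eta> n))) w x) \<bullet> conv (pd j (\<eta> n)) w x) = \<kappa> * (\<phi> x * (Fn n x \<bullet> Gn n j x))" for x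
        using on_S(1)[OF elim \<phi>S j, of x] on_S(2)[OF elim \<phi>S j, of x] by (cases "\<phi> x = 0") auto
      have "\<kappa> * (\<integral>x. \<phi> x * (Fn n x \<bullet> Gn n j x) \<partial>lborel) =
        (\<integral>x. \<phi> x * ((\<Sum>i\<in>Basis. conv (pd i (pd i (\<eta> n))) w x) \<bullet> conv (pd j (\<eta> n)) w x) \<partial>lborel)"
        unfolding e2 by simp
      also have "\<dots> = (\<Sum>i\<in>Basis. (\<integral>x. pd j \<phi> x * (conv (pd i (\<eta> n)) w x \<bullet> conv (pd i (\<eta> n)) w x) \<partial>lborel)) / 2
        - (\<Sum>i\<in>Basis. (\<integral>x. pd i \<phi> x * (conv (pd i (\<eta> n)) w x \<bullet> conv (pd j (\<eta> n)) w x) \<partial>lborel))"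
        by (rule conv_stress_identity[OF t\<eta> w \<phi> j])
      also have "\<dots> = (\<Sum>i\<in>Basis. (\<integral>x. pd j \<phi> x * (Gn n i x \<bullet> Gn n i x) \<partial>lborel)) / 2
        - (\<Sum>i\<in>Basis. (\<integral>x. pd i \<phi> x * (Gn n i x \<bullet> Gn n j x) \<partial>lborel))"
        using j by (simp add: e1 cong: sum.cong)
      finally show ?case by simp
    qed
    ultimately show "(\<lambda>n. \<kappa> * (\<integral>x. \<phi> x * (Fn n x \<bullet> Gn n j x) \<partial>lborel)) \<longlonglongrightarrow>
      (\<Sum>i\<in>Basis. (\<integral>x. pd j \<phi> x * (gK i x \<bullet> gK i x) \<partial>lborel)) / 2
      - (\<Sum>i\<in>Basis. (\<integral>x. pd i \<phi> x * (gK i x \<bullet> gK j x) \<partial>lborel))"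
      by (rule Lim_transform_eventually)
  qed
  have Vc: "continuous_on UNIV V"
    using V by (intro has_derivative_continuous_on) (auto intro: has_derivative_at_withinI)
  have chain: "(\<integral>x. \<phi> x * (fK x \<bullet> gK j x) \<partial>lborel) = - (\<integral>x. pd j \<phi> x * V (w x) \<partial>lborel)"
  proof (rule LIMSEQ_unique)
    define A where "A n x = indicator K x *\<^sub>R gV (v n x)" for n x
    have Am: "A n \<in> borel_measurable lborel" for n
      unfolding A_def[abs_def] using vm[of n] by measurable
    show "(\<lambda>n. \<integral>x. \<phi> x * (A n x \<bullet> Gn n j x) \<partial>lborel) \<longlonglongrightarrow> (\<integral>x. \<phi> x * (fK x \<bullet> gK j x) \<partial>lborel)"
    proof (rule tendsto_integral_inner_L2(1)[where K=B1])
      show "\<forall>\<^sub>F n in sequentially. integrable lborel (\<lambda>x. (norm (A n x - fK x))\<^sup>2)"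
        unfolding A_def using HgV(1) by simp
      show "(\<lambda>n. \<integral>x. (norm (A n x - fK x))\<^sup>2 \<partial>lborel) \<longlonglongrightarrow> 0"
        unfolding A_def using HgV(2) by simp
    qed (use Am Gm'[OF j] GL[OF j] gK(2)[OF j] \<phi>m fKm fK2 B1 in auto)
    have L: "(\<lambda>n. - (\<integral>x. pd j \<phi> x * V (v n x) \<partial>lborel)) \<longlonglongrightarrow> - (\<integral>x. pd j \<phi> x * V (w x) \<partial>lborel)"
    proof (intro tendsto_minus)
      obtain bV where bV: "\<And>y. norm y \<le> B0 \<Longrightarrow> norm (V y) \<le> bV"
        using compose_continuous_tendsto_L2(4)[OF K(1) _ vm Vc vlim vB] by auto
      have Vm [measurable]: "V \<in> borel_measurable borel" by (rule borel_measurable_continuous_onI[OF Vc])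
      show "(\<lambda>n. \<integral>x. pd j \<phi> x * V (v n x) \<partial>lborel) \<longlonglongrightarrow> (\<integral>x. pd j \<phi> x * V (w x) \<partial>lborel)"
      proof (rule integral_dominated_convergence[where w="\<lambda>x. \<bar>pd j \<phi> x\<bar> * bV"])
        show "integrable lborel (\<lambda>x. \<bar>pd j \<phi> x\<bar> * bV)"
          using test_functions_integrable[OF tp[OF j]] by auto
        show "AE x in lborel. (\<lambda>n. pd j \<phi> x * V (v n x)) \<longlonglongrightarrow> pd j \<phi> x * V (w x)"
          using vlim
        proof (rule AE_mp, intro AE_I2 impI)
          fix x assume l: "(\<lambda>n. v n x) \<longlonglongrightarrow> w x"
          have "isCont V (w x)" using Vc by (simp add: continuous_on_eq_continuous_at)
          from isCont_tendsto_compose[OF this l]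
          show "(\<lambda>n. pd j \<phi> x * V (v n x)) \<longlonglongrightarrow> pd j \<phi> x * V (w x)" by (intro tendsto_intros)
        qed
        show "AE x in lborel. norm (pd j \<phi> x * V (v n x)) \<le> \<bar>pd j \<phi> x\<bar> * bV" for n
          using bV[OF vB] by (intro AE_I2) (simp add: abs_mult mult_left_mono)
        show "(\<lambda>x. pd j \<phi> x * V (w x)) \<in> borel_measurable lborel"
          using pm[OF j] by measurable
        show "(\<lambda>x. pd j \<phi> x * V (v n x)) \<in> borel_measurable lborel" for n
          using pm[OF j] vm[of n] by measurable
      qed
    qed
    have "\<forall>\<^sub>F n in sequentially. - (\<integral>x. pd j \<phi> x * V (v n x) \<partial>lborel) = (\<integral>x. \<phi> x * (A n x \<bullet> Gn n j x) \<partial>lborel)"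
      using mollifiers_eventually[OF \<eta> d(1)]
    proof eventually_elim
      case (elim n)
      have "((\<lambda>x. V (v n x)) has_derivative (\<lambda>h. gV (v n x) \<bullet> conv (pd h (\<eta> n)) w x)) (at x)" for x
        unfolding v_def by (rule has_derivative_compose[OF conv_has_derivative[OF t\<eta> w] V])
      moreover have "continuous_on UNIV (\<lambda>x. gV (v n x) \<bullet> conv (pd j (\<eta> n)) w x)"
        by (intro continuous_intros continuous_on_compose2[OF gV cv] conv_continuous[OF test_functions_pd[OF t\<eta> j] w]) auto
      ultimately have "(\<integral>x. \<phi> x * (gV (v n x) \<bullet> conv (pd j (\<eta> n)) w x) \<partial>lborel) = - (\<integral>x. pd j \<phi> x * V (v n x) \<partial>lborel)"
        by (rule integral_by_parts_test_function[OF \<phi> j])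
      moreover have "\<phi> x * (gV (v n x) \<bullet> conv (pd j (\<eta> n)) w x) = \<phi> x * (A n x \<bullet> Gn n j x)" for x
        using on_S(1)[OF elim \<phi>S j, of x] SK[OF \<phi>S, of x] by (cases "\<phi> x = 0") (auto simp: A_def)
      ultimately show ?case by simp
    qed
    from Lim_transform_eventually[OF L this]
    show "(\<lambda>n. \<integral>x. \<phi> x * (A n x \<bullet> Gn n j x) \<partial>lborel) \<longlonglongrightarrow> - (\<integral>x. pd j \<phi> x * V (w x) \<partial>lborel)" .
  qed
  have r1: "pd k \<phi> x * (gK i x \<bullet> gK l x) = pd k \<phi> x * (g i x \<bullet> g l x)" for k i l x
    using SK[OF pS, of x k] by (cases "pd k \<phi> x = 0") (auto simp: gK_def)
  have r2: "pd j \<phi> x * V (w x) = pd j \<phi> x * V (u x)" for x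
    using SK[OF pS, of x j] by (cases "pd j \<phi> x = 0") (auto simp: w_def)
  show ?thesis
    using stress unfolding chain r1 r2 by simp
qed

lemma lebesgue_on_AE_borel:
  fixes f :: "'a::euclidean_space \<Rightarrow> 'b::euclidean_space"
  assumes \<Omega>: "open \<Omega>" and f: "f \<in> borel_measurable (lebesgue_on \<Omega>)"
  obtains F where "F \<in> borel_measurable borel" "AE x in lborel. x \<in> \<Omega> \<longrightarrow> f x = F x"
proof -
  define h where "h x = (if x \<in> \<Omega> then f x else 0)" for x
  have h: "h \<in> borel_measurable lebesgue"
    unfolding h_def[abs_def] using f \<Omega> by (intro borel_measurable_if_I) auto
  have "\<exists>F\<in>borel_measurable lborel. AE x in lborel. h x \<bullet> b = F x" for b
    by (rule completion_ex_borel_measurable_real) (use h in measurable)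
  then obtain F where F: "\<And>b. F b \<in> borel_measurable lborel" "\<And>b. AE x in lborel. h x \<bullet> b = F b x"
    by metis
  show ?thesis
  proof (rule that[of "\<lambda>x. \<Sum>b\<in>Basis. F b x *\<^sub>R b"])
    show "(\<lambda>x. \<Sum>b\<in>Basis. F b x *\<^sub>R b) \<in> borel_measurable borel"
      using F(1) by simp
    have "AE x in lborel. \<forall>b\<in>Basis. h x \<bullet> b = F b x"
      using F(2) by (intro AE_finite_allI) auto
    then show "AE x in lborel. x \<in> \<Omega> \<longrightarrow> f x = (\<Sum>b\<in>Basis. F b x *\<^sub>R b)"
    proof (rule AE_mp, intro AE_I2 impI)
      fix x assume "\<forall>b\<in>Basis. h x \<bullet> b = F b x" "x \<in> \<Omega>"
      then show "f x = (\<Sum>b\<in>Basis. F b x *\<^sub>R b)"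
        using euclidean_representation[of "f x"] by (simp add: h_def cong: sum.cong)
    qed
  qed
qed

lemma integral_lebesgue_on_eq_lborel:
  fixes p q :: "'a::euclidean_space \<Rightarrow> 'b::euclidean_space"
  assumes \<Omega>: "open \<Omega>" and p: "p \<in> borel_measurable (lebesgue_on \<Omega>)" and q: "q \<in> borel_measurable borel"
    and eq: "AE x in lborel. x \<in> \<Omega> \<longrightarrow> p x = q x" and q0: "\<And>x. x \<notin> \<Omega> \<Longrightarrow> q x = 0"
  shows "(LINT x|lebesgue_on \<Omega>. p x) = (\<integral>x. q x \<partial>lborel)"
    and "integrable (lebesgue_on \<Omega>) p \<longleftrightarrow> integrable lborel q"
proof -
  have \<Omega>m: "\<Omega> \<inter> space lebesgue \<in> sets lebesgue" using \<Omega> by auto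
  have pm: "(\<lambda>x. indicator \<Omega> x *\<^sub>R p x) \<in> borel_measurable lebesgue"
    using p borel_measurable_restrict_space_iff[OF \<Omega>m, of p] by simp
  have qm: "q \<in> borel_measurable lebesgue" using q by (intro measurable_completion) auto
  have ae: "AE x in lebesgue. indicator \<Omega> x *\<^sub>R p x = q x"
    by (rule AE_completion, use eq in \<open>rule AE_mp\<close>) (intro AE_I2 impI, use q0 in \<open>auto simp: indicator_def\<close>)
  have "(LINT x|lebesgue_on \<Omega>. p x) = (LINT x|lebesgue. indicator \<Omega> x *\<^sub>R p x)"
    by (rule integral_restrict_space[OF \<Omega>m])
  also have "\<dots> = integral\<^sup>L lebesgue q" by (rule integral_cong_AE[OF pm qm ae])
  also have "\<dots> = (\<integral>x. q x \<partial>lborel)" using q by (intro integral_completion) auto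
  finally show "(LINT x|lebesgue_on \<Omega>. p x) = (\<integral>x. q x \<partial>lborel)" .
  have "integrable (lebesgue_on \<Omega>) p \<longleftrightarrow> integrable lebesgue (\<lambda>x. indicator \<Omega> x *\<^sub>R p x)"
    by (rule integrable_restrict_space[OF \<Omega>m])
  also have "\<dots> \<longleftrightarrow> integrable lebesgue q" by (rule integrable_cong_AE[OF pm qm ae])
  also have "\<dots> \<longleftrightarrow> integrable lborel q" using q by (intro integrable_completion) auto
  finally show "integrable (lebesgue_on \<Omega>) p \<longleftrightarrow> integrable lborel q" .
qed

lemma L1_loc_measurable:
  fixes f :: "'a::euclidean_space \<Rightarrow> 'b::euclidean_space"
  assumes \<Omega>: "open \<Omega>" and f: "L1_loc \<Omega> f"
  shows "f \<in> borel_measurable (lebesgue_on \<Omega>)"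
proof -
  obtain C :: "nat \<Rightarrow> 'a set" where C: "\<And>n. compact (C n)" "\<And>n. C n \<subseteq> \<Omega>" "\<And>n. C n \<subseteq> interior (C (Suc n))" "\<Union>(range C) = \<Omega>"
    using open_Union_compact_subsets[OF \<Omega>] by metis
  have \<Omega>m: "\<Omega> \<inter> space lebesgue \<in> sets lebesgue" using \<Omega> by auto
  have mono: "C m \<subseteq> C n" if "m \<le> n" for m n
    by (rule lift_Suc_mono_le[OF _ that]) (use C(3) interior_subset in blast)
  have "(\<lambda>x. indicator \<Omega> x *\<^sub>R f x) \<in> borel_measurable lebesgue"
  proof (rule borel_measurable_LIMSEQ_metric)
    show "(\<lambda>x. indicator (C n) x *\<^sub>R f x) \<in> borel_measurable lebesgue" for n
      using f C(1,2) unfolding L1_loc_def set_integrable_def by (auto intro: borel_measurable_integrable)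
    fix x
    show "(\<lambda>n. indicator (C n) x *\<^sub>R f x) \<longlonglongrightarrow> indicator \<Omega> x *\<^sub>R f x"
    proof (cases "x \<in> \<Omega>")
      case True
      then obtain N where "x \<in> C N" using C(4) by blast
      then have "\<And>n. n \<ge> N \<Longrightarrow> x \<in> C n" using mono by blast
      then have "\<forall>\<^sub>F n in sequentially. indicator (C n) x *\<^sub>R f x = indicator \<Omega> x *\<^sub>R f x"
        using True by (auto simp: eventually_sequentially intro!: exI[of _ N])
      then show ?thesis by (rule tendsto_eventually)
    next
      case False
      then have "x \<notin> C n" for n using C(2) by blast
      then show ?thesis using False by simp
    qed
  qed
  then show ?thesis using borel_measurable_restrict_space_iff[OF \<Omega>m, of f] by simp
qed

lemma borel_measurable_lebesgue_onI:
  "f \<in> borel_measurable borel \<Longrightarrow> f \<in> borel_measurable (lebesgue_on \<Omega>)"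
  by (intro measurable_restrict_space1 measurable_completion) simp

lemma integral_test_function_lebesgue_on:
  fixes f F :: "'a::euclidean_space \<Rightarrow> 'b::euclidean_space" and \<psi> :: "'a \<Rightarrow> real"
  assumes \<Omega>: "open \<Omega>" and \<psi>: "\<psi> \<in> test_functions \<Omega>" and f: "f \<in> borel_measurable (lebesgue_on \<Omega>)"
    and F: "F \<in> borel_measurable borel" and eq: "AE x in lborel. x \<in> \<Omega> \<longrightarrow> f x = F x"
  shows "(LINT x|lebesgue_on \<Omega>. \<psi> x *\<^sub>R f x) = (\<integral>x. \<psi> x *\<^sub>R F x \<partial>lborel)"
proof (rule integral_lebesgue_on_eq_lborel(1)[OF \<Omega>])
  have \<psi>m: "\<psi> \<in> borel_measurable borel" by (rule test_functions_measurable[OF \<psi>])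
  show "(\<lambda>x. \<psi> x *\<^sub>R f x) \<in> borel_measurable (lebesgue_on \<Omega>)"
    by (intro borel_measurable_scaleR f borel_measurable_lebesgue_onI \<psi>m)
  show "(\<lambda>x. \<psi> x *\<^sub>R F x) \<in> borel_measurable borel"
    by (intro borel_measurable_scaleR F \<psi>m)
  show "AE x in lborel. x \<in> \<Omega> \<longrightarrow> \<psi> x *\<^sub>R f x = \<psi> x *\<^sub>R F x"
    using eq by eventually_elim simp
  show "\<psi> x *\<^sub>R F x = 0" if "x \<notin> \<Omega>" for x
    using that test_functionsD(3)[OF \<psi>] closure_subset[of "{x. \<psi> x \<noteq> 0}"] by auto
qed

lemma L1_loc_borel:
  fixes f F :: "'a::euclidean_space \<Rightarrow> 'b::euclidean_space"
  assumes f: "L1_loc \<Omega> f" and F: "F \<in> borel_measurable borel"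
    and eq: "AE x in lborel. x \<in> \<Omega> \<longrightarrow> f x = F x" and K: "compact K" "K \<subseteq> \<Omega>"
  shows "integrable lborel (\<lambda>y. indicator K y *\<^sub>R F y)"
proof -
  have [measurable]: "K \<in> sets borel" using K(1) by (intro borel_closed compact_imp_closed)
  have q: "(\<lambda>y. indicator K y *\<^sub>R F y) \<in> borel_measurable lborel" using F by measurable
  have i: "integrable lebesgue (\<lambda>y. indicator K y *\<^sub>R f y)"
    using f K unfolding L1_loc_def set_integrable_def by blast
  have "AE y in lborel. indicator K y *\<^sub>R f y = indicator K y *\<^sub>R F y"
    using eq by eventually_elim (use K(2) in \<open>auto simp: indicator_def\<close>)
  then have "integrable lebesgue (\<lambda>y. indicator K y *\<^sub>R F y)"
    using integrable_cong_AE[OF borel_measurable_integrable[OF i] measurable_completion[OF q] AE_completion] i by blast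
  then show ?thesis using integrable_completion[OF q] by simp
qed

lemma multi_well_potential_facts:
  assumes V: "multi_well_potential V"
  shows "0 \<le> V y" "(V has_derivative (\<lambda>h. gradient V y \<bullet> h)) (at y)" "continuous_on UNIV (gradient V)"
    "\<exists>C. \<forall>y. - C \<le> y \<bullet> gradient V y"
proof -
  have sm: "smooth_on UNIV V" and bd: "bdd_below (range V)" and inf: "(INF y. V y) = 0"
    using V by (auto simp: multi_well_potential_def)
  obtain \<alpha> R where R: "\<alpha> > 0" "R > 0" "\<And>y. norm y > R \<Longrightarrow> y \<bullet> gradient V y \<ge> \<alpha> * (norm y)\<^sup>2"
    using V unfolding multi_well_potential_def by blast
  show "0 \<le> V y" using cINF_lower[OF bd, of y] inf by simp
  have C1: "Ck_on (Suc 0) UNIV V" using sm unfolding smooth_on_def by blast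
  then have d: "(V has_derivative frechet_derivative V (at y)) (at y)" for y
    by (simp add: frechet_derivative_works)
  have "frechet_derivative V (at y) = (\<lambda>h. gradient V y \<bullet> h)" for y
  proof
    fix h
    interpret bounded_linear "frechet_derivative V (at y)" by (rule has_derivative_bounded_linear[OF d])
    have "frechet_derivative V (at y) h = (\<Sum>b\<in>Basis. (h \<bullet> b) *\<^sub>R frechet_derivative V (at y) b)"
      by (subst euclidean_representation[of h, symmetric]) (simp only: sum scaleR)
    also have "\<dots> = gradient V y \<bullet> h"
      by (simp add: gradient_def inner_sum_left inner_commute[of h] mult.commute)
    finally show "frechet_derivative V (at y) h = gradient V y \<bullet> h" .
  qed
  then show "(V has_derivative (\<lambda>h. gradient V y \<bullet> h)) (at y)" using d[of y] by metis
  show gc: "continuous_on UNIV (gradient V)"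
    unfolding gradient_def[abs_def] using C1 by (intro continuous_intros) auto
  have "continuous_on UNIV (\<lambda>y. y \<bullet> gradient V y)" by (intro continuous_intros gc)
  then have "bounded ((\<lambda>y. y \<bullet> gradient V y) ` cball 0 R)"
    by (intro compact_imp_bounded compact_continuous_image) (auto intro: continuous_on_subset)
  then obtain b where "\<forall>z\<in>(\<lambda>y. y \<bullet> gradient V y) ` cball 0 R. norm z \<le> b" unfolding bounded_iff by blast
  then have b: "\<bar>y \<bullet> gradient V y\<bar> \<le> b" if "norm y \<le> R" for y using that by simp
  have "- \<bar>b\<bar> \<le> y \<bullet> gradient V y" for y
  proof (cases "norm y \<le> R")
    case True
    then show ?thesis using b[OF True] by linarith
  next
    case False
    have "0 \<le> \<alpha> * (norm y)\<^sup>2" using R(1) by simp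
    then show ?thesis using R(3)[of y] False by linarith
  qed
  then show "\<exists>C. \<forall>y. - C \<le> y \<bullet> gradient V y" by blast
qed

lemma stress_energy_identity:
  fixes u :: "'a::euclidean_space \<Rightarrow> 'b::euclidean_space" and \<phi> :: "'a \<Rightarrow> real"
  assumes \<Omega>: "open \<Omega>" and V: "multi_well_potential V" and \<epsilon>: "\<epsilon> > 0"
    and sol: "H1_solution \<Omega> V \<epsilon> u" and en: "energy \<Omega> V \<epsilon> u < \<infinity>"
    and \<phi>: "\<phi> \<in> test_functions \<Omega>" and j: "j \<in> Basis"
  shows "(\<Sum>i\<in>Basis. LINT x|lebesgue_on \<Omega>. pd j \<phi> x * (weak_partial \<Omega> i u x \<bullet> weak_partial \<Omega> i u x)) / 2
    - (\<Sum>i\<in>Basis. LINT x|lebesgue_on \<Omega>. pd i \<phi> x * (weak_partial \<Omega> i u x \<bullet> weak_partial \<Omega> j u x))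
    = - (1 / \<epsilon>\<^sup>2) * (LINT x|lebesgue_on \<Omega>. pd j \<phi> x * V (u x))"
proof (cases "\<forall>x. \<phi> x = 0")
  case True
  then have "\<phi> = (\<lambda>_. 0)" by auto
  then show ?thesis by simp
next
  case False
  then obtain p where "\<phi> p \<noteq> 0" by blast
  have "\<exists>\<rho>::'a \<Rightarrow> real. mollifier (1 / real (Suc n)) \<rho>" for n
    by (rule mollifier_exists[OF \<phi> \<open>\<phi> p \<noteq> 0\<close>]) simp
  then obtain \<rho> :: "nat \<Rightarrow> 'a \<Rightarrow> real" where \<rho>: "mollifiers \<rho>"
    unfolding mollifiers_def by metis
  note V' = multi_well_potential_facts[OF V]
  have [measurable]: "V \<in> borel_measurable borel" "gradient V \<in> borel_measurable borel"
    using V'(2,3) by (auto intro!: borel_measurable_continuous_onI has_derivative_continuous_on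
      intro: has_derivative_at_withinI)
  obtain C where C: "\<And>y. - C \<le> y \<bullet> gradient V y" using V'(4) by blast
  define wp where "wp e = weak_partial \<Omega> e u" for e
  have H1: "H1_on \<Omega> u" and gVu: "L1_loc \<Omega> (\<lambda>x. gradient V (u x))"
    and pde: "\<And>\<phi>::'a \<Rightarrow> real. \<phi> \<in> test_functions \<Omega> \<Longrightarrow>
        (LINT x|lebesgue_on \<Omega>. (\<Sum>e\<in>Basis. pd e \<phi> x *\<^sub>R wp e x)) =
        - (1 / \<epsilon>\<^sup>2) *\<^sub>R (LINT x|lebesgue_on \<Omega>. \<phi> x *\<^sub>R gradient V (u x))"
    using sol by (auto simp: H1_solution_def wp_def)
  have wp: "has_weak_partial \<Omega> e u (wp e)" if "e \<in> Basis" for e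
    using H1 that unfolding H1_on_def wp_def weak_partial_def by (metis someI_ex)
  have uL: "L1_loc \<Omega> u" using wp[OF j] by (simp add: has_weak_partial_def)
  have um [measurable]: "u \<in> borel_measurable (lebesgue_on \<Omega>)" by (rule L1_loc_measurable[OF \<Omega> uL])
  have wpL: "L1_loc \<Omega> (wp e)" if "e \<in> Basis" for e using wp[OF that] by (simp add: has_weak_partial_def)
  have wpm: "wp e \<in> borel_measurable (lebesgue_on \<Omega>)" if "e \<in> Basis" for e
    by (rule L1_loc_measurable[OF \<Omega> wpL[OF that]])
  obtain U where U [measurable]: "U \<in> borel_measurable borel" and uU: "AE x in lborel. x \<in> \<Omega> \<longrightarrow> u x = U x"
    using lebesgue_on_AE_borel[OF \<Omega> um] by blast
  have "\<exists>F. F \<in> borel_measurable borel \<and> (AE x in lborel. x \<in> \<Omega> \<longrightarrow> wp e x = F x)" if "e \<in> Basis" for e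
    using lebesgue_on_AE_borel[OF \<Omega> wpm[OF that]] by metis
  then obtain G where G: "\<And>e. e \<in> Basis \<Longrightarrow> G e \<in> borel_measurable borel"
      "\<And>e. e \<in> Basis \<Longrightarrow> AE x in lborel. x \<in> \<Omega> \<longrightarrow> wp e x = G e x"
    by metis
  have Vu: "AE x in lborel. x \<in> \<Omega> \<longrightarrow> V (u x) = V (U x)" "AE x in lborel. x \<in> \<Omega> \<longrightarrow> gradient V (u x) = gradient V (U x)"
    by (rule AE_mp[OF uU], intro AE_I2, simp)+
  have gVum: "(\<lambda>x. gradient V (u x)) \<in> borel_measurable (lebesgue_on \<Omega>)" by measurable
  have wpwp: "(LINT x|lebesgue_on \<Omega>. pd k \<phi> x * (wp i x \<bullet> wp l x)) = (\<integral>x. pd k \<phi> x * (G i x \<bullet> G l x) \<partial>lborel)"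
    if "i \<in> Basis" "k \<in> Basis" "l \<in> Basis" for i k l
  proof -
    have "AE x in lborel. x \<in> \<Omega> \<longrightarrow> wp i x \<bullet> wp l x = G i x \<bullet> G l x"
      using G(2)[OF that(1)] G(2)[OF that(3)] by eventually_elim simp
    from integral_test_function_lebesgue_on[OF \<Omega> test_functions_pd[OF \<phi> that(2)] _ _ this]
    show ?thesis using wpm[OF that(1)] wpm[OF that(3)] G(1)[OF that(1)] G(1)[OF that(3)] by simp
  qed
  have VV: "(LINT x|lebesgue_on \<Omega>. pd j \<phi> x * V (u x)) = (\<integral>x. pd j \<phi> x * V (U x) \<partial>lborel)"
    using integral_test_function_lebesgue_on[OF \<Omega> test_functions_pd[OF \<phi> j] _ _ Vu(1)] by simp
  have "(\<Sum>i\<in>Basis. (\<integral>x. pd j \<phi> x * (G i x \<bullet> G i x) \<partial>lborel)) / 2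
    - (\<Sum>i\<in>Basis. (\<integral>x. pd i \<phi> x * (G i x \<bullet> G j x) \<partial>lborel)) = - (1 / \<epsilon>\<^sup>2) * (\<integral>x. pd j \<phi> x * V (U x) \<partial>lborel)"
  proof (rule stress_energy_identity_borel[OF \<rho> \<Omega> U _ _ _ _ _ _ V'(2,3) _ C \<phi> j])
    show "(\<integral>x. pd i \<psi> x *\<^sub>R U x \<partial>lborel) = - (\<integral>x. \<psi> x *\<^sub>R G i x \<partial>lborel)"
      if i: "i \<in> Basis" and \<psi>: "\<psi> \<in> test_functions \<Omega>" for i and \<psi> :: "'a \<Rightarrow> real"
      using wp[OF i] \<psi> integral_test_function_lebesgue_on[OF \<Omega> test_functions_pd[OF \<psi> i] um U uU]
        integral_test_function_lebesgue_on[OF \<Omega> \<psi> wpm[OF i] G(1)[OF i] G(2)[OF i]]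
      unfolding has_weak_partial_def by metis
    show "(\<integral>x. (\<Sum>i\<in>Basis. pd i \<psi> x *\<^sub>R G i x) \<partial>lborel) = - (1 / \<epsilon>\<^sup>2) *\<^sub>R (\<integral>x. \<psi> x *\<^sub>R gradient V (U x) \<partial>lborel)"
      if \<psi>: "\<psi> \<in> test_functions \<Omega>" for \<psi> :: "'a \<Rightarrow> real"
    proof -
      have pm: "pd i \<psi> \<in> borel_measurable borel" if "i \<in> Basis" for i
        by (rule test_functions_measurable[OF test_functions_pd[OF \<psi> that]])
      have "(LINT x|lebesgue_on \<Omega>. (\<Sum>e\<in>Basis. pd e \<psi> x *\<^sub>R wp e x)) = (\<integral>x. (\<Sum>i\<in>Basis. pd i \<psi> x *\<^sub>R G i x) \<partial>lborel)"
      proof (rule integral_lebesgue_on_eq_lborel(1)[OF \<Omega>])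
        show "(\<lambda>x. \<Sum>e\<in>Basis. pd e \<psi> x *\<^sub>R wp e x) \<in> borel_measurable (lebesgue_on \<Omega>)"
          by (intro borel_measurable_sum borel_measurable_scaleR wpm borel_measurable_lebesgue_onI pm)
        show "(\<lambda>x. \<Sum>i\<in>Basis. pd i \<psi> x *\<^sub>R G i x) \<in> borel_measurable borel"
          by (intro borel_measurable_sum borel_measurable_scaleR pm G)
        have "AE x in lborel. \<forall>e\<in>Basis. x \<in> \<Omega> \<longrightarrow> wp e x = G e x"
          using G(2) by (intro AE_finite_allI) auto
        then show "AE x in lborel. x \<in> \<Omega> \<longrightarrow> (\<Sum>e\<in>Basis. pd e \<psi> x *\<^sub>R wp e x) = (\<Sum>i\<in>Basis. pd i \<psi> x *\<^sub>R G i x)"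
          by (rule AE_mp) (intro AE_I2 impI sum.cong refl, simp)
        show "(\<Sum>i\<in>Basis. pd i \<psi> x *\<^sub>R G i x) = 0" if "x \<notin> \<Omega>" for x
        proof -
          have "x \<notin> closure {x. \<psi> x \<noteq> 0}" using test_functionsD(3)[OF \<psi>] that by blast
          from frechet_derivative_eq_0_outside_support[OF this] show ?thesis by simp
        qed
      qed
      moreover have "(LINT x|lebesgue_on \<Omega>. \<psi> x *\<^sub>R gradient V (u x)) = (\<integral>x. \<psi> x *\<^sub>R gradient V (U x) \<partial>lborel)"
        by (rule integral_test_function_lebesgue_on[OF \<Omega> \<psi> gVum _ Vu(2)]) measurable
      ultimately show ?thesis using pde[OF \<psi>] by simp
    qed
    show "integrable lborel (\<lambda>y. indicator K y *\<^sub>R U y)" if "compact K" "K \<subseteq> \<Omega>" for K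
      by (rule L1_loc_borel[OF uL U uU that])
    show "integrable lborel (\<lambda>y. indicator K y *\<^sub>R G i y)" if "i \<in> Basis" "compact K" "K \<subseteq> \<Omega>" for i K
      by (rule L1_loc_borel[OF wpL[OF that(1)] G(1)[OF that(1)] G(2)[OF that(1)] that(2,3)])
    show "integrable lborel (\<lambda>y. indicator K y *\<^sub>R gradient V (U y))" if "compact K" "K \<subseteq> \<Omega>" for K
      by (rule L1_loc_borel[OF gVu _ Vu(2) that]) measurable
    show "integrable lborel (\<lambda>y. (norm (indicator K y *\<^sub>R G i y))\<^sup>2)" if i: "i \<in> Basis" and K: "compact K" "K \<subseteq> \<Omega>" for i K
    proof -
      have [measurable]: "K \<in> sets borel" using K(1) by (intro borel_closed compact_imp_closed)
      have Km: "(indicator K :: 'a \<Rightarrow> real) \<in> borel_measurable (lebesgue_on \<Omega>)"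
        by (rule borel_measurable_lebesgue_onI) measurable
      define E where "E x = \<epsilon> * ((\<Sum>e\<in>Basis. (norm (wp e x))\<^sup>2) / 2) + 1 / \<epsilon> * V (u x)" for x
      have E0: "0 \<le> E x" for x
        using \<epsilon> V'(1) by (auto simp: E_def intro!: add_nonneg_nonneg mult_nonneg_nonneg sum_nonneg)
      have "integrable (lebesgue_on \<Omega>) E"
      proof (rule integrableI_nonneg)
        show "E \<in> borel_measurable (lebesgue_on \<Omega>)"
          unfolding E_def[abs_def] using wpm by measurable
        show "(\<integral>\<^sup>+x. ennreal (E x) \<partial>lebesgue_on \<Omega>) < \<infinity>"
          using en by (simp add: energy_def E_def wp_def)
      qed (use E0 in auto)
      then have iE: "integrable (lebesgue_on \<Omega>) (\<lambda>x. 2 / \<epsilon> * E x)" by simp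
      have "integrable (lebesgue_on \<Omega>) (\<lambda>y. (norm (indicator K y *\<^sub>R wp i y))\<^sup>2)"
      proof (rule Bochner_Integration.integrable_bound[OF iE])
        show "(\<lambda>y. (norm (indicator K y *\<^sub>R wp i y))\<^sup>2) \<in> borel_measurable (lebesgue_on \<Omega>)"
          using wpm[OF i] Km by measurable
        show "AE y in lebesgue_on \<Omega>. norm ((norm (indicator K y *\<^sub>R wp i y))\<^sup>2) \<le> norm (2 / \<epsilon> * E y)"
        proof (rule AE_I2)
          fix y
          have "(norm (wp i y))\<^sup>2 \<le> (\<Sum>e\<in>Basis. (norm (wp e y))\<^sup>2)"
            using i by (intro member_le_sum) auto
          also have "\<dots> = 2 / \<epsilon> * (\<epsilon> * ((\<Sum>e\<in>Basis. (norm (wp e y))\<^sup>2) / 2))" using \<epsilon> by simp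
          also have "\<dots> \<le> 2 / \<epsilon> * E y"
            using \<epsilon> V'(1) unfolding E_def by (intro mult_left_mono) auto
          finally have le: "(norm (wp i y))\<^sup>2 \<le> 2 / \<epsilon> * E y" .
          moreover have "0 \<le> 2 / \<epsilon> * E y" using \<epsilon> E0[of y] by (intro mult_nonneg_nonneg) auto
          ultimately show "norm ((norm (indicator K y *\<^sub>R wp i y))\<^sup>2) \<le> norm (2 / \<epsilon> * E y)"
            by (cases "y \<in> K") (simp_all only: real_norm_def abs_of_nonneg, simp_all)
        qed
      qed
      then show ?thesis
      proof (subst integral_lebesgue_on_eq_lborel(2)[OF \<Omega>, symmetric, where p="\<lambda>y. (norm (indicator K y *\<^sub>R wp i y))\<^sup>2"])
        show "(\<lambda>y. (norm (indicator K y *\<^sub>R wp i y))\<^sup>2) \<in> borel_measurable (lebesgue_on \<Omega>)"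
          using wpm[OF i] Km by measurable
        show "(\<lambda>y. (norm (indicator K y *\<^sub>R G i y))\<^sup>2) \<in> borel_measurable borel"
          using G(1)[OF i] by measurable
        show "AE x in lborel. x \<in> \<Omega> \<longrightarrow> (norm (indicator K x *\<^sub>R wp i x))\<^sup>2 = (norm (indicator K x *\<^sub>R G i x))\<^sup>2"
          using G(2)[OF i] by eventually_elim simp
        show "(norm (indicator K x *\<^sub>R G i x))\<^sup>2 = 0" if "x \<notin> \<Omega>" for x
        proof -
          have "x \<notin> K" using that K(2) by blast
          then show ?thesis by simp
        qed
      qed
    qed
  qed auto
  then show ?thesis
    using j by (simp add: wpwp VV wp_def[symmetric] cong: sum.cong)
qed

section \<open>Passage to the limit\<close>

lemma signed_integral_lincomb_complex:
  fixes \<nu>\<^sub>1 \<nu>\<^sub>2 :: "'a set \<Rightarrow> real" and f :: "'a \<Rightarrow> complex"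
  assumes \<nu>: "vector_measure M \<nu>\<^sub>1" "vector_measure M \<nu>\<^sub>2"
    and f: "f \<in> borel_measurable M" "\<And>x. x \<in> space M \<Longrightarrow> norm (f x) \<le> B"
  shows "signed_integral M (\<lambda>A. a * \<nu>\<^sub>1 A + b * \<nu>\<^sub>2 A) f =
    complex_of_real a * signed_integral M \<nu>\<^sub>1 f + complex_of_real b * signed_integral M \<nu>\<^sub>2 f"
proof -
  have *: "\<bar>Re (f x)\<bar> \<le> B" "\<bar>Im (f x)\<bar> \<le> B" if "x \<in> space M" for x
    using f(2)[OF that] abs_Re_le_cmod[of "f x"] abs_Im_le_cmod[of "f x"] by linarith+
  have m: "(\<lambda>x. Re (f x)) \<in> borel_measurable M" "(\<lambda>x. Im (f x)) \<in> borel_measurable M"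
    using f(1) by measurable
  have R: "signed_integral M (\<lambda>A. a * \<nu>\<^sub>1 A + b * \<nu>\<^sub>2 A) (\<lambda>x. Re (f x)) =
      a * signed_integral M \<nu>\<^sub>1 (\<lambda>x. Re (f x)) + b * signed_integral M \<nu>\<^sub>2 (\<lambda>x. Re (f x))"
    by (rule signed_integral_lincomb[OF \<nu> m(1), of B]) (use * in auto)
  have I: "signed_integral M (\<lambda>A. a * \<nu>\<^sub>1 A + b * \<nu>\<^sub>2 A) (\<lambda>x. Im (f x)) =
      a * signed_integral M \<nu>\<^sub>1 (\<lambda>x. Im (f x)) + b * signed_integral M \<nu>\<^sub>2 (\<lambda>x. Im (f x))"
    by (rule signed_integral_lincomb[OF \<nu> m(2), of B]) (use * in auto)
  show ?thesis
    using signed_integral_complex[OF vector_measure_lincomb[OF \<nu>, of a b] f]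
      signed_integral_complex[OF \<nu>(1) f] signed_integral_complex[OF \<nu>(2) f] R I
    by (simp add: complex_eq_iff)
qed

lemma test_functions_subset_Cc: "\<phi> \<in> test_functions \<Omega> \<Longrightarrow> \<phi> \<in> Cc \<Omega>"
  using test_functions_continuous[of \<phi> \<Omega>] by (simp add: Cc_def test_functions_def)

lemma coord_simps: "coord 1 = 1" "coord 2 = \<i>" "coord 1 \<in> Basis" "coord 2 \<in> Basis"
  by (auto simp: coord_def Basis_complex_def)

theorem lemma1:
  fixes \<Omega> :: "complex set"
    and V :: "real ^ 'k \<Rightarrow> real"
    and M0 :: real
    and \<epsilon> :: "nat \<Rightarrow> real"
    and u :: "nat \<Rightarrow> complex \<Rightarrow> real ^ 'k"
    and r :: "nat \<Rightarrow> nat"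
    and \<zeta> :: "complex set \<Rightarrow> real"
    and \<mu> :: "nat \<Rightarrow> nat \<Rightarrow> complex set \<Rightarrow> real"
  assumes "smooth_bounded_domain \<Omega>"
    and "multi_well_potential V"
    and "M0 > 0"
    and "\<And>n. 0 < \<epsilon> n \<and> \<epsilon> n \<le> 1"
    and "\<epsilon> \<longlonglongrightarrow> 0"
    and "\<And>n. H1_solution \<Omega> V (\<epsilon> n) (u n)"
    and "\<And>n. energy \<Omega> V (\<epsilon> n) (u n) \<le> ennreal M0"
    and "strict_mono r"
    and "weakly_as_measures \<Omega> (\<lambda>n x. V (u (r n) x) / \<epsilon> (r n)) \<zeta>"
    and "\<And>i j. i \<in> {1, 2} \<Longrightarrow> j \<in> {1, 2} \<Longrightarrow>
      weakly_as_measures \<Omega>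
        (\<lambda>n x. \<epsilon> (r n) * (weak_partial \<Omega> (coord i) (u (r n)) x
                          \<bullet> weak_partial \<Omega> (coord j) (u (r n)) x))
        (\<mu> i j)"
  shows "distr_eq_on \<Omega>
    (distr_dzbar (distr_of_measure \<Omega> (limiting_hopf \<mu>)))
    (\<lambda>\<phi>. 2 * distr_dz (distr_of_measure \<Omega> (\<lambda>A. complex_of_real (\<zeta> A))) \<phi>)"
proof -
  have \<Omega>: "open \<Omega>" using assms(1) by (simp add: smooth_bounded_domain_def)
  define S where "S \<nu> f = signed_integral (borel_on \<Omega>) \<nu> f" for \<nu> and f :: "complex \<Rightarrow> real"
  have vm\<mu>: "vector_measure (borel_on \<Omega>) (\<mu> i j)" if "i \<in> {1, 2}" "j \<in> {1, 2}" for i j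
    using assms(10)[OF that] by (simp add: weakly_as_measures_def)
  have vm\<zeta>: "vector_measure (borel_on \<Omega>) \<zeta>"
    using assms(9) by (simp add: weakly_as_measures_def)
  have real_case:
    "S (\<mu> 1 1) (pd 1 \<psi>) - S (\<mu> 2 2) (pd 1 \<psi>) + 2 * S (\<mu> 1 2) (pd \<i> \<psi>) = 2 * S \<zeta> (pd 1 \<psi>)"
    "S (\<mu> 2 2) (pd \<i> \<psi>) - S (\<mu> 1 1) (pd \<i> \<psi>) + 2 * S (\<mu> 1 2) (pd 1 \<psi>) = 2 * S \<zeta> (pd \<i> \<psi>)"
    if \<psi>: "\<psi> \<in> test_functions \<Omega>" for \<psi> :: "complex \<Rightarrow> real"
  proof -
    define P where "P i j e n = (LINT x|lebesgue_on \<Omega>. pd e \<psi> x * (weak_partial \<Omega> i (u (r n)) x \<bullet> weak_partial \<Omega> j (u (r n)) x))" for i j e n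
    define Q where "Q e n = (LINT x|lebesgue_on \<Omega>. pd e \<psi> x * V (u (r n) x))" for e n
    have b: "(1::complex) \<in> Basis" "\<i> \<in> Basis" by (auto simp: Basis_complex_def)
    have Cc: "pd e \<psi> \<in> Cc \<Omega>" if "e \<in> Basis" for e
      by (rule test_functions_subset_Cc[OF test_functions_pd[OF \<psi> that]])
    have P: "(\<lambda>n. \<epsilon> (r n) * P (coord i) (coord j) e n) \<longlonglongrightarrow> S (\<mu> i j) (pd e \<psi>)"
      if "i \<in> {1, 2}" "j \<in> {1, 2}" "e \<in> Basis" for i j e
    proof -
      have "(\<lambda>n. LINT x|lebesgue_on \<Omega>. pd e \<psi> x * (\<epsilon> (r n) * (weak_partial \<Omega> (coord i) (u (r n)) x \<bullet> weak_partial \<Omega> (coord j) (u (r n)) x)))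
          \<longlonglongrightarrow> S (\<mu> i j) (pd e \<psi>)"
        using assms(10)[OF that(1,2)] Cc[OF that(3)] unfolding weakly_as_measures_def S_def by blast
      then show ?thesis by (simp add: P_def mult.left_commute[of _ "\<epsilon> _"])
    qed
    have Q: "(\<lambda>n. Q e n / \<epsilon> (r n)) \<longlonglongrightarrow> S \<zeta> (pd e \<psi>)" if "e \<in> Basis" for e
    proof -
      have "(\<lambda>n. LINT x|lebesgue_on \<Omega>. pd e \<psi> x * (V (u (r n) x) / \<epsilon> (r n))) \<longlonglongrightarrow> S \<zeta> (pd e \<psi>)"
        using assms(9) Cc[OF that] unfolding weakly_as_measures_def S_def by blast
      then show ?thesis by (simp add: Q_def)
    qed
    note P' = P[of 1 1, unfolded coord_simps] P[of 1 2, unfolded coord_simps] P[of 2 2, unfolded coord_simps]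
    have comm: "P \<i> 1 e n = P 1 \<i> e n" for e n by (simp add: P_def inner_commute)
    have id: "(P 1 1 e n + P \<i> \<i> e n) / 2 - (P 1 e 1 n + P \<i> e \<i> n) = - (1 / (\<epsilon> (r n))\<^sup>2) * Q e n" if "e \<in> Basis" for e n
    proof -
      have "energy \<Omega> V (\<epsilon> (r n)) (u (r n)) < \<infinity>"
        using assms(7)[of "r n"] by (rule le_less_trans) simp
      from stress_energy_identity[OF \<Omega> assms(2) _ assms(6) this \<psi> that] assms(4)[of "r n"]
      show ?thesis by (simp add: P_def Q_def Basis_complex_def)
    qed
    have alg: "- (2 * e) * ((A + B) / 2 - (A + D)) = e * A - e * B + 2 * (e * D)"
        "- (2 * e) * ((A + B) / 2 - (D + B)) = e * B - e * A + 2 * (e * D)" for e A B D :: real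
      by (simp_all add: field_simps)
    have scale: "2 * (Q e n / \<epsilon> (r n)) = - (2 * \<epsilon> (r n)) * (- (1 / (\<epsilon> (r n))\<^sup>2) * Q e n)" for e n
      using assms(4)[of "r n"] by (simp add: power2_eq_square)
    have eq1: "(\<lambda>n. 2 * (Q 1 n / \<epsilon> (r n))) = (\<lambda>n. \<epsilon> (r n) * P 1 1 1 n - \<epsilon> (r n) * P \<i> \<i> 1 n + 2 * (\<epsilon> (r n) * P 1 \<i> \<i> n))"
      unfolding scale id[OF b(1), symmetric] by (intro ext) (simp only: comm alg)
    have "(\<lambda>n. 2 * (Q 1 n / \<epsilon> (r n))) \<longlonglongrightarrow> S (\<mu> 1 1) (pd 1 \<psi>) - S (\<mu> 2 2) (pd 1 \<psi>) + 2 * S (\<mu> 1 2) (pd \<i> \<psi>)"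
      unfolding eq1 by (intro tendsto_intros P' b) auto
    then show "S (\<mu> 1 1) (pd 1 \<psi>) - S (\<mu> 2 2) (pd 1 \<psi>) + 2 * S (\<mu> 1 2) (pd \<i> \<psi>) = 2 * S \<zeta> (pd 1 \<psi>)"
      by (rule LIMSEQ_unique) (intro tendsto_intros Q b)
    have eq2: "(\<lambda>n. 2 * (Q \<i> n / \<epsilon> (r n))) = (\<lambda>n. \<epsilon> (r n) * P \<i> \<i> \<i> n - \<epsilon> (r n) * P 1 1 \<i> n + 2 * (\<epsilon> (r n) * P 1 \<i> 1 n))"
      unfolding scale id[OF b(2), symmetric] by (intro ext) (simp only: comm alg)
    have "(\<lambda>n. 2 * (Q \<i> n / \<epsilon> (r n))) \<longlonglongrightarrow> S (\<mu> 2 2) (pd \<i> \<psi>) - S (\<mu> 1 1) (pd \<i> \<psi>) + 2 * S (\<mu> 1 2) (pd 1 \<psi>)"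
      unfolding eq2 by (intro tendsto_intros P' b) auto
    then show "S (\<mu> 2 2) (pd \<i> \<psi>) - S (\<mu> 1 1) (pd \<i> \<psi>) + 2 * S (\<mu> 1 2) (pd 1 \<psi>) = 2 * S \<zeta> (pd \<i> \<psi>)"
      by (rule LIMSEQ_unique) (intro tendsto_intros Q b)
  qed
  show ?thesis
    unfolding distr_eq_on_def
  proof
    fix \<phi> :: "complex \<Rightarrow> complex" assume \<phi>: "\<phi> \<in> test_functions \<Omega>"
    define T where "T \<nu> f = signed_integral (borel_on \<Omega>) \<nu> f" for \<nu> and f :: "complex \<Rightarrow> complex"
    have Re\<phi>: "(\<lambda>x. Re (\<phi> x)) \<in> test_functions \<Omega>" and Im\<phi>: "(\<lambda>x. Im (\<phi> x)) \<in> test_functions \<Omega>"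
      by (rule test_functions_bounded_linear[OF bounded_linear_Re \<phi>], rule test_functions_bounded_linear[OF bounded_linear_Im \<phi>])
    have Re_pd: "pd e (\<lambda>x. Re (\<phi> x)) = (\<lambda>x. Re (pd e \<phi> x))" and Im_pd: "pd e (\<lambda>x. Im (\<phi> x)) = (\<lambda>x. Im (pd e \<phi> x))" for e
      using frechet_derivative_bounded_linear[OF bounded_linear_Re \<phi>] frechet_derivative_bounded_linear[OF bounded_linear_Im \<phi>]
      by auto
    have fm: "pd e \<phi> \<in> borel_measurable (borel_on \<Omega>)" if "e \<in> Basis" for e
      by (rule measurable_restrict_space1[OF test_functions_measurable[OF test_functions_pd[OF \<phi> that]]])
    have bnd: "\<exists>B. \<forall>x. norm (pd e \<phi> x) \<le> B" if "e \<in> Basis" for e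
      using test_functions_bounded[OF test_functions_pd[OF \<phi> that]] by metis
    have T: "T \<nu> (pd e \<phi>) = Complex (S \<nu> (pd e (\<lambda>x. Re (\<phi> x)))) (S \<nu> (pd e (\<lambda>x. Im (\<phi> x))))"
      if "vector_measure (borel_on \<Omega>) \<nu>" "e \<in> Basis" for \<nu> e
      using signed_integral_complex[OF that(1) fm[OF that(2)]] bnd[OF that(2)]
      unfolding T_def S_def Re_pd Im_pd by blast
    have comb: "T (\<lambda>A. a * \<nu> A + b * \<nu>' A) (pd e \<phi>) = of_real a * T \<nu> (pd e \<phi>) + of_real b * T \<nu>' (pd e \<phi>)"
      if "vector_measure (borel_on \<Omega>) \<nu>" "vector_measure (borel_on \<Omega>) \<nu>'" "e \<in> Basis" for a b \<nu> \<nu>' e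
      using signed_integral_lincomb_complex[OF that(1,2) fm[OF that(3)]] bnd[OF that(3)]
      unfolding T_def by blast
    have hopf: "distr_of_measure \<Omega> (limiting_hopf \<mu>) (pd e \<phi>) = T (\<mu> 1 1) (pd e \<phi>) - T (\<mu> 2 2) (pd e \<phi>) - 2 * \<i> * T (\<mu> 1 2) (pd e \<phi>)"
      if e: "e \<in> Basis" for e
      using comb[of "\<mu> 1 1" "\<mu> 2 2" e 1 "-1"] comb[of "\<mu> 1 2" "\<mu> 1 2" e "-2" 0] vm\<mu> e
      by (simp add: distr_of_measure_def complex_measure_integral_def limiting_hopf_def T_def)
    have zeta: "distr_of_measure \<Omega> (\<lambda>A. complex_of_real (\<zeta> A)) (pd e \<phi>) = T \<zeta> (pd e \<phi>)" if e: "e \<in> Basis" for e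
      using comb[of \<zeta> \<zeta> e 0 0] vm\<zeta> e
      by (simp add: distr_of_measure_def complex_measure_integral_def T_def)
    have b: "(1::complex) \<in> Basis" "\<i> \<in> Basis" by (auto simp: Basis_complex_def)
    have v: "vector_measure (borel_on \<Omega>) (\<mu> 1 1)" "vector_measure (borel_on \<Omega>) (\<mu> 2 2)" "vector_measure (borel_on \<Omega>) (\<mu> 1 2)"
      using vm\<mu> by auto
    have e1: "T (\<mu> 1 1) (pd 1 \<phi>) - T (\<mu> 2 2) (pd 1 \<phi>) + 2 * T (\<mu> 1 2) (pd \<i> \<phi>) = 2 * T \<zeta> (pd 1 \<phi>)"
      using real_case(1)[OF Re\<phi>] real_case(1)[OF Im\<phi>]
      unfolding T[OF v(1) b(1)] T[OF v(2) b(1)] T[OF v(3) b(2)] T[OF vm\<zeta> b(1)]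
      by (simp add: complex_eq_iff)
    have e2: "T (\<mu> 2 2) (pd \<i> \<phi>) - T (\<mu> 1 1) (pd \<i> \<phi>) + 2 * T (\<mu> 1 2) (pd 1 \<phi>) = 2 * T \<zeta> (pd \<i> \<phi>)"
      using real_case(2)[OF Re\<phi>] real_case(2)[OF Im\<phi>]
      unfolding T[OF v(1) b(2)] T[OF v(2) b(2)] T[OF v(3) b(1)] T[OF vm\<zeta> b(2)]
      by (simp add: complex_eq_iff)
    have "distr_dzbar (distr_of_measure \<Omega> (limiting_hopf \<mu>)) \<phi> =
       - 1/2 * ((T (\<mu> 1 1) (pd 1 \<phi>) - T (\<mu> 2 2) (pd 1 \<phi>) + 2 * T (\<mu> 1 2) (pd \<i> \<phi>))
         - \<i> * (T (\<mu> 2 2) (pd \<i> \<phi>) - T (\<mu> 1 1) (pd \<i> \<phi>) + 2 * T (\<mu> 1 2) (pd 1 \<phi>)))"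
      unfolding distr_dzbar_def distr_partial_def coord_simps hopf[OF b(1)] hopf[OF b(2)]
      by (simp add: algebra_simps)
    also have "\<dots> = 2 * distr_dz (distr_of_measure \<Omega> (\<lambda>A. complex_of_real (\<zeta> A))) \<phi>"
      unfolding e1 e2 distr_dz_def distr_partial_def coord_simps zeta[OF b(1)] zeta[OF b(2)]
      by (simp add: algebra_simps)
    finally show "distr_dzbar (distr_of_measure \<Omega> (limiting_hopf \<mu>)) \<phi> =
      2 * distr_dz (distr_of_measure \<Omega> (\<lambda>A. complex_of_real (\<zeta> A))) \<phi>" .
  qed
qed

end
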